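(* Let $S_1$ and $S_2$ be Riemann surfaces, and, for $r=1,2$, let $h_r:S_r\to V_r\subseteq U_r$ be a holomap onto a hyperbolic analytic curve $V_r$. Then the following are equivalent: (i) There is a biholomorphic homeomorphism $\phi:V_1\to V_2$. (ii) There are biholomorphic homeomorphisms $\psi:S_1\to S_2$ and $\phi:V_1\to V_2$ such that $h_2\circ\psi=\phi\circ h_1$. (iii) There is a biholomorphic homeomorphism $\psi:S_1\to S_2$ such that $$\{F\circ h_1:F\in O(V_1)\}=\{G\circ h_2\circ\psi:G\in O(V_2)\}.$$ (iv) There is a biholomorphic homeomorphism $\psi:S_1\to S_2$ that pushes forward the connection on $S_1$ induced by $h_1$ to the connection on $S_2$ induced by $h_2$, i.e. $\psi_*(\Gamma_1)=\Gamma_2$.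
   Context: Riemann surfaces are not required to be connected. Hyperbolic analytic curve: a one-dimensional analytic subvariety of a bounded open set; precisely, a set $V\subseteq\mathbb{C}^n$ such that (1) $V$ is relatively closed in some bounded open set $U\subseteq\mathbb{C}^n$; (2) there is a finite set $B\subset V$ such that for every $P\in V\setminus B$ there exist a neighborhood $W$ of $P$ in $\mathbb{C}^n$ and $n-1$ holomorphic functions $F=(F_2,\dots,F_n)$ on $W$ such that $DF$ has rank $n-1$ on $W$ and $V\cap W=\{z\in W:F(z)=0\}$; (3) for every $P\in B$ there exist a neighborhood $W$ of $P$ and finitely many holomorphic tuples $F^j=(F^j_2,\dots,F^j_{n_j})$ on $W$ such that $V\cap W=\bigcup_j\{z\in W:F^j(z)=0\}$. Holomap: a proper holomorphic map $h$ from a Riemann surface $S$ into a bounded open set $U\subseteq\mathbb{C}^n$ such that there is a finite subset $E$ of $S$ with $h$ non-singular and injective on $S\setminus E$. A function on $V\subseteq\mathbb{C}^n$ is holomorphic if near every point of $V$ it is the restriction of a holomorphic function on a neighborhood in $\mathbb{C}^n$; a map from $V_1$ to $V_2$ is holomorphic if its components are; a biholomorphic homeomorphism is a homeomorphism which is holomorphic with holomorphic inverse. $O(V)$ and $O(S)$ denote the holomorphic functions with the topology of uniform convergence on compact sets. For a holomap $h:S\to V$ onto $V$, the connection on $S$ induced by $h$ is the annihilator of $\{F\circ h:F\in O(V)\}$ in the dual of $O(S)$: the set of continuous linear functionals $\Lambda$ on $O(S)$ with $\Lambda(F\circ h)=0$ for all $F\in O(V)$. $\Gamma_r$ denotes the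 connection on $S_r$ induced by $h_r$. For a holomorphic map $\psi:S_1\to S_2$ and a linear functional $\Lambda$ on $O(S_1)$, the push-forward is $\psi_*(\Lambda)[f]=\Lambda[f\circ\psi]$ for $f\in O(S_2)$, and $\psi_*(\Gamma)=\{\psi_*(\Lambda):\Lambda\in\Gamma\}$. *)

theory Defs
  imports "HOL-Analysis.Analysis"
begin

section \<open>Holomorphic functions on open subsets of complex n-space\<close>

definition holomorphic_multi :: "(complex^'n \<Rightarrow> complex) \<Rightarrow> (complex^'n) set \<Rightarrow> bool" where
  "holomorphic_multi F W \<longleftrightarrow>
     (\<forall>z\<in>W. \<exists>D. (F has_derivative D) (at z) \<and> (\<forall>c v. D (c *s v) = c * D v))"

definition complex_gradient :: "(complex^'n \<Rightarrow> complex) \<Rightarrow> complex^'n \<Rightarrow> complex^'n" where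
  "complex_gradient F z = (\<chi> i. frechet_derivative F (at z) (axis i 1))"


section \<open>Hyperbolic analytic curves\<close>

text \<open>The n - 1 defining functions are indexed by 2, ..., n, where n is the cardinality of the
  index type. The rank of their Jacobian matrix is its row rank over the complex numbers, as in
  the library definition of \<^const>\<open>rank\<close>; that constant itself is not applicable because
  the number of rows is not the cardinality of a type.\<close>

definition hyperbolic_analytic_curve :: "(complex^'n) set \<Rightarrow> bool" where
  "hyperbolic_analytic_curve V \<longleftrightarrow>
     (\<exists>U. open U \<and> bounded U \<and> closedin (top_of_set U) V) \<and>
     (\<exists>B. finite B \<and> B \<subseteq> V \<and>
        (\<forall>P\<in>V - B. \<exists>W (F :: nat \<Rightarrow> complex^'n \<Rightarrow> complex).
            open W \<and> P \<in> W \<and>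
            (\<forall>i\<in>{2..CARD('n)}. holomorphic_multi (F i) W) \<and>
            (\<forall>z\<in>W. vec.dim ((\<lambda>i. complex_gradient (F i) z) ` {2..CARD('n)}) = CARD('n) - 1) \<and>
            V \<inter> W = {z\<in>W. \<forall>i\<in>{2..CARD('n)}. F i z = 0}) \<and>
        (\<forall>P\<in>B. \<exists>W k (N :: nat \<Rightarrow> nat) (F :: nat \<Rightarrow> nat \<Rightarrow> complex^'n \<Rightarrow> complex).
            open W \<and> P \<in> W \<and>
            (\<forall>j<k. \<forall>i\<in>{2..N j}. holomorphic_multi (F j i) W) \<and>
            V \<inter> W = (\<Union>j<k. {z\<in>W. \<forall>i\<in>{2..N j}. F j i z = 0})))"

definition holomorphic_on_curve :: "(complex^'n) set \<Rightarrow> (complex^'n \<Rightarrow> complex) \<Rightarrow> bool" where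
  "holomorphic_on_curve V f \<longleftrightarrow>
     (\<forall>P\<in>V. \<exists>W F. open W \<and> P \<in> W \<and> holomorphic_multi F W \<and> (\<forall>z\<in>V \<inter> W. f z = F z))"

text \<open>Functions on a set are represented by the \<^const>\<open>extensional\<close> functions, so
  that equality of such functions is equality on that set.\<close>

definition O_curve :: "(complex^'n) set \<Rightarrow> (complex^'n \<Rightarrow> complex) set" where
  "O_curve V = {f \<in> extensional V. holomorphic_on_curve V f}"

definition holomorphic_curve_map ::
    "(complex^'n) set \<Rightarrow> (complex^'m) set \<Rightarrow> (complex^'n \<Rightarrow> complex^'m) \<Rightarrow> bool" where
  "holomorphic_curve_map V1 V2 \<phi> \<longleftrightarrow>
     \<phi> ` V1 \<subseteq> V2 \<and> (\<forall>i. holomorphic_on_curve V1 (\<lambda>z. \<phi> z $ i))"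

definition biholomorphic_curve_map ::
    "(complex^'n) set \<Rightarrow> (complex^'m) set \<Rightarrow> (complex^'n \<Rightarrow> complex^'m) \<Rightarrow> bool" where
  "biholomorphic_curve_map V1 V2 \<phi> \<longleftrightarrow>
     (\<exists>\<phi>'. homeomorphism V1 V2 \<phi> \<phi>' \<and>
        holomorphic_curve_map V1 V2 \<phi> \<and> holomorphic_curve_map V2 V1 \<phi>')"


section \<open>Riemann surfaces\<close>

text \<open>A Riemann surface is given by a topology together with an atlas of pairs of a chart
  domain and a chart map. The atlas need not be maximal. Neither connectedness nor second
  countability is required.\<close>

record 'a surface =
  surface_top :: "'a topology"
  atlas :: "('a set \<times> ('a \<Rightarrow> complex)) set"

abbreviation points :: "'a surface \<Rightarrow> 'a set" where
  "points S \<equiv> topspace (surface_top S)"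

definition riemann_surface :: "'a surface \<Rightarrow> bool" where
  "riemann_surface S \<longleftrightarrow>
     Hausdorff_space (surface_top S) \<and>
     points S = (\<Union>(W, c)\<in>atlas S. W) \<and>
     (\<forall>(W, c)\<in>atlas S. openin (surface_top S) W \<and> open (c ` W) \<and>
        homeomorphic_map (subtopology (surface_top S) W) (top_of_set (c ` W)) c) \<and>
     (\<forall>(W, c)\<in>atlas S. \<forall>(W', c')\<in>atlas S.
        (c' \<circ> inv_into W c) holomorphic_on (c ` (W \<inter> W')))"

definition holomorphic_on_surface :: "'a surface \<Rightarrow> ('a \<Rightarrow> complex) \<Rightarrow> bool" where
  "holomorphic_on_surface S f \<longleftrightarrow>
     (\<forall>(W, c)\<in>atlas S. (f \<circ> inv_into W c) holomorphic_on (c ` W))"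

definition O_surface :: "'a surface \<Rightarrow> ('a \<Rightarrow> complex) set" where
  "O_surface S = {f \<in> extensional (points S). holomorphic_on_surface S f}"

definition holomorphic_surface_map :: "'a surface \<Rightarrow> 'b surface \<Rightarrow> ('a \<Rightarrow> 'b) \<Rightarrow> bool" where
  "holomorphic_surface_map S1 S2 \<psi> \<longleftrightarrow>
     continuous_map (surface_top S1) (surface_top S2) \<psi> \<and>
     (\<forall>(W, c)\<in>atlas S1. \<forall>(W', c')\<in>atlas S2.
        (c' \<circ> \<psi> \<circ> inv_into W c) holomorphic_on (c ` (W \<inter> \<psi> -` W')))"

definition biholomorphic_surface_map :: "'a surface \<Rightarrow> 'b surface \<Rightarrow> ('a \<Rightarrow> 'b) \<Rightarrow> bool" where
  "biholomorphic_surface_map S1 S2 \<psi> \<longleftrightarrow>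
     (\<exists>\<psi>'. homeomorphic_maps (surface_top S1) (surface_top S2) \<psi> \<psi>' \<and>
        holomorphic_surface_map S1 S2 \<psi> \<and> holomorphic_surface_map S2 S1 \<psi>')"


section \<open>Holomaps\<close>

definition nonsingular_at :: "'a surface \<Rightarrow> ('a \<Rightarrow> complex^'n) \<Rightarrow> 'a \<Rightarrow> bool" where
  "nonsingular_at S h p \<longleftrightarrow>
     (\<forall>(W, c)\<in>atlas S. p \<in> W \<longrightarrow> (\<exists>i. deriv (\<lambda>t. h (inv_into W c t) $ i) (c p) \<noteq> 0))"

definition holomap :: "'a surface \<Rightarrow> (complex^'n) set \<Rightarrow> ('a \<Rightarrow> complex^'n) \<Rightarrow> bool" where
  "holomap S U h \<longleftrightarrow>
     open U \<and> bounded U \<and>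
     h ` points S \<subseteq> U \<and>
     (\<forall>i. holomorphic_on_surface S (\<lambda>p. h p $ i)) \<and>
     proper_map (surface_top S) (top_of_set U) h \<and>
     (\<exists>E. finite E \<and> E \<subseteq> points S \<and>
        (\<forall>p\<in>points S - E. nonsingular_at S h p) \<and> inj_on h (points S - E))"


section \<open>Connections\<close>

text \<open>The topology of uniform convergence on compact sets. Continuous linear functionals are
  likewise \<^const>\<open>extensional\<close>, on the space of holomorphic functions, and the
  vector space operations on that space are the pointwise ones.\<close>

definition ucc_open :: "'a surface \<Rightarrow> ('a \<Rightarrow> complex) set \<Rightarrow> bool" where
  "ucc_open S \<U> \<longleftrightarrow>
     \<U> \<subseteq> O_surface S \<and>
     (\<forall>f\<in>\<U>. \<exists>K e. compactin (surface_top S) K \<and> e > 0 \<and>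
        {g \<in> O_surface S. \<forall>x\<in>K. dist (g x) (f x) < e} \<subseteq> \<U>)"

lemma istopology_ucc_open: "istopology (ucc_open S)"
  unfolding istopology_def
proof (intro conjI allI impI)
  fix A B assume A: "ucc_open S A" and B: "ucc_open S B"
  show "ucc_open S (A \<inter> B)"
    unfolding ucc_open_def
  proof (intro conjI ballI)
    show "A \<inter> B \<subseteq> O_surface S" using A by (auto simp: ucc_open_def)
    fix f assume f: "f \<in> A \<inter> B"
    obtain K e where 1: "compactin (surface_top S) K" "e > 0"
        "{g \<in> O_surface S. \<forall>x\<in>K. dist (g x) (f x) < e} \<subseteq> A"
      using A f unfolding ucc_open_def by blast
    obtain L d where 2: "compactin (surface_top S) L" "d > 0"
        "{g \<in> O_surface S. \<forall>x\<in>L. dist (g x) (f x) < d} \<subseteq> B"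
      using B f unfolding ucc_open_def by blast
    have "compactin (surface_top S) (K \<union> L)" "min e d > 0"
      using 1 2 by (auto intro: compactin_Un)
    moreover have "{g \<in> O_surface S. \<forall>x\<in>K \<union> L. dist (g x) (f x) < min e d} \<subseteq> A \<inter> B"
      using 1(3) 2(3) by auto
    ultimately show "\<exists>K e. compactin (surface_top S) K \<and> e > 0 \<and>
        {g \<in> O_surface S. \<forall>x\<in>K. dist (g x) (f x) < e} \<subseteq> A \<inter> B" by blast
  qed
next
  fix \<K> assume "\<forall>A\<in>\<K>. ucc_open S A"
  then show "ucc_open S (\<Union>\<K>)"
    unfolding ucc_open_def by (meson Sup_least UnionE Union_upper subset_trans)
qed

definition O_topology :: "'a surface \<Rightarrow> ('a \<Rightarrow> complex) topology" where
  "O_topology S = topology (ucc_open S)"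

lemma openin_O_topology: "openin (O_topology S) = ucc_open S"
  by (simp add: O_topology_def istopology_ucc_open)

lemma topspace_O_topology [simp]: "topspace (O_topology S) = O_surface S"
proof -
  have "openin (O_topology S) (O_surface S)"
    unfolding openin_O_topology ucc_open_def
    by (auto intro!: exI[of _ "{}"] exI[of _ "1::real"])
  moreover have "topspace (O_topology S) \<subseteq> O_surface S"
    using openin_topspace[of "O_topology S"] unfolding openin_O_topology ucc_open_def by blast
  ultimately show ?thesis
    by (simp add: openin_subset subset_antisym)
qed

definition O_dual :: "'a surface \<Rightarrow> (('a \<Rightarrow> complex) \<Rightarrow> complex) set" where
  "O_dual S = {\<Lambda> \<in> extensional (O_surface S).
     (\<forall>f\<in>O_surface S. \<forall>g\<in>O_surface S. \<Lambda> (\<lambda>p\<in>points S. f p + g p) = \<Lambda> f + \<Lambda> g) \<and>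
     (\<forall>a. \<forall>f\<in>O_surface S. \<Lambda> (\<lambda>p\<in>points S. a * f p) = a * \<Lambda> f) \<and>
     continuous_map (O_topology S) euclidean \<Lambda>}"

definition connection ::
    "'a surface \<Rightarrow> ('a \<Rightarrow> complex^'n) \<Rightarrow> (complex^'n) set \<Rightarrow> (('a \<Rightarrow> complex) \<Rightarrow> complex) set" where
  "connection S h V =
     {\<Lambda> \<in> O_dual S. \<forall>F\<in>O_curve V. \<Lambda> (restrict (F \<circ> h) (points S)) = 0}"

definition push_forward ::
    "'a surface \<Rightarrow> 'b surface \<Rightarrow> ('a \<Rightarrow> 'b) \<Rightarrow> (('a \<Rightarrow> complex) \<Rightarrow> complex) \<Rightarrow>
     (('b \<Rightarrow> complex) \<Rightarrow> complex)" where
  "push_forward S1 S2 \<psi> \<Lambda> = (\<lambda>f\<in>O_surface S2. \<Lambda> (restrict (f \<circ> \<psi>) (points S1)))"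

end

theory Submission
  imports Defs "HOL-Complex_Analysis.Complex_Analysis"
begin

text \<open>A biholomorphic map of curves lifts to the Riemann surfaces because \<open>h\<^sub>2\<close> is injective and
  non-singular off a finite set; properness of \<open>h\<^sub>2\<close> and finiteness of its fibres give
  a continuous extension over the remaining points, and isolated singularities of continuous
  functions are removable. Conversely \<open>\<phi>\<close> is recovered from an identity of pullback algebras by
  applying the identity to the coordinate functions.

  For the connections one needs that the pullbacks \<open>F \<circ> h\<close> form the annihilator of the connection in
  \<open>O(S)\<close>. No Hahn-Banach argument is used: \<open>f\<close> is a pullback if and only if it descends locally at
  every point \<open>P\<close> of the curve, and descending at \<open>P\<close> is a condition on a finite jet of \<open>f\<close> along
  the finite fibre over \<open>P\<close>. This is so because every function vanishing to high order along the
  fibre descends, by Lagrange interpolation along a generic linear projection. Jets are continuous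
  by the Cauchy estimates, so a function that does not descend is detected by a finite
  combination of jets that kills all pullbacks.\<close>

subsection \<open>Holomorphic functions of several variables\<close>

text \<open>Annihilators see only closed subspaces, so going back from connections to pullbacks
  requires the pullbacks to be closed in \<open>O_surface S\<close>. The local description supplies
  this: membership is a family of conditions, one for each point of the curve, and each of them is a
  linear condition on finitely many derivatives. Finitely many are enough because the denominators
  of the Lagrange formula, which are differences of the values of a separating linear form on
  distinct branches, vanish only to finite order at the centre of each disc. That order tells how
  far a function has to vanish in order to descend. The map of surfaces has to be constructed only
  when passing from (i) to (ii); between (ii), (iii) and (iv) the map \<open>\<psi>\<close> is
  kept.\<close>

lemma holomorphic_multi_subset:
  "holomorphic_multi F W \<Longrightarrow> W' \<subseteq> W \<Longrightarrow> holomorphic_multi F W'"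
  unfolding holomorphic_multi_def by blast

lemma holomorphic_multi_continuous_on:
  "holomorphic_multi F W \<Longrightarrow> continuous_on W F"
  unfolding holomorphic_multi_def
  by (meson continuous_at_imp_continuous_on has_derivative_continuous)

lemma holomorphic_multi_const: "holomorphic_multi (\<lambda>z. c) W"
  unfolding holomorphic_multi_def by (auto intro!: exI[of _ "\<lambda>_. 0"])

lemma holomorphic_multi_nth: "holomorphic_multi (\<lambda>z. z $ i) W"
  unfolding holomorphic_multi_def
  by (auto intro!: exI[of _ "\<lambda>z. z $ i"] bounded_linear_imp_has_derivative bounded_linear_vec_nth)

lemma holomorphic_multi_add:
  assumes "holomorphic_multi F W" and "holomorphic_multi G W"
  shows "holomorphic_multi (\<lambda>z. F z + G z) W"
  unfolding holomorphic_multi_def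
proof
  fix z assume "z \<in> W"
  then obtain D E where "(F has_derivative D) (at z)" "(G has_derivative E) (at z)"
      "\<forall>c v. D (c *s v) = c * D v" "\<forall>c v. E (c *s v) = c * E v"
    using assms unfolding holomorphic_multi_def by meson
  then show "\<exists>D. ((\<lambda>z. F z + G z) has_derivative D) (at z) \<and> (\<forall>c v. D (c *s v) = c * D v)"
    by (intro exI[of _ "\<lambda>v. D v + E v"]) (auto intro!: derivative_intros simp: algebra_simps)
qed

lemma holomorphic_multi_mult:
  assumes "holomorphic_multi F W" and "holomorphic_multi G W"
  shows "holomorphic_multi (\<lambda>z. F z * G z) W"
  unfolding holomorphic_multi_def
proof
  fix z assume "z \<in> W"
  then obtain D E where "(F has_derivative D) (at z)" "(G has_derivative E) (at z)"
      "\<forall>c v. D (c *s v) = c * D v" "\<forall>c v. E (c *s v) = c * E v"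
    using assms unfolding holomorphic_multi_def by meson
  then show "\<exists>D. ((\<lambda>z. F z * G z) has_derivative D) (at z) \<and> (\<forall>c v. D (c *s v) = c * D v)"
    by (intro exI[of _ "\<lambda>v. F z * E v + D v * G z"] conjI has_derivative_mult)
       (auto simp: algebra_simps)
qed

lemma holomorphic_multi_power:
  "holomorphic_multi F W \<Longrightarrow> holomorphic_multi (\<lambda>z. F z ^ k) W"
  by (induction k) (auto intro: holomorphic_multi_mult holomorphic_multi_const)

lemma holomorphic_multi_sum:
  "(\<And>k. k \<in> K \<Longrightarrow> holomorphic_multi (F k) W) \<Longrightarrow> holomorphic_multi (\<lambda>z. \<Sum>k\<in>K. F k z) W"
  by (induction K rule: infinite_finite_induct)
     (auto intro: holomorphic_multi_add holomorphic_multi_const)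

lemma holomorphic_multi_compose:
  assumes F: "holomorphic_multi F W" and g: "g holomorphic_on A" "open A"
    and sub: "\<And>z. z \<in> W \<Longrightarrow> F z \<in> A"
  shows "holomorphic_multi (\<lambda>z. g (F z)) W"
  unfolding holomorphic_multi_def
proof
  fix z assume z: "z \<in> W"
  then obtain D where D: "(F has_derivative D) (at z)" "\<forall>c v. D (c *s v) = c * D v"
    using F unfolding holomorphic_multi_def by meson
  have "(g has_derivative (*) (deriv g (F z))) (at (F z))"
    using holomorphic_derivI[OF g sub[OF z]] by (simp add: has_field_derivative_def)
  from diff_chain_at[OF D(1) this]
  have "((\<lambda>z. g (F z)) has_derivative (\<lambda>v. deriv g (F z) * D v)) (at z)"
    by (simp add: o_def)
  then show "\<exists>D. ((\<lambda>z. g (F z)) has_derivative D) (at z) \<and> (\<forall>c v. D (c *s v) = c * D v)"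
    using D(2) by (intro exI[of _ "\<lambda>v. deriv g (F z) * D v"]) (auto simp: algebra_simps)
qed

lemma has_derivative_vec_lambda:
  fixes f :: "'a::real_normed_vector \<Rightarrow> 'b::euclidean_space ^ 'm"
  assumes "\<And>j. ((\<lambda>z. f z $ j) has_derivative (\<lambda>v. D j v)) (at z)"
  shows "(f has_derivative (\<lambda>v. \<chi> j. D j v)) (at z)"
  unfolding has_derivative_componentwise_within[of f]
proof
  fix i :: "'b ^ 'm" assume "i \<in> Basis"
  then obtain j b where i: "i = axis j b" "b \<in> Basis"
    by (auto simp: Basis_vec_def)
  have "((\<lambda>z. (f z $ j) \<bullet> b) has_derivative (\<lambda>v. D j v \<bullet> b)) (at z)"
    by (intro has_derivative_inner_left assms)
  then show "((\<lambda>z. f z \<bullet> i) has_derivative (\<lambda>v. (\<chi> j. D j v) \<bullet> i)) (at z)"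
    by (simp add: i inner_axis)
qed

lemma holomorphic_multi_compose_multi:
  fixes f :: "complex^'n \<Rightarrow> complex^'m"
  assumes F: "holomorphic_multi F A" and f: "\<And>j. holomorphic_multi (\<lambda>z. f z $ j) W"
    and sub: "\<And>z. z \<in> W \<Longrightarrow> f z \<in> A"
  shows "holomorphic_multi (\<lambda>z. F (f z)) W"
  unfolding holomorphic_multi_def
proof
  fix z assume z: "z \<in> W"
  obtain D where D: "(F has_derivative D) (at (f z))" "\<forall>c v. D (c *s v) = c * D v"
    using F sub[OF z] unfolding holomorphic_multi_def by meson
  have "\<forall>j. \<exists>E. ((\<lambda>z. f z $ j) has_derivative E) (at z) \<and> (\<forall>c v. E (c *s v) = c * E v)"
    using f z unfolding holomorphic_multi_def by meson
  then obtain E where E: "\<And>j. ((\<lambda>z. f z $ j) has_derivative E j) (at z)"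
      "\<And>j c v. E j (c *s v) = c * E j v"
    by metis
  have "((\<lambda>z. F (f z)) has_derivative (\<lambda>v. D (\<chi> j. E j v))) (at z)"
    using diff_chain_at[OF has_derivative_vec_lambda[OF E(1)] D(1)] by (simp add: o_def)
  moreover have "D (\<chi> j. E j (c *s v)) = c * D (\<chi> j. E j v)" for c v
  proof -
    have "(\<chi> j. E j (c *s v)) = c *s (\<chi> j. E j v)"
      by (simp add: vec_eq_iff E(2))
    then show ?thesis using D(2) by simp
  qed
  ultimately show "\<exists>D. ((\<lambda>z. F (f z)) has_derivative D) (at z) \<and> (\<forall>c v. D (c *s v) = c * D v)"
    by blast
qed

lemma holomorphic_multi_compose_disc:
  fixes f :: "complex \<Rightarrow> complex^'m"
  assumes F: "holomorphic_multi F A" and f: "\<And>j. (\<lambda>t. f t $ j) holomorphic_on W" and W: "open W"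
    and sub: "\<And>t. t \<in> W \<Longrightarrow> f t \<in> A"
  shows "(\<lambda>t. F (f t)) holomorphic_on W"
  unfolding holomorphic_on_open[OF W]
proof
  fix t assume t: "t \<in> W"
  obtain D where D: "(F has_derivative D) (at (f t))" "\<forall>c v. D (c *s v) = c * D v"
    using F sub[OF t] unfolding holomorphic_multi_def by meson
  \<comment> \<open>The complex tangent vector of the disc. Complex linearity of \<open>D\<close>
    turns the real differential of the composite into multiplication by the number
    \<open>D d\<close>.\<close>
  define d where "d = (\<chi> j. deriv (\<lambda>t. f t $ j) t)"
  have "((\<lambda>t. f t $ j) has_derivative (\<lambda>v. v * d $ j)) (at t)" for j
    using holomorphic_derivI[OF f W t, of j]
    by (simp add: has_field_derivative_def d_def mult.commute[of _ "deriv _ _"])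
  from diff_chain_at[OF has_derivative_vec_lambda[OF this] D(1)]
  have "((\<lambda>t. F (f t)) has_derivative (\<lambda>v. D (\<chi> j. v * d $ j))) (at t)"
    by (simp add: o_def)
  moreover have "D (\<chi> j. v * d $ j) = D d * v" for v
  proof -
    have "(\<chi> j. v * d $ j) = v *s d" by (simp add: vec_eq_iff)
    then show ?thesis using D(2) by simp
  qed
  ultimately have "((\<lambda>t. F (f t)) has_field_derivative D d) (at t)"
    by (simp add: has_field_derivative_def)
  then show "\<exists>d. ((\<lambda>t. F (f t)) has_field_derivative d) (at t)" by blast
qed

text \<open>Each vector of \<open>X\<close> excludes a hyperplane of forms, and finitely many
  hyperplanes do not fill the dual space. The induction takes the form found for the old vectors and
  perturbs one of its coefficients.\<close>

lemma separating_linear_form: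
  fixes X :: "(complex^'n) set"
  assumes "finite X" and "0 \<notin> X"
  obtains a :: "complex^'n" where "\<And>v. v \<in> X \<Longrightarrow> (\<Sum>i\<in>UNIV. a $ i * v $ i) \<noteq> 0"
proof -
  have "\<exists>a :: complex^'n. \<forall>v\<in>X. (\<Sum>i\<in>UNIV. a $ i * v $ i) \<noteq> 0"
    using assms
  proof (induction X)
    case empty
    then show ?case by simp
  next
    case (insert v X)
    then obtain a :: "complex^'n" where a: "\<And>x. x \<in> X \<Longrightarrow> (\<Sum>i\<in>UNIV. a $ i * x $ i) \<noteq> 0"
      by auto
    from insert.prems obtain j where j: "v $ j \<noteq> 0"
      by (auto simp: vec_eq_iff)
    define A where "A x = (\<Sum>i\<in>UNIV. a $ i * x $ i)" for x
    \<comment> \<open>Adding \<open>e\<close> to the coefficient at \<open>j\<close> changes the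
      value at \<open>x\<close> by \<open>e * x $ j\<close>, so a vector with
      \<open>x $ j \<noteq> 0\<close> forbids one value of \<open>e\<close>. If
      \<open>x $ j = 0\<close>, division by zero merely forbids \<open>e = 0\<close>; such a vector
      lies in the old set and keeps its value \<open>A x\<close>.\<close>
    have "infinite (UNIV - ((\<lambda>x. - A x / x $ j) ` insert v X))"
      using insert.hyps by (auto intro!: Diff_infinite_finite simp: infinite_UNIV_char_0)
    then obtain e where e: "e \<notin> (\<lambda>x. - A x / x $ j) ` insert v X"
      by (metis DiffD2 finite.emptyI ex_in_conv)
    define a' where "a' = (\<chi> i. a $ i + (if i = j then e else 0))"
    have a': "(\<Sum>i\<in>UNIV. a' $ i * x $ i) = A x + e * x $ j" for x
      by (simp add: a'_def A_def distrib_right sum.distrib if_distrib[of "\<lambda>y. y * _"] cong: if_cong)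
    have "A x + e * x $ j \<noteq> 0" if "x \<in> insert v X" for x
    proof
      assume eq: "A x + e * x $ j = 0"
      show False
      proof (cases "x $ j = 0")
        case True
        then have "x \<in> X" using that j by auto
        then show False using eq True a[of x] by (simp add: A_def)
      next
        case False
        have "e = - A x / x $ j"
          using eq False by (simp add: field_simps eq_neg_iff_add_eq_0)
        then show False using e that by auto
      qed
    qed
    then show ?case by (intro exI[of _ a']) (simp add: a')
  qed
  then show ?thesis using that by blast
qed

subsection \<open>Interpolation along a branched covering\<close>

definition root_unity :: "nat \<Rightarrow> nat \<Rightarrow> complex" where
  "root_unity n j = exp (2 * of_real pi * \<i> * of_nat j / of_nat n)"

lemma norm_root_unity [simp]: "norm (root_unity n j) = 1"
  by (simp add: root_unity_def exp_of_nat_mult norm_exp_eq_Re)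

lemma root_unity_0 [simp]: "root_unity n 0 = 1"
  by (simp add: root_unity_def)

lemma root_unity_power: "root_unity n j = root_unity n 1 ^ j"
  by (simp add: root_unity_def mult_ac flip: exp_of_nat_mult)

lemma root_unity_Suc: "root_unity n (Suc j) = root_unity n j * root_unity n 1"
  using root_unity_power[of n j] root_unity_power[of n "Suc j"] by simp

lemma root_unity_power_self: "n > 0 \<Longrightarrow> root_unity n j ^ n = 1"
  using complex_root_unity[of n j] by (simp add: root_unity_def)

lemma root_unity_mod: "n > 0 \<Longrightarrow> root_unity n (j mod n) = root_unity n j"
  unfolding root_unity_def by (subst complex_root_unity_eq) auto

lemma root_unity_inj:
  "n > 0 \<Longrightarrow> i < n \<Longrightarrow> j < n \<Longrightarrow> root_unity n i = root_unity n j \<Longrightarrow> i = j"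
  unfolding root_unity_def by (subst (asm) complex_root_unity_eq) auto

lemma root_unity_power_div:
  assumes "m dvd M" and "M > 0"
  shows "root_unity M 1 ^ (M div m) = root_unity m 1"
proof -
  from assms obtain k where "M = m * k" "m > 0" "k > 0" by (auto simp: dvd_def)
  then show ?thesis by (simp add: root_unity_def field_simps flip: exp_of_nat_mult)
qed

text \<open>Invariance under the primitive root kills each Taylor coefficient whose index is not a
  multiple of \<open>M\<close>, so the series of \<open>g\<close> is a power series in
  \<open>s ^ M\<close>.\<close>

lemma holomorphic_invariant_root_unity:
  assumes g: "g holomorphic_on ball 0 r" and M: "M > 0"
    and inv: "\<And>s. s \<in> ball 0 r \<Longrightarrow> g (root_unity M 1 * s) = g s"
  obtains G where "G holomorphic_on ball 0 (r ^ M)" and "\<And>s. s \<in> ball 0 r \<Longrightarrow> G (s ^ M) = g s"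
proof (cases "r > 0")
  case False
  then have "ball (0::complex) r = {}" by simp
  moreover have "(\<lambda>_. 0) holomorphic_on ball (0::complex) (r ^ M)" by simp
  ultimately show ?thesis using that by blast
next
  case r: True
  define a where "a n = (deriv ^^ n) g 0 / fact n" for n
  have sums: "(\<lambda>n. a n * s ^ n) sums g s" if "s \<in> ball 0 r" for s
    using holomorphic_power_series[OF g that] by (simp add: a_def)
  have a0: "a n = 0" if "\<not> M dvd n" for n
  proof -
    have sub: "root_unity M 1 * w \<in> ball 0 r" if "w \<in> ball 0 r" for w
      using that by (simp add: norm_mult)
    have "(\<lambda>s. g (root_unity M 1 * s)) holomorphic_on ball 0 r"
    proof -
      have "(\<lambda>w. root_unity M 1 * w) ` ball 0 r \<subseteq> ball 0 r" using sub by blast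
      from holomorphic_on_compose_gen[OF _ g this] show ?thesis
        by (simp add: o_def holomorphic_intros)
    qed
    then have "(deriv ^^ n) (\<lambda>s. g (root_unity M 1 * s)) 0 = (deriv ^^ n) g 0"
      by (rule higher_deriv_transform_within_open[OF _ g]) (use r inv in auto)
    moreover have "(deriv ^^ n) (\<lambda>s. g (root_unity M 1 * s)) 0 = root_unity M 1 ^ n * (deriv ^^ n) g 0"
      using higher_deriv_compose_linear[OF g _ _ _ sub, of "ball 0 r" 0 n] r by simp
    moreover have "root_unity M 1 ^ n \<noteq> 1"
      using that M complex_root_unity_eq_1[of M n] root_unity_power[of M n]
      unfolding root_unity_def by force
    ultimately show ?thesis by (simp add: a_def)
  qed
  define G where "G w = (\<Sum>n. a (M * n) * w ^ n)" for w
  have G: "(\<lambda>n. a (M * n) * (s ^ M) ^ n) sums g s" if "s \<in> ball 0 r" for s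
  proof -
    have "strict_mono ((*) M)" using M by (simp add: strict_mono_def)
    then have "(\<lambda>n. a (M * n) * s ^ (M * n)) sums g s"
      by (subst sums_mono_reindex[of "(*) M" "\<lambda>n. a n * s ^ n"])
         (use a0 sums[OF that] in \<open>auto simp: dvd_def\<close>)
    then show ?thesis by (simp add: power_mult)
  qed
  show ?thesis
  proof
    show "G (s ^ M) = g s" if "s \<in> ball 0 r" for s
      using G[OF that] by (simp add: G_def sums_iff)
    show "G holomorphic_on ball 0 (r ^ M)"
    proof (rule power_series_holomorphic)
      fix w :: complex assume w: "w \<in> ball 0 (r ^ M)"
      \<comment> \<open>Each \<open>w\<close> in this disc is \<open>s ^ M\<close> with
        \<open>s\<close> in the original disc, so convergence of the series of \<open>G\<close> at
        \<open>w\<close> is that of the series of \<open>g\<close> at \<open>s\<close>.\<close>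
      obtain s where s: "w = s ^ M" using exists_complex_root[of M w] M by auto
      have "s \<in> ball 0 r"
        using w s r by (auto simp: norm_power intro: power_less_imp_less_base)
      from G[OF this] show "(\<lambda>n. a (M * n) * (w - 0) ^ n) sums G w"
        by (simp add: s G_def sums_iff)
    qed
  qed
qed

text \<open>The exponent may be 0, which covers a function without a zero at the centre. The point
  \<open>t\<close> rules out the zero function.\<close>

lemma holomorphic_factor_zero:
  assumes f: "f holomorphic_on ball 0 R" and t: "t \<in> ball 0 R" "f t \<noteq> 0"
  obtains n r u where "0 < r" "r \<le> R" "u holomorphic_on ball 0 r"
    "\<And>w. w \<in> ball 0 r \<Longrightarrow> f w = w ^ n * u w" "\<And>w. w \<in> ball 0 r \<Longrightarrow> u w \<noteq> 0"
proof (cases "f 0 = 0")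
  case True
  have R: "R > 0" using t by (metis ball_eq_empty empty_iff not_le)
  have nc: "\<not> f constant_on ball 0 R"
  proof
    assume "f constant_on ball 0 R"
    then obtain c where "\<And>x. x \<in> ball 0 R \<Longrightarrow> f x = c" unfolding constant_on_def by blast
    from this[of 0] this[OF t(1)] show False using R t True by simp
  qed
  have c0: "0 \<in> ball (0::complex) R" using R by simp
  obtain g r n where g: "(0::nat) < n" "0 < r" "ball (0::complex) r \<subseteq> ball 0 R" "g holomorphic_on ball 0 r"
      "\<And>w. w \<in> ball 0 r \<Longrightarrow> f w = (w - 0) ^ n * g w" "\<And>w. w \<in> ball 0 r \<Longrightarrow> g w \<noteq> 0"
    by (rule holomorphic_factor_zero_nonconstant[OF f open_ball connected_ball c0 True nc]) (rule that)
  have "r \<le> R" using g(2,3) by (simp add: ball_subset_ball_iff)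
  moreover have "f w = w ^ n * g w" if "w \<in> ball 0 r" for w using g(5)[OF that] by simp
  ultimately show ?thesis using that[of r g n] g by blast
next
  case False
  have R: "R > 0" using t by (metis ball_eq_empty empty_iff not_le)
  have "open (f -` (- {0}) \<inter> ball 0 R)"
    using continuous_open_preimage[OF holomorphic_on_imp_continuous_on[OF f] open_ball, of "- {0}"]
    by (simp add: Int_commute open_Compl)
  moreover have "0 \<in> f -` (- {0}) \<inter> ball 0 R" using False R by simp
  ultimately obtain r where r: "0 < r" "ball 0 r \<subseteq> f -` (- {0}) \<inter> ball 0 R"
    by (meson open_contains_ball)
  show ?thesis
  proof (rule that[of r f 0])
    show "r \<le> R" using r by (auto simp: ball_subset_ball_iff)
    show "f holomorphic_on ball 0 r" using r f by (auto intro: holomorphic_on_subset)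
    show "f w \<noteq> 0" if "w \<in> ball 0 r" for w using r that by blast
  qed (use r in auto)
qed

section \<open>Polynomials whose coefficients depend holomorphically on a parameter\<close>

lemma holomorphic_on_coeff_mult:
  assumes "\<And>n. (\<lambda>s. coeff (p s) n) holomorphic_on A" "\<And>n. (\<lambda>s. coeff (q s) n) holomorphic_on A"
  shows "(\<lambda>s. coeff (p s * q s) n) holomorphic_on A"
  unfolding coeff_mult by (intro holomorphic_intros assms)

lemma holomorphic_on_coeff_prod:
  assumes "\<And>k n. k \<in> K \<Longrightarrow> (\<lambda>s. coeff (p k s) n) holomorphic_on A"
  shows "(\<lambda>s. coeff (\<Prod>k\<in>K. p k s) n) holomorphic_on A"
  using assms
proof (induction K arbitrary: n rule: infinite_finite_induct)
  case (insert k K)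
  then show ?case by (auto intro!: holomorphic_on_coeff_mult)
qed auto

text \<open>The branched covering consists of the discs \<open>q \<in> Q\<close> with projection \<open>t \<mapsto> t ^ m q\<close>. After the
  base change \<open>w = s ^ M\<close> the points above \<open>w\<close> are the values \<open>sheet k s\<close> for \<open>k \<in> sheets\<close>. The
  function \<open>y\<close> separates them generically, so functions on the discs can be interpolated
  by polynomials in \<open>y\<close>. The substitution \<open>s \<mapsto> root_unity M 1 * s\<close> permutes the sheets,
  so the coefficients of the interpolating polynomial depend only on \<open>w\<close>.\<close>

locale branched_discs =
  fixes Q :: "'q set" and m :: "'q \<Rightarrow> nat" and y :: "'q \<Rightarrow> complex \<Rightarrow> complex" and \<rho> :: real
  assumes finite_Q: "finite Q" and m_pos: "\<And>q. q \<in> Q \<Longrightarrow> m q > 0"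
    and \<rho>: "0 < \<rho>" "\<rho> \<le> 1"
    and y_holomorphic: "\<And>q. q \<in> Q \<Longrightarrow> y q holomorphic_on ball 0 \<rho>"
begin

text \<open>A common multiple of the ramification indices: after the substitution
  \<open>w = s ^ M\<close> all solutions of \<open>t ^ m q = w\<close> are holomorphic in
  \<open>s\<close>.\<close>

definition M :: nat where "M = prod m Q"

definition sheets :: "('q \<times> nat) set" where "sheets = Sigma Q (\<lambda>q. {..<m q})"

text \<open>For \<open>k = (q, j)\<close> this is the \<open>j\<close>-th solution \<open>t\<close>
  of \<open>t ^ m q = s ^ M\<close>.\<close>

definition sheet :: "'q \<times> nat \<Rightarrow> complex \<Rightarrow> complex" where
  "sheet k s = root_unity (m (fst k)) (snd k) * s ^ (M div m (fst k))"

text \<open>Lagrange interpolation at the nodes \<open>y (fst k) (sheet k s)\<close> with the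
  denominators left out. The coefficients thereby stay holomorphic where nodes collide, at the price
  that the polynomial takes the prescribed value times a product of node differences.\<close>

definition lagrange :: "('q \<Rightarrow> complex \<Rightarrow> complex) \<Rightarrow> complex \<Rightarrow> complex poly" where
  "lagrange f s = (\<Sum>k\<in>sheets. smult (f (fst k) (sheet k s))
     (\<Prod>l\<in>sheets - {k}. [:- y (fst l) (sheet l s), 1:]))"

lemma M_pos: "M > 0"
  using m_pos finite_Q by (auto simp: M_def intro!: prod_pos)

lemma m_dvd_M: "q \<in> Q \<Longrightarrow> m q dvd M"
  using finite_Q by (auto simp: M_def intro: dvd_prod_eqI)

lemma M_div_m_pos: "q \<in> Q \<Longrightarrow> M div m q > 0"
  using m_dvd_M[of q] M_pos by (auto simp: dvd_def)

lemma finite_sheets: "finite sheets"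
  using finite_Q by (auto simp: sheets_def)

lemma norm_sheet: "norm (sheet k s) = norm s ^ (M div m (fst k))"
  by (simp add: sheet_def norm_mult norm_power)

text \<open>Positive powers do not leave a disc of radius at most 1; this is the reason for the
  upper bound on \<open>\<rho>\<close>.\<close>

lemma sheet_in_ball:
  assumes "k \<in> sheets" "s \<in> ball 0 r" "r \<le> 1" shows "sheet k s \<in> ball 0 r"
proof -
  have "M div m (fst k) > 0" using assms M_div_m_pos by (auto simp: sheets_def)
  then have "norm s ^ (M div m (fst k)) \<le> norm s ^ 1"
    using assms by (intro power_decreasing) auto
  then show ?thesis using assms by (simp add: norm_sheet)
qed

lemma sheet_power: "k \<in> sheets \<Longrightarrow> sheet k s ^ m (fst k) = s ^ M"
  using m_dvd_M[of "fst k"] m_pos[of "fst k"]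
  by (auto simp: sheet_def sheets_def power_mult_distrib root_unity_power_self simp flip: power_mult)

lemma sheet_holomorphic: "sheet k holomorphic_on A"
  unfolding sheet_def by (intro holomorphic_intros)

lemma compose_sheet_holomorphic:
  assumes "g holomorphic_on ball 0 r" "k \<in> sheets" "r \<le> 1"
  shows "(\<lambda>s. g (sheet k s)) holomorphic_on ball 0 r"
proof -
  have "sheet k ` ball 0 r \<subseteq> ball 0 r" using sheet_in_ball assms(2,3) by blast
  from holomorphic_on_compose_gen[OF sheet_holomorphic assms(1) this] show ?thesis
    by (simp add: o_def)
qed

lemma lagrange_coeff_holomorphic:
  assumes f: "\<And>q. q \<in> Q \<Longrightarrow> f q holomorphic_on ball 0 r" and r: "r \<le> \<rho>"
  shows "(\<lambda>s. coeff (lagrange f s) n) holomorphic_on ball 0 r"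
proof -
  have r1: "r \<le> 1" using r \<rho> by simp
  have lin: "(\<lambda>s. coeff [:- y (fst l) (sheet l s), 1:] n) holomorphic_on ball 0 r"
    if "l \<in> sheets" for l n
  proof -
    have "y (fst l) holomorphic_on ball 0 r"
      using y_holomorphic[of "fst l"] that r
      by (auto simp: sheets_def intro: holomorphic_on_subset)
    then have "(\<lambda>s. - y (fst l) (sheet l s)) holomorphic_on ball 0 r"
      by (intro holomorphic_intros compose_sheet_holomorphic that r1)
    then show ?thesis
      by (cases n) simp_all
  qed
  show ?thesis
    unfolding lagrange_def coeff_sum coeff_smult
  proof (intro holomorphic_on_sum holomorphic_on_mult holomorphic_on_coeff_prod lin)
    fix k assume k: "k \<in> sheets"
    then have "fst k \<in> Q" by (auto simp: sheets_def)
    then show "(\<lambda>s. f (fst k) (sheet k s)) holomorphic_on ball 0 r"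
      using compose_sheet_holomorphic[OF f k r1] by simp
  qed auto
qed

text \<open>What matters is a bound that does not depend on \<open>s\<close>: it lets all these
  polynomials be written with one range of exponents.\<close>

lemma degree_lagrange_le: "degree (lagrange f s) \<le> card sheets"
  unfolding lagrange_def
proof (rule degree_sum_le[OF finite_sheets])
  fix k assume k: "k \<in> sheets"
  have "degree (\<Prod>l\<in>sheets - {k}. [:- y (fst l) (sheet l s), 1:])
      \<le> (\<Sum>l\<in>sheets - {k}. degree [:- y (fst l) (sheet l s), 1:])"
    using finite_sheets by (intro degree_prod_sum_le[unfolded o_def]) auto
  also have "\<dots> \<le> card sheets" using finite_sheets by (auto intro!: card_mono)
  finally show "degree (smult (f (fst k) (sheet k s))
      (\<Prod>l\<in>sheets - {k}. [:- y (fst l) (sheet l s), 1:])) \<le> card sheets"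
    using degree_smult_le le_trans by blast
qed

text \<open>In each other summand the product contains the factor belonging to \<open>k\<close>,
  which vanishes at this node. The identity holds also where nodes coincide.\<close>

lemma poly_lagrange_sheet:
  assumes k: "k \<in> sheets"
  shows "poly (lagrange f s) (y (fst k) (sheet k s)) = f (fst k) (sheet k s) *
    (\<Prod>l\<in>sheets - {k}. y (fst k) (sheet k s) - y (fst l) (sheet l s))"
proof -
  have "poly (lagrange f s) (y (fst k) (sheet k s)) = (\<Sum>k'\<in>sheets. f (fst k') (sheet k' s) *
      (\<Prod>l\<in>sheets - {k'}. y (fst k) (sheet k s) - y (fst l) (sheet l s)))"
    by (simp add: lagrange_def poly_sum poly_prod)
  also have "\<dots> = (\<Sum>k'\<in>{k}. f (fst k') (sheet k' s) *
      (\<Prod>l\<in>sheets - {k'}. y (fst k) (sheet k s) - y (fst l) (sheet l s)))"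
  proof (rule sum.mono_neutral_right)
    show "\<forall>k'\<in>sheets - {k}. f (fst k') (sheet k' s) *
        (\<Prod>l\<in>sheets - {k'}. y (fst k) (sheet k s) - y (fst l) (sheet l s)) = 0"
      using k finite_sheets by (auto intro!: prod_zero)
  qed (use k finite_sheets in auto)
  finally show ?thesis by simp
qed

lemma lagrange_root_unity: "lagrange f (root_unity M 1 * s) = lagrange f s"
proof -
  \<comment> \<open>The monodromy of the covering: it advances the index of the root cyclically
    inside each disc, since \<open>root_unity M 1 ^ (M div m q)\<close> is the primitive
    \<open>m q\<close>-th root.\<close>
  define \<sigma> where "\<sigma> k = (fst k, (snd k + 1) mod m (fst k))" for k :: "'q \<times> nat"
  have fst_\<sigma>: "fst (\<sigma> k) = fst k" for k by (simp add: \<sigma>_def)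
  have \<sigma>_in: "\<sigma> k \<in> sheets" if "k \<in> sheets" for k
    using that m_pos by (auto simp: \<sigma>_def sheets_def)
  have "inj_on \<sigma> sheets"
  proof (rule inj_onI)
    fix k l assume kl: "k \<in> sheets" "l \<in> sheets" "\<sigma> k = \<sigma> l"
    then have "snd k < m (fst k)" "snd l < m (fst k)" "fst k = fst l"
        "Suc (snd k) mod m (fst k) = Suc (snd l) mod m (fst k)"
      by (auto simp: \<sigma>_def sheets_def)
    then show "k = l" by (auto simp: mod_Suc prod_eq_iff split: if_splits)
  qed
  moreover have "\<sigma> ` sheets = sheets"
    by (rule endo_inj_surj[OF finite_sheets _ calculation]) (use \<sigma>_in in auto)
  ultimately have bij: "bij_betw \<sigma> sheets sheets" by (simp add: bij_betw_def)
  have sh: "sheet k (root_unity M 1 * s) = sheet (\<sigma> k) s" if "k \<in> sheets" for k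
  proof -
    have "fst k \<in> Q" using that by (auto simp: sheets_def)
    then have "root_unity (m (fst k)) ((snd k + 1) mod m (fst k)) =
        root_unity (m (fst k)) (snd k) * root_unity M 1 ^ (M div m (fst k))"
      using m_pos[of "fst k"] m_dvd_M[of "fst k"] M_pos
      by (simp only: root_unity_mod root_unity_power_div Suc_eq_plus1[symmetric] root_unity_Suc)
    then show ?thesis by (simp add: sheet_def \<sigma>_def power_mult_distrib)
  qed
  have pr: "(\<Prod>l\<in>sheets - {k}. [:- y (fst l) (sheet l (root_unity M 1 * s)), 1:]) =
      (\<Prod>l\<in>sheets - {\<sigma> k}. [:- y (fst l) (sheet l s), 1:])" if k: "k \<in> sheets" for k
  proof -
    have "bij_betw \<sigma> (sheets - {k}) (sheets - {\<sigma> k})"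
      using bij_betw_DiffI[OF bij, of "{k}" "{\<sigma> k}"] k \<sigma>_in by (auto simp: bij_betw_def)
    then have "(\<Prod>l\<in>sheets - {\<sigma> k}. [:- y (fst l) (sheet l s), 1:]) =
        (\<Prod>l\<in>sheets - {k}. [:- y (fst (\<sigma> l)) (sheet (\<sigma> l) s), 1:])"
      by (rule prod.reindex_bij_betw[symmetric])
    also have "\<dots> = (\<Prod>l\<in>sheets - {k}. [:- y (fst l) (sheet l (root_unity M 1 * s)), 1:])"
      by (rule prod.cong) (auto simp only: fst_\<sigma> sh Diff_iff)
    finally show ?thesis by simp
  qed
  have "lagrange f (root_unity M 1 * s) = (\<Sum>k\<in>sheets. smult (f (fst (\<sigma> k)) (sheet (\<sigma> k) s))
     (\<Prod>l\<in>sheets - {\<sigma> k}. [:- y (fst l) (sheet l s), 1:]))"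
    unfolding lagrange_def by (rule sum.cong) (simp_all only: sh pr fst_\<sigma>)
  also have "\<dots> = lagrange f s"
    unfolding lagrange_def by (rule sum.reindex_bij_betw[OF bij])
  finally show ?thesis .
qed

text \<open>An \<open>(M div m q)\<close>-th root of \<open>t\<close> puts \<open>t\<close> on the
  sheet with root index 0. The radius \<open>r ^ M\<close> forces this root into the disc of radius
  \<open>r\<close>, because \<open>r ^ M \<le> r ^ (M div m q)\<close>.\<close>

lemma sheet_surj:
  assumes "q \<in> Q" and "t \<in> ball 0 (r ^ M)" and r: "0 < r" "r \<le> 1"
  obtains s where "s \<in> ball 0 r" "sheet (q, 0) s = t" "(q, 0) \<in> sheets" "t ^ m q = s ^ M"
proof -
  obtain s where s: "t = s ^ (M div m q)"
    using exists_complex_root[of "M div m q" t] M_div_m_pos[OF assms(1)] by auto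
  have "norm s ^ (M div m q) < r ^ (M div m q)"
  proof -
    have "norm s ^ (M div m q) < r ^ M" using assms s by (simp add: norm_power)
    also have "\<dots> \<le> r ^ (M div m q)" using r by (intro power_decreasing) auto
    finally show ?thesis .
  qed
  then have "s \<in> ball 0 r" using r power_less_imp_less_base[of "norm s" _ r] by simp
  moreover have k: "(q, 0) \<in> sheets" using assms m_pos by (auto simp: sheets_def)
  moreover have "sheet (q, 0) s = t" by (simp add: sheet_def s)
  ultimately show ?thesis using that sheet_power[OF k, of s] by auto
qed

text \<open>Each coefficient is holomorphic in \<open>s\<close> and unchanged by the rotation of
  \<open>s\<close>, hence a holomorphic function of \<open>s ^ M\<close>.\<close>

lemma lagrange_descends:
  assumes f: "\<And>q. q \<in> Q \<Longrightarrow> f q holomorphic_on ball 0 r" and r: "0 < r" "r \<le> \<rho>"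
  obtains C where "\<And>n. C n holomorphic_on ball 0 (r ^ M)"
    and "\<And>s t. s \<in> ball 0 r \<Longrightarrow> (\<Sum>n\<le>card sheets. C n (s ^ M) * t ^ n) = poly (lagrange f s) t"
proof -
  have "\<exists>C. C holomorphic_on ball 0 (r ^ M) \<and>
      (\<forall>s\<in>ball 0 r. C (s ^ M) = coeff (lagrange f s) n)" for n
  proof -
    have hol: "(\<lambda>s. coeff (lagrange f s) n) holomorphic_on ball 0 r"
      using f r(2) by (rule lagrange_coeff_holomorphic)
    obtain C where "C holomorphic_on ball 0 (r ^ M)"
        "\<And>s. s \<in> ball 0 r \<Longrightarrow> C (s ^ M) = coeff (lagrange f s) n"
      by (rule holomorphic_invariant_root_unity[OF hol M_pos])
         (simp only: lagrange_root_unity, rule that)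
    then show ?thesis by blast
  qed
  then obtain C where C: "\<And>n. C n holomorphic_on ball 0 (r ^ M)"
      "\<And>n s. s \<in> ball 0 r \<Longrightarrow> C n (s ^ M) = coeff (lagrange f s) n"
    by metis
  have "(\<Sum>n\<le>card sheets. C n (s ^ M) * t ^ n) = poly (lagrange f s) t" if "s \<in> ball 0 r" for s t
  proof -
    have "(\<Sum>n\<le>card sheets. C n (s ^ M) * t ^ n) = (\<Sum>n\<le>card sheets. coeff (lagrange f s) n * t ^ n)"
      by (simp only: C(2)[OF that])
    also have "\<dots> = poly (lagrange f s) t"
      unfolding poly_altdef using degree_lagrange_le[of f s]
      by (intro sum.mono_neutral_right) (auto simp: coeff_eq_0)
    finally show ?thesis .
  qed
  then show ?thesis using that C(1) by blast
qed

text \<open>The polynomial for the constant function 1 has on each sheet the value of the product of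
  node differences. As the nodes over \<open>s0\<close> are distinct, this product is not
  identically zero on any disc, so near the centre it is a power of \<open>t\<close> times a
  zero-free factor. Functions carrying enough powers of \<open>t\<close> can therefore be divided by
  it before they are interpolated, and \<open>N\<close> does not depend on \<open>g\<close>.\<close>

lemma interpolation:
  assumes s0: "s0 \<in> ball 0 (\<rho> ^ M)" and inj: "inj_on (\<lambda>k. y (fst k) (sheet k s0)) sheets"
  shows "\<exists>N. \<forall>g. (\<forall>q\<in>Q. g q holomorphic_on ball 0 \<rho>) \<longrightarrow>
    (\<exists>C r. 0 < r \<and> r \<le> \<rho> \<and> (\<forall>n. C n holomorphic_on ball 0 r) \<and>
      (\<forall>q\<in>Q. \<forall>t\<in>ball 0 r. t ^ N * g q t = (\<Sum>n\<le>card sheets. C n (t ^ m q) * y q t ^ n)))"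
proof -
  have \<rho>M: "\<rho> ^ M \<le> \<rho>" "0 < \<rho> ^ M"
    using \<rho> M_pos power_decreasing[of 1 M \<rho>] by auto
  obtain C1 where C1: "\<And>n. C1 n holomorphic_on ball 0 (\<rho> ^ M)"
      "\<And>s t. s \<in> ball 0 \<rho> \<Longrightarrow>
        (\<Sum>n\<le>card sheets. C1 n (s ^ M) * t ^ n) = poly (lagrange (\<lambda>_ _. 1) s) t"
    using lagrange_descends[of "\<lambda>_ _. 1" \<rho>] \<rho> by auto
  \<comment> \<open>The product of node differences, expressed through \<open>t\<close> alone: the
    \<open>C1 n\<close> are evaluated at \<open>t ^ m q\<close>, which is \<open>s ^ M\<close> on a
    sheet.\<close>
  define \<Delta> where "\<Delta> q t = (\<Sum>n\<le>card sheets. C1 n (t ^ m q) * y q t ^ n)" for q t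
  have \<Delta>: "\<Delta> q t = poly (lagrange (\<lambda>_ _. 1) s) (y q t)" if "s \<in> ball 0 \<rho>" "t ^ m q = s ^ M" for q t s
    using C1(2)[OF that(1), of "y q t"] that(2) by (simp add: \<Delta>_def)
  have pow: "(\<lambda>t. t ^ m q) ` ball 0 (\<rho> ^ M) \<subseteq> ball (0::complex) (\<rho> ^ M)" if "q \<in> Q" for q
  proof safe
    fix t :: complex assume "t \<in> ball 0 (\<rho> ^ M)"
    moreover have "norm t ^ m q \<le> norm t ^ 1"
      using m_pos[OF that] calculation \<rho>M \<rho> by (intro power_decreasing) auto
    ultimately show "t ^ m q \<in> ball 0 (\<rho> ^ M)" by (simp add: norm_power)
  qed
  have \<Delta>_hol: "\<Delta> q holomorphic_on ball 0 (\<rho> ^ M)" if "q \<in> Q" for q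
  proof -
    have "y q holomorphic_on ball 0 (\<rho> ^ M)"
      using y_holomorphic[OF that] \<rho>M by (auto intro: holomorphic_on_subset)
    moreover have "(\<lambda>t. C1 n (t ^ m q)) holomorphic_on ball 0 (\<rho> ^ M)" for n
      using holomorphic_on_compose_gen[OF _ C1(1) pow[OF that], of n]
      by (simp add: o_def holomorphic_intros)
    ultimately show ?thesis unfolding \<Delta>_def by (intro holomorphic_intros)
  qed
  define P where "P q n r u \<longleftrightarrow> 0 < r \<and> r \<le> \<rho> ^ M \<and> u holomorphic_on ball 0 r \<and>
      (\<forall>w\<in>ball 0 r. \<Delta> q w = w ^ n * u w \<and> u w \<noteq> 0)" for q n r u
  have fac: "\<exists>n r u. P q n r u" if q: "q \<in> Q" for q
  proof -
    have k: "(q, 0) \<in> sheets" using q m_pos by (auto simp: sheets_def)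
    have s0': "s0 \<in> ball 0 \<rho>" using s0 \<rho>M by auto
    have \<rho>M1: "\<rho> ^ M \<le> 1" using \<rho>M \<rho> by simp
    have "\<Delta> q (sheet (q, 0) s0) = poly (lagrange (\<lambda>_ _. 1) s0) (y q (sheet (q, 0) s0))"
      using sheet_power[OF k, of s0] by (intro \<Delta>[OF s0']) simp
    also have "\<dots> \<noteq> 0"
    proof -
      have "y q (sheet (q, 0) s0) - y (fst l) (sheet l s0) \<noteq> 0" if "l \<in> sheets - {(q, 0)}" for l
        using inj_onD[OF inj, of "(q, 0)" l] k that by auto
      then show ?thesis
        using poly_lagrange_sheet[OF k, of "\<lambda>_ _. 1" s0] finite_sheets by simp
    qed
    finally have "\<Delta> q (sheet (q, 0) s0) \<noteq> 0" .
    then obtain n r u where "0 < r" "r \<le> \<rho> ^ M" "u holomorphic_on ball 0 r"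
        and nz: "\<And>w. w \<in> ball 0 r \<Longrightarrow> \<Delta> q w = w ^ n * u w" "\<And>w. w \<in> ball 0 r \<Longrightarrow> u w \<noteq> 0"
      by (rule holomorphic_factor_zero[OF \<Delta>_hol[OF q] sheet_in_ball[OF k s0 \<rho>M1]]) (rule that)
    moreover have "\<forall>w\<in>ball 0 r. \<Delta> q w = w ^ n * u w \<and> u w \<noteq> 0"
      by (intro ballI conjI nz)
    ultimately show ?thesis unfolding P_def by (intro exI conjI)
  qed
  then obtain N r u where P: "\<And>q. q \<in> Q \<Longrightarrow> P q (N q) (r q) (u q)" by metis
  then have N: "\<And>q. q \<in> Q \<Longrightarrow> 0 < r q" "\<And>q. q \<in> Q \<Longrightarrow> r q \<le> \<rho> ^ M"
      "\<And>q. q \<in> Q \<Longrightarrow> u q holomorphic_on ball 0 (r q)"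
      "\<And>q w. q \<in> Q \<Longrightarrow> w \<in> ball 0 (r q) \<Longrightarrow> \<Delta> q w = w ^ N q * u q w"
      "\<And>q w. q \<in> Q \<Longrightarrow> w \<in> ball 0 (r q) \<Longrightarrow> u q w \<noteq> 0"
    by (auto simp: P_def)
  define \<rho>' where "\<rho>' = Min (insert (\<rho> ^ M) (r ` Q))"
  have \<rho>': "0 < \<rho>'" "\<rho>' \<le> \<rho> ^ M" "\<And>q. q \<in> Q \<Longrightarrow> \<rho>' \<le> r q"
    using finite_Q N(1) \<rho>M by (auto simp: \<rho>'_def)
  \<comment> \<open>One exponent for all discs: a sum of natural numbers dominates each
    summand.\<close>
  define NN where "NN = (\<Sum>q\<in>Q. N q)"
  have NN: "N q \<le> NN" if "q \<in> Q" for q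
    using finite_Q that by (auto simp: NN_def intro: member_le_sum)
  show ?thesis
  proof (intro exI[of _ NN] allI impI)
    fix g assume g: "\<forall>q\<in>Q. g q holomorphic_on ball 0 \<rho>"
    \<comment> \<open>Chosen so that \<open>f q t * \<Delta> q t = t ^ NN * g q t\<close>; it is
      holomorphic because \<open>u q\<close> has no zeros.\<close>
    define f where "f q t = t ^ (NN - N q) * g q t / u q t" for q t
    have f: "f q holomorphic_on ball 0 \<rho>'" if "q \<in> Q" for q
    proof -
      have "g q holomorphic_on ball 0 \<rho>'"
        using g[rule_format, OF that] \<rho>' \<rho>M by (auto intro: holomorphic_on_subset)
      moreover have "u q holomorphic_on ball 0 \<rho>'"
        using N(3)[OF that] \<rho>'(3)[OF that] by (auto intro: holomorphic_on_subset)
      ultimately show ?thesis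
        unfolding f_def using N(5)[OF that] \<rho>'(3)[OF that] by (intro holomorphic_intros) auto
    qed
    have \<rho>'\<rho>: "\<rho>' \<le> \<rho>" using \<rho>'(2) \<rho>M by simp
    obtain C where C: "\<And>n. C n holomorphic_on ball 0 (\<rho>' ^ M)"
      "\<And>s t. s \<in> ball 0 \<rho>' \<Longrightarrow> (\<Sum>n\<le>card sheets. C n (s ^ M) * t ^ n) = poly (lagrange f s) t"
      using lagrange_descends[of f, OF f \<rho>'(1) \<rho>'\<rho>] by blast
    have \<rho>'M: "\<rho>' ^ M \<le> \<rho>'" "0 < \<rho>' ^ M"
      using \<rho>' \<rho>'\<rho> \<rho> M_pos power_decreasing[of 1 M \<rho>'] by auto
    \<comment> \<open>Within the radius \<open>\<rho>' ^ M\<close> every \<open>t\<close> is the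
      value of a sheet at some \<open>s\<close> in \<open>ball 0 \<rho>'\<close>, where the value of
      the interpolating polynomial is known.\<close>
    have "t ^ NN * g q t = (\<Sum>n\<le>card sheets. C n (t ^ m q) * y q t ^ n)"
      if q: "q \<in> Q" and t: "t \<in> ball 0 (\<rho>' ^ M)" for q t
    proof -
      obtain s where s: "s \<in> ball 0 \<rho>'" "sheet (q, 0) s = t" "(q, 0) \<in> sheets" "t ^ m q = s ^ M"
        using sheet_surj[OF q t \<rho>'(1)] \<rho>'\<rho> \<rho> by auto
      have tr: "t \<in> ball 0 (r q)" using t \<rho>'M \<rho>'(3)[OF q] by auto
      have s\<rho>: "s \<in> ball 0 \<rho>" using s \<rho>'\<rho> by auto
      have "(\<Sum>n\<le>card sheets. C n (t ^ m q) * y q t ^ n) = poly (lagrange f s) (y q t)"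
        using C(2)[OF s(1)] s(4) by simp
      also have "\<dots> = f q t * poly (lagrange (\<lambda>_ _. 1) s) (y q t)"
        using poly_lagrange_sheet[OF s(3), of f s] poly_lagrange_sheet[OF s(3), of "\<lambda>_ _. 1" s] s(2)
        by simp
      also have "\<dots> = f q t * \<Delta> q t" using \<Delta>[OF s\<rho> s(4)] by simp
      also have "\<dots> = t ^ (NN - N q) * t ^ N q * g q t"
        using N(4,5)[OF q tr] by (simp add: f_def)
      also have "t ^ (NN - N q) * t ^ N q = t ^ NN"
        using NN[OF q] by (simp flip: power_add)
      finally show ?thesis by simp
    qed
    then show "\<exists>C r. 0 < r \<and> r \<le> \<rho> \<and> (\<forall>n. C n holomorphic_on ball 0 r) \<and>
      (\<forall>q\<in>Q. \<forall>t\<in>ball 0 r. t ^ NN * g q t = (\<Sum>n\<le>card sheets. C n (t ^ m q) * y q t ^ n))"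
      using C(1) \<rho>'M \<rho>'\<rho> by (intro exI[of _ C] exI[of _ "\<rho>' ^ M"]) auto
  qed
qed

end

subsection \<open>Parametrised discs on Riemann surfaces\<close>

lemma chart_facts:
  assumes "riemann_surface S" and "(W, c) \<in> atlas S"
  shows "openin (surface_top S) W" "open (c ` W)" "inj_on c W" "W \<subseteq> points S"
    and "\<And>A. open A \<Longrightarrow> openin (surface_top S) {x \<in> W. c x \<in> A}"
    and "\<And>B. openin (surface_top S) B \<Longrightarrow> open (c ` (B \<inter> W))"
proof -
  show W: "openin (surface_top S) W" and cW: "open (c ` W)"
    using assms unfolding riemann_surface_def by blast+
  have hom: "homeomorphic_map (subtopology (surface_top S) W) (top_of_set (c ` W)) c"
    using assms unfolding riemann_surface_def by blast
  show WS: "W \<subseteq> points S" using W by (rule openin_subset)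
  then have top: "topspace (subtopology (surface_top S) W) = W" by auto
  show "inj_on c W" using homeomorphic_imp_injective_map[OF hom] top by simp
  show "openin (surface_top S) {x \<in> W. c x \<in> A}" if "open A" for A
  proof -
    have "openin (subtopology (surface_top S) W) {x \<in> W. c x \<in> c ` W \<inter> A}"
      using openin_continuous_map_preimage[OF homeomorphic_imp_continuous_map[OF hom],
          of "c ` W \<inter> A", unfolded top]
        that by (simp add: openin_open_Int)
    moreover have "{x \<in> W. c x \<in> c ` W \<inter> A} = {x \<in> W. c x \<in> A}" by auto
    ultimately show ?thesis using W by (simp add: openin_open_subtopology)
  qed
  show "open (c ` (B \<inter> W))" if "openin (surface_top S) B" for B
  proof -
    have "openin (subtopology (surface_top S) W) (B \<inter> W)"
      using that by (auto simp: openin_subtopology)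
    then have "openin (top_of_set (c ` W)) (c ` (B \<inter> W))"
      using homeomorphic_imp_open_map[OF hom] by (auto simp: open_map_def)
    then show ?thesis using cW by (simp add: openin_open_eq)
  qed
qed

text \<open>The inverse of a chart centred at \<open>T 0\<close>, as a condition on \<open>T\<close>
  alone: injective, continuous, open, and holomorphic in each chart of the atlas. Local arguments
  then take place on balls around 0, and coordinates can be changed without enlarging the
  atlas.\<close>

definition disc :: "'a surface \<Rightarrow> (complex \<Rightarrow> 'a) \<Rightarrow> real \<Rightarrow> bool" where
  "disc S T r \<longleftrightarrow> 0 < r \<and> T ` ball 0 r \<subseteq> points S \<and> inj_on T (ball 0 r) \<and>
     (\<forall>B. openin (surface_top S) B \<longrightarrow> open {t \<in> ball 0 r. T t \<in> B}) \<and>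
     (\<forall>A. open A \<longrightarrow> A \<subseteq> ball 0 r \<longrightarrow> openin (surface_top S) (T ` A)) \<and>
     (\<forall>(W, c)\<in>atlas S. (c \<circ> T) holomorphic_on {t \<in> ball 0 r. T t \<in> W})"

lemma discD:
  assumes "disc S T r"
  shows "0 < r" "T ` ball 0 r \<subseteq> points S" "inj_on T (ball 0 r)"
    "\<And>B. openin (surface_top S) B \<Longrightarrow> open {t \<in> ball 0 r. T t \<in> B}"
    "\<And>A. open A \<Longrightarrow> A \<subseteq> ball 0 r \<Longrightarrow> openin (surface_top S) (T ` A)"
    "\<And>W c. (W, c) \<in> atlas S \<Longrightarrow> (c \<circ> T) holomorphic_on {t \<in> ball 0 r. T t \<in> W}"
  using assms unfolding disc_def by blast+

lemma disc_in_points: "disc S T r \<Longrightarrow> t \<in> ball 0 r \<Longrightarrow> T t \<in> points S"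
  using discD(2) by blast

lemma disc_reparam:
  assumes T: "disc S T r" and r': "0 < r'" and g: "g holomorphic_on ball 0 r'"
    and inj: "inj_on g (ball 0 r')" and sub: "g ` ball 0 r' \<subseteq> ball 0 r"
  shows "disc S (\<lambda>t. T (g t)) r'"
  unfolding disc_def
proof (intro conjI allI impI)
  show "(\<lambda>t. T (g t)) ` ball 0 r' \<subseteq> points S" using discD(2)[OF T] sub by blast
  show "inj_on (\<lambda>t. T (g t)) (ball 0 r')"
    using comp_inj_on[OF inj inj_on_subset[OF discD(3)[OF T] sub]] by (simp add: o_def)
  fix B assume "openin (surface_top S) B"
  then have "open (ball 0 r' \<inter> g -` {t \<in> ball 0 r. T t \<in> B})"
    by (intro continuous_open_preimage holomorphic_on_imp_continuous_on g discD(4)[OF T]) auto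
  moreover have "ball 0 r' \<inter> g -` {t \<in> ball 0 r. T t \<in> B} = {t \<in> ball 0 r'. T (g t) \<in> B}"
    using sub by blast
  ultimately show "open {t \<in> ball 0 r'. T (g t) \<in> B}" by simp
next
  fix A :: "complex set" assume A: "open A" "A \<subseteq> ball 0 r'"
  \<comment> \<open>Injective holomorphic functions are open maps.\<close>
  have "open (g ` A)"
    using A g inj by (intro open_mapping_thm3) (auto intro: holomorphic_on_subset inj_on_subset)
  then have "openin (surface_top S) (T ` (g ` A))"
    using A sub by (intro discD(5)[OF T]) auto
  then show "openin (surface_top S) ((\<lambda>t. T (g t)) ` A)" by (simp add: image_image)
next
  show "\<forall>(W, c)\<in>atlas S. (c \<circ> (\<lambda>t. T (g t))) holomorphic_on {t \<in> ball 0 r'. T (g t) \<in> W}"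
  proof clarify
    fix W c assume "(W, c) \<in> atlas S"
    then have 1: "(c \<circ> T) holomorphic_on {t \<in> ball 0 r. T t \<in> W}" by (rule discD(6)[OF T])
    have 2: "g ` {t \<in> ball 0 r'. T (g t) \<in> W} \<subseteq> {t \<in> ball 0 r. T t \<in> W}" using sub by blast
    have 3: "g holomorphic_on {t \<in> ball 0 r'. T (g t) \<in> W}" using g by (auto intro: holomorphic_on_subset)
    show "(c \<circ> (\<lambda>t. T (g t))) holomorphic_on {t \<in> ball 0 r'. T (g t) \<in> W}"
      using holomorphic_on_compose_gen[OF 3 1 2] by (simp add: o_def)
  qed
qed (use r' in auto)

lemma disc_smaller: "disc S T r \<Longrightarrow> 0 < r' \<Longrightarrow> r' \<le> r \<Longrightarrow> disc S T r'"
  using disc_reparam[of S T r r' "\<lambda>t. t"] by (simp add: ball_subset_ball_iff)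

lemma disc_shrink:
  assumes "disc S T r" "openin (surface_top S) B" "T 0 \<in> B"
  obtains r' where "0 < r'" "r' \<le> r" "T ` ball 0 r' \<subseteq> B" "disc S T r'"
proof -
  have "open {t \<in> ball 0 r. T t \<in> B}" "0 \<in> {t \<in> ball 0 r. T t \<in> B}"
    using assms discD(1,4)[OF assms(1)] by auto
  then obtain r' where r': "0 < r'" "ball 0 r' \<subseteq> {t \<in> ball 0 r. T t \<in> B}"
    by (meson open_contains_ball)
  then have "ball 0 r' \<subseteq> ball (0::complex) r" by blast
  then have "r' \<le> r" using r' by (auto simp: ball_subset_ball_iff)
  then show ?thesis using that[of r'] r' disc_smaller[OF assms(1)] by blast
qed

lemma disc_exists:
  assumes S: "riemann_surface S" and q: "q \<in> points S"
  obtains T r where "disc S T r" "T 0 = q"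
proof -
  obtain W c where Wc: "(W, c) \<in> atlas S" "q \<in> W"
    using S q unfolding riemann_surface_def by auto
  note ch = chart_facts[OF S Wc(1)]
  obtain r where r: "0 < r" "ball (c q) r \<subseteq> c ` W"
    using ch(2) Wc(2) by (meson imageI open_contains_ball)
  define T where "T t = inv_into W c (c q + t)" for t
  have cT: "T t \<in> W \<and> c (T t) = c q + t" if "t \<in> ball 0 r" for t
  proof -
    have "c q + t \<in> c ` W" using that r(2) by (auto simp: dist_norm)
    then show ?thesis unfolding T_def by (simp add: inv_into_into f_inv_into_f)
  qed
  have Tc: "T (c x - c q) = x" if "x \<in> W" for x
    unfolding T_def using that ch(3) by simp
  have "disc S T r"
    unfolding disc_def
  proof (intro conjI allI impI)
    show "0 < r" by (rule r)
    show "T ` ball 0 r \<subseteq> points S" using cT ch(4) by blast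
    show "inj_on T (ball 0 r)"
    proof (rule inj_onI)
      fix s t assume "s \<in> ball 0 r" "t \<in> ball 0 r" "T s = T t"
      then show "s = t" using cT[of s] cT[of t] by (metis add_left_cancel)
    qed
    fix B assume B: "openin (surface_top S) B"
    have "{t \<in> ball 0 r. T t \<in> B} = ball 0 r \<inter> (\<lambda>z. z - c q) ` (c ` (B \<inter> W))"
    proof (intro equalityI subsetI)
      fix t assume "t \<in> {t \<in> ball 0 r. T t \<in> B}"
      then have t: "t \<in> ball 0 r" "T t \<in> B" by auto
      then have "t = c (T t) - c q" using cT[of t] by simp
      then show "t \<in> ball 0 r \<inter> (\<lambda>z. z - c q) ` (c ` (B \<inter> W))" using t cT[of t] by blast
    qed (use Tc in auto)
    moreover have "open ((\<lambda>z. z - c q) ` (c ` (B \<inter> W)))"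
      using ch(6)[OF B] by (simp add: open_translation_subtract)
    ultimately show "open {t \<in> ball 0 r. T t \<in> B}" by auto
  next
    fix A :: "complex set" assume A: "open A" "A \<subseteq> ball 0 r"
    have "T ` A = {x \<in> W. c x \<in> (+) (c q) ` A}"
    proof (intro equalityI subsetI)
      fix x assume "x \<in> {x \<in> W. c x \<in> (+) (c q) ` A}"
      then obtain t where "x \<in> W" "c x = c q + t" "t \<in> A" by auto
      then show "x \<in> T ` A" using Tc[of x] by force
    qed (use A cT in auto)
    then show "openin (surface_top S) (T ` A)"
      using ch(5)[of "(+) (c q) ` A"] A by (simp add: open_translation)
  next
    show "\<forall>(W', c')\<in>atlas S. (c' \<circ> T) holomorphic_on {t \<in> ball 0 r. T t \<in> W'}"
    proof clarify
      fix W' c' assume W': "(W', c') \<in> atlas S"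
      have 1: "(c' \<circ> inv_into W c) holomorphic_on (c ` (W \<inter> W'))"
        using S Wc(1) W' unfolding riemann_surface_def by blast
      have 2: "(\<lambda>t. c q + t) ` {t \<in> ball 0 r. T t \<in> W'} \<subseteq> c ` (W \<inter> W')"
      proof safe
        fix t assume t: "t \<in> ball 0 r" "T t \<in> W'"
        then show "c q + t \<in> c ` (W \<inter> W')" using cT[OF t(1)] by (metis IntI imageI)
      qed
      have 3: "(\<lambda>t. c q + t) holomorphic_on {t \<in> ball 0 r. T t \<in> W'}" by (intro holomorphic_intros)
      show "(c' \<circ> T) holomorphic_on {t \<in> ball 0 r. T t \<in> W'}"
        using holomorphic_on_compose_gen[OF 3 1 2] by (simp add: o_def T_def)
    qed
  qed
  moreover have "T 0 = q" using Tc[OF Wc(2)] by simp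
  ultimately show ?thesis using that by blast
qed

lemma disc_holomorphic:
  assumes S: "riemann_surface S" and f: "holomorphic_on_surface S f" and T: "disc S T r"
  shows "(\<lambda>t. f (T t)) holomorphic_on ball 0 r"
proof -
  have "(\<lambda>t. f (T t)) holomorphic_on (\<Union>Wc\<in>atlas S. {t \<in> ball 0 r. T t \<in> fst Wc})"
  proof (rule holomorphic_on_UN_open)
    fix Wc assume "Wc \<in> atlas S"
    then obtain W c where Wc: "Wc = (W, c)" "(W, c) \<in> atlas S" by (metis surj_pair)
    note ch = chart_facts[OF S Wc(2)]
    show "open {t \<in> ball 0 r. T t \<in> fst Wc}" using discD(4)[OF T ch(1)] Wc by simp
    have 1: "(f \<circ> inv_into W c) holomorphic_on (c ` W)"
      using f Wc unfolding holomorphic_on_surface_def by blast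
    have "((f \<circ> inv_into W c) \<circ> (c \<circ> T)) holomorphic_on {t \<in> ball 0 r. T t \<in> W}"
      by (rule holomorphic_on_compose_gen[OF discD(6)[OF T Wc(2)] 1]) auto
    then have "(\<lambda>t. f (T t)) holomorphic_on {t \<in> ball 0 r. T t \<in> W}"
      by (rule holomorphic_transform) (use ch(3) in auto)
    then show "(\<lambda>t. f (T t)) holomorphic_on {t \<in> ball 0 r. T t \<in> fst Wc}" by (simp add: Wc)
  qed
  moreover have "(\<Union>Wc\<in>atlas S. {t \<in> ball 0 r. T t \<in> fst Wc}) = ball 0 r"
  proof (intro equalityI subsetI)
    fix t :: complex assume t: "t \<in> ball 0 r"
    have "points S = (\<Union>(W, c)\<in>atlas S. W)" using S unfolding riemann_surface_def by blast
    then obtain W c where "(W, c) \<in> atlas S" "T t \<in> W" using disc_in_points[OF T t] by auto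
    then show "t \<in> (\<Union>Wc\<in>atlas S. {t \<in> ball 0 r. T t \<in> fst Wc})"
      using t by (intro UN_I[of "(W, c)"]) auto
  qed auto
  ultimately show ?thesis by simp
qed

text \<open>Discs are open maps and every point is the centre of one, so continuity can be tested
  along discs.\<close>

lemma continuous_map_discs:
  assumes "riemann_surface S"
    and cont: "\<And>T r B. disc S T r \<Longrightarrow> openin Y B \<Longrightarrow> open {t \<in> ball 0 r. f (T t) \<in> B}"
    and im: "f ` points S \<subseteq> topspace Y"
  shows "continuous_map (surface_top S) Y f"
  unfolding continuous_map
proof (intro conjI allI impI im)
  fix B assume B: "openin Y B"
  show "openin (surface_top S) {x \<in> points S. f x \<in> B}"
  proof (subst openin_subopen, intro ballI)
    fix x assume x: "x \<in> {x \<in> points S. f x \<in> B}"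
    then obtain T r where T: "disc S T r" "T 0 = x"
      using disc_exists[OF assms(1), of x] by blast
    define A where "A = {t \<in> ball 0 r. f (T t) \<in> B}"
    have "openin (surface_top S) (T ` A)"
      using cont[OF T(1) B] by (intro discD(5)[OF T(1)]) (auto simp: A_def)
    moreover have "x \<in> T ` A" using x T discD(1)[OF T(1)] by (force simp: A_def)
    moreover have "T ` A \<subseteq> {x \<in> points S. f x \<in> B}"
      using disc_in_points[OF T(1)] by (auto simp: A_def)
    ultimately show "\<exists>T. openin (surface_top S) T \<and> x \<in> T \<and> T \<subseteq> {x \<in> points S. f x \<in> B}"
      by blast
  qed
qed

lemma holomorphic_vec_continuous:
  fixes h :: "'a \<Rightarrow> complex^'n"
  assumes S: "riemann_surface S" and h: "\<And>i. holomorphic_on_surface S (\<lambda>p. h p $ i)"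
  shows "continuous_map (surface_top S) euclidean h"
proof (rule continuous_map_discs[OF S])
  fix T r and B :: "(complex^'n) set" assume T: "disc S T r" and B: "openin euclidean B"
  have "continuous_on (ball 0 r) (\<lambda>t. \<chi> i. h (T t) $ i)"
    by (intro continuous_on_vec_lambda holomorphic_on_imp_continuous_on disc_holomorphic[OF S h T])
  then have "continuous_on (ball 0 r) (\<lambda>t. h (T t))" by simp
  from continuous_open_preimage[OF this open_ball, of B] B
  show "open {t \<in> ball 0 r. h (T t) \<in> B}" by (simp add: vimage_def Int_def conj_commute)
qed auto

text \<open>Write \<open>u w = w ^ n * v w\<close> with \<open>v\<close> zero-free. An
  \<open>n\<close>-th root of \<open>v\<close>, obtained from a logarithm on the disc, gives a
  coordinate \<open>k\<close> with \<open>k ^ n = u\<close>, and \<open>g\<close> is its local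
  inverse.\<close>

lemma holomorphic_power_coordinate:
  assumes u: "u holomorphic_on ball 0 R" and u0: "u 0 = 0" and t0: "t0 \<in> ball 0 R" "u t0 \<noteq> 0"
  obtains g r and n :: nat where "0 < r" "0 < n" "g holomorphic_on ball 0 r" "inj_on g (ball 0 r)"
    "g ` ball 0 r \<subseteq> ball 0 R" "g 0 = 0" "\<And>t. t \<in> ball 0 r \<Longrightarrow> u (g t) = t ^ n"
proof -
  obtain n r1 v where r1: "0 < r1" "r1 \<le> R" and v: "v holomorphic_on ball 0 r1"
    and uv: "\<And>w. w \<in> ball 0 r1 \<Longrightarrow> u w = w ^ n * v w" and v0: "\<And>w. w \<in> ball 0 r1 \<Longrightarrow> v w \<noteq> 0"
    by (rule holomorphic_factor_zero[OF u t0]) (rule that)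
  have n: "n > 0" using uv[of 0] v0[of 0] r1 u0 by (cases n) auto
  obtain l where l: "l holomorphic_on ball 0 r1" "\<And>z. z \<in> ball 0 r1 \<Longrightarrow> v z = exp (l z)"
    by (rule contractible_imp_holomorphic_log[OF v convex_imp_contractible[OF convex_ball] v0], assumption) (rule that)
  define k where "k w = w * exp (l w / of_nat n)" for w
  have k: "k holomorphic_on ball 0 r1"
    unfolding k_def using l(1) n by (intro holomorphic_intros) auto
  have ku: "k w ^ n = u w" if "w \<in> ball 0 r1" for w
    using that n by (simp add: k_def power_mult_distrib uv l flip: exp_of_nat_mult)
  have e: "(\<lambda>w. exp (l w / of_nat n)) holomorphic_on ball 0 r1"
    using l(1) n by (intro holomorphic_intros) auto
  have c0: "0 \<in> ball (0::complex) r1" using r1 by simp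
  have "deriv k 0 = exp (l 0 / of_nat n)"
    using DERIV_mult'[OF DERIV_ident holomorphic_derivI[OF e open_ball c0]]
    unfolding k_def by (simp add: DERIV_imp_deriv)
  then have dk: "deriv k 0 \<noteq> 0" by simp
  obtain r2 where r2: "r2 > 0" "ball (0::complex) r2 \<subseteq> ball 0 r1" "inj_on k (ball 0 r2)"
    by (rule has_complex_derivative_locally_injective[OF k c0 open_ball dk]) (rule that)
  have k2: "k holomorphic_on ball 0 r2" using k r2(2) by (rule holomorphic_on_subset)
  obtain g where g: "g holomorphic_on k ` ball 0 r2" "\<And>z. z \<in> ball 0 r2 \<Longrightarrow> g (k z) = z"
    by (rule holomorphic_has_inverse[OF k2 open_ball r2(3)]) (rule that)
  have "open (k ` ball 0 r2)" by (rule open_mapping_thm3[OF k2 open_ball r2(3)])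
  moreover have k0: "k 0 = 0" by (simp add: k_def)
  have "0 \<in> k ` ball 0 r2" using r2(1) k0 by force
  ultimately obtain r where r: "r > 0" "ball 0 r \<subseteq> k ` ball 0 r2" by (meson open_contains_ball)
  have g': "g t \<in> ball 0 r2 \<and> k (g t) = t" if "t \<in> ball 0 r" for t
    using that r(2) g(2) by force
  show ?thesis
  proof (rule that[of r n g])
    show "g holomorphic_on ball 0 r" using g(1) r(2) by (rule holomorphic_on_subset)
    show "inj_on g (ball 0 r)"
    proof (rule inj_onI)
      fix s t assume "s \<in> ball 0 r" "t \<in> ball 0 r" "g s = g t"
      then show "s = t" using g'[of s] g'[of t] by metis
    qed
    have "ball (0::complex) r1 \<subseteq> ball 0 R" using r1 by (simp add: ball_subset_ball_iff)
    then show "g ` ball 0 r \<subseteq> ball 0 R" using g' r2(2) by blast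
    show "g 0 = 0" using g(2)[of 0] r2(1) k0 by simp
    show "u (g t) = t ^ n" if "t \<in> ball 0 r" for t
    proof -
      have "g t \<in> ball 0 r1" using g'[OF that] r2(2) by blast
      from ku[OF this] show ?thesis using g'[OF that] by simp
    qed
  qed (use r n in auto)
qed

lemma Hausdorff_space_separate_finite:
  assumes X: "Hausdorff_space X" and F: "finite F" "F \<subseteq> topspace X"
  obtains B where "\<And>p. p \<in> F \<Longrightarrow> openin X (B p)" "\<And>p. p \<in> F \<Longrightarrow> p \<in> B p"
    "\<And>p q. p \<in> F \<Longrightarrow> q \<in> F \<Longrightarrow> p \<noteq> q \<Longrightarrow> B p \<inter> B q = {}"
proof -
  have "\<exists>U V. openin X U \<and> openin X V \<and> p \<in> U \<and> q \<in> V \<and> disjnt U V"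
    if "p \<in> F" "q \<in> F" "p \<noteq> q" for p q
    using X F(2) that unfolding Hausdorff_space_def by blast
  then obtain U V where UV: "\<And>p q. p \<in> F \<Longrightarrow> q \<in> F \<Longrightarrow> p \<noteq> q \<Longrightarrow>
      openin X (U p q) \<and> openin X (V p q) \<and> p \<in> U p q \<and> q \<in> V p q \<and> disjnt (U p q) (V p q)"
    by metis
  \<comment> \<open>For a singleton \<open>F\<close> the intersection runs over the empty family;
    intersecting with \<open>topspace X\<close> keeps the result open in \<open>X\<close>.\<close>
  define B where "B p = (\<Inter>q\<in>F - {p}. U p q \<inter> V q p) \<inter> topspace X" for p
  show ?thesis
  proof (rule that[of B])
    show "openin X (B p)" if "p \<in> F" for p
      unfolding B_def by (rule openin_INT) (use F UV that in auto)
    show "p \<in> B p" if "p \<in> F" for p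
      using that F UV by (auto simp: B_def)
    show "B p \<inter> B q = {}" if "p \<in> F" "q \<in> F" "p \<noteq> q" for p q
      using UV[OF that] that by (auto simp: B_def disjnt_def)
  qed
qed

subsection \<open>Holomaps\<close>

lemma holomap_exceptional:
  assumes "holomap S U h"
  obtains E where "finite E" "E \<subseteq> points S" "\<And>p. p \<in> points S - E \<Longrightarrow> nonsingular_at S h p"
    "inj_on h (points S - E)"
  using assms unfolding holomap_def by blast

text \<open>At most one point of a fibre lies outside the exceptional set.\<close>

lemma holomap_finite_fibre:
  assumes "holomap S U h" shows "finite {p \<in> points S. h p = P}"
proof -
  obtain E where E: "finite E" "inj_on h (points S - E)"
    using holomap_exceptional[OF assms] by metis
  have "finite (h -` {P} \<inter> (points S - E))"
    using finite_vimage_IntI[of "{P}" h, OF _ E(2)] by simp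
  then have "finite (E \<union> (h -` {P} \<inter> (points S - E)))" using E(1) by simp
  then show ?thesis by (rule rev_finite_subset) auto
qed

text \<open>Properness enters the proof here. A proper map is closed, so the points mapped near
  \<open>P\<close> all lie near the fibre over \<open>P\<close>; if the fibre is empty, a whole
  neighbourhood of \<open>P\<close> is missed.\<close>

lemma holomap_fibre_neighbourhood:
  assumes h: "holomap S U h" and P: "P \<in> U" and B: "openin (surface_top S) B"
    and fibre: "{p \<in> points S. h p = P} \<subseteq> B"
  obtains W where "open W" "P \<in> W" "\<And>p. p \<in> points S \<Longrightarrow> h p \<in> W \<Longrightarrow> p \<in> B"
proof -
  have "closed_map (surface_top S) (top_of_set U) h" and U: "open U"
    using h unfolding holomap_def by (auto intro: proper_imp_closed_map)
  have "\<forall>B P. openin (surface_top S) B \<and> P \<in> topspace (top_of_set U) \<and>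
      {p \<in> points S. h p = P} \<subseteq> B \<longrightarrow>
      (\<exists>W. openin (top_of_set U) W \<and> P \<in> W \<and> {p \<in> points S. h p \<in> W} \<subseteq> B)"
    using \<open>closed_map (surface_top S) (top_of_set U) h\<close>[unfolded closed_map_fibre_neighbourhood]
    by (rule conjunct2)
  moreover have "P \<in> topspace (top_of_set U)" using P by simp
  ultimately obtain W where W: "openin (top_of_set U) W" "P \<in> W" "{p \<in> points S. h p \<in> W} \<subseteq> B"
    using B fibre by meson
  have "open W" using W(1) U by (simp add: openin_open_eq)
  then show ?thesis using that[of W] W by blast
qed

subsection \<open>Functions that descend to the image of a holomap\<close>

text \<open>A single \<open>F\<close> has to serve all points of \<open>S\<close> that map into
  \<open>W\<close>, hence all branches of the curve through \<open>P\<close> at once.\<close>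

definition descends_at :: "'a surface \<Rightarrow> ('a \<Rightarrow> complex^'n) \<Rightarrow> ('a \<Rightarrow> complex) \<Rightarrow> complex^'n \<Rightarrow> bool" where
  "descends_at S h f P \<longleftrightarrow> (\<exists>W F. open W \<and> P \<in> W \<and> holomorphic_multi F W \<and>
     (\<forall>p\<in>points S. h p \<in> W \<longrightarrow> f p = F (h p)))"

lemma descends_at_add:
  assumes "descends_at S h f P" "descends_at S h g P"
  shows "descends_at S h (\<lambda>p. f p + g p) P"
proof -
  obtain W F where F: "open W" "P \<in> W" "holomorphic_multi F W"
      "\<forall>p\<in>points S. h p \<in> W \<longrightarrow> f p = F (h p)"
    using assms(1) unfolding descends_at_def by blast
  obtain W' G where G: "open W'" "P \<in> W'" "holomorphic_multi G W'"
      "\<forall>p\<in>points S. h p \<in> W' \<longrightarrow> g p = G (h p)"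
    using assms(2) unfolding descends_at_def by blast
  have "holomorphic_multi (\<lambda>z. F z + G z) (W \<inter> W')"
    using F(3) G(3) by (intro holomorphic_multi_add) (auto intro: holomorphic_multi_subset)
  then show ?thesis
    unfolding descends_at_def using F G
    by (intro exI[of _ "W \<inter> W'"] exI[of _ "\<lambda>z. F z + G z"]) auto
qed

lemma descends_at_scale:
  assumes "descends_at S h f P"
  shows "descends_at S h (\<lambda>p. c * f p) P"
proof -
  obtain W F where F: "open W" "P \<in> W" "holomorphic_multi F W"
      "\<forall>p\<in>points S. h p \<in> W \<longrightarrow> f p = F (h p)"
    using assms(1) unfolding descends_at_def by blast
  then show ?thesis
    unfolding descends_at_def
    by (intro exI[of _ W] exI[of _ "\<lambda>z. c * F z"]) (auto intro: holomorphic_multi_mult holomorphic_multi_const)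
qed

lemma holomorphic_vanishing_order:
  assumes f: "f holomorphic_on ball 0 r" and r: "0 < r" and z: "\<And>i. i < N \<Longrightarrow> (deriv ^^ i) f 0 = 0"
  obtains g where "g holomorphic_on ball 0 r" "\<And>t. t \<in> ball 0 r \<Longrightarrow> f t = t ^ N * g t"
proof -
  define a where "a n = (deriv ^^ n) f 0 / fact n" for n
  \<comment> \<open>The value at 0 is the first Taylor coefficient that is not assumed to
    vanish.\<close>
  define g where "g t = (if t = 0 then a N else f t / t ^ N)" for t
  have sums: "(\<lambda>n. a n * t ^ n) sums f t" if "t \<in> ball 0 r" for t
    using holomorphic_power_series[OF f that] by (simp add: a_def)
  have g: "(\<lambda>n. a (n + N) * (t - 0) ^ n) sums g t" if "t \<in> ball 0 r" for t
  proof (cases "t = 0")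
    case True
    then show ?thesis using powser_sums_zero[of "\<lambda>n. a (n + N)"] by (simp add: g_def)
  next
    case False
    have "(\<lambda>n. a (n + N) * t ^ (n + N)) sums (f t - (\<Sum>i<N. a i * t ^ i))"
      using sums[OF that] by (rule sums_split_initial_segment)
    moreover have "(\<Sum>i<N. a i * t ^ i) = 0"
      by (rule sum.neutral) (simp add: a_def z)
    ultimately have "(\<lambda>n. a (n + N) * t ^ (n + N) / t ^ N) sums (f t / t ^ N)"
      by (intro sums_divide) simp
    then show ?thesis using False by (simp add: power_add g_def)
  qed
  show ?thesis
  proof (rule that[of g])
    show "g holomorphic_on ball 0 r" using g by (rule power_series_holomorphic)
    show "f t = t ^ N * g t" if "t \<in> ball 0 r" for t
    proof (cases "t = 0 \<and> N > 0")
      case True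
      then show ?thesis using z[of 0] by simp
    next
      case False
      then show ?thesis by (auto simp: g_def a_def)
    qed
  qed
qed

text \<open>A local normal form of \<open>h\<close> over \<open>P\<close>. A generic linear form of
  \<open>h - P\<close> vanishes at the centre of each branch without vanishing identically on it, so
  a change of coordinate turns it into \<open>t ^ m q\<close>. Away from their centres the discs
  avoid the exceptional set, where injectivity of \<open>h\<close> could fail.\<close>

lemma discs_over_point:
  fixes h :: "'a \<Rightarrow> complex^'n" and P :: "complex^'n"
  assumes S: "riemann_surface S" and h: "holomap S U h"
  defines "Q \<equiv> {p \<in> points S. h p = P}"
  obtains T a \<rho> and m :: "'a \<Rightarrow> nat" where "0 < \<rho>" "\<rho> \<le> 1" "\<And>q. q \<in> Q \<Longrightarrow> disc S (T q) \<rho>" "\<And>q. q \<in> Q \<Longrightarrow> T q 0 = q"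
    "\<And>q. q \<in> Q \<Longrightarrow> m q > 0"
    "\<And>q t. q \<in> Q \<Longrightarrow> t \<in> ball 0 \<rho> \<Longrightarrow> (\<Sum>i\<in>UNIV. a $ i * (h (T q t) - P) $ i) = t ^ m q"
    "\<And>q q' t t'. q \<in> Q \<Longrightarrow> q' \<in> Q \<Longrightarrow> t \<in> ball 0 \<rho> - {0} \<Longrightarrow> t' \<in> ball 0 \<rho> - {0} \<Longrightarrow>
       h (T q t) = h (T q' t') \<Longrightarrow> q = q' \<and> t = t'"
proof -
  have finQ: "finite Q" unfolding Q_def by (rule holomap_finite_fibre[OF h])
  have hol: "holomorphic_on_surface S (\<lambda>p. h p $ i)" for i
    using h unfolding holomap_def by blast
  obtain E where E: "finite E" "E \<subseteq> points S" "inj_on h (points S - E)"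
    using holomap_exceptional[OF h] by metis
  have "Hausdorff_space (surface_top S)" using S unfolding riemann_surface_def by blast
  moreover have "finite (E \<union> Q)" "E \<union> Q \<subseteq> points S" using finQ E by (auto simp: Q_def)
  \<comment> \<open>The neighbourhoods separate the fibre from the points of \<open>E\<close> as
    well: a disc inside \<open>B q\<close> can meet \<open>E \<union> Q\<close> only at
    \<open>q\<close>, and discs with different centres are disjoint.\<close>
  ultimately obtain B where B: "\<And>p. p \<in> E \<union> Q \<Longrightarrow> openin (surface_top S) (B p)"
      "\<And>p. p \<in> E \<union> Q \<Longrightarrow> p \<in> B p"
      "\<And>p q. p \<in> E \<union> Q \<Longrightarrow> q \<in> E \<union> Q \<Longrightarrow> p \<noteq> q \<Longrightarrow> B p \<inter> B q = {}"
    using Hausdorff_space_separate_finite by (metis (no_types, lifting))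
  have "\<exists>T r. disc S T r \<and> T 0 = q \<and> T ` ball 0 r \<subseteq> B q" if q: "q \<in> Q" for q
  proof -
    obtain T r where T: "disc S T r" "T 0 = q"
      using disc_exists[OF S, of q] q by (auto simp: Q_def)
    have Bq: "openin (surface_top S) (B q)" "T 0 \<in> B q" using B(1,2)[of q] q T(2) by auto
    obtain r' where "T ` ball 0 r' \<subseteq> B q" "disc S T r'"
      by (rule disc_shrink[OF T(1) Bq]) (rule that)
    then show ?thesis using T by blast
  qed
  then obtain T0 r0 where T0: "\<And>q. q \<in> Q \<Longrightarrow> disc S (T0 q) (r0 q)" "\<And>q. q \<in> Q \<Longrightarrow> T0 q 0 = q"
      "\<And>q. q \<in> Q \<Longrightarrow> T0 q ` ball 0 (r0 q) \<subseteq> B q"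
    by metis
  have T0_notin: "T0 q t \<notin> E \<union> Q" if "q \<in> Q" "t \<in> ball 0 (r0 q)" "t \<noteq> 0" for q t
  proof
    assume "T0 q t \<in> E \<union> Q"
    moreover have "T0 q t \<in> B q" using T0(3) that by blast
    ultimately have "T0 q t = q" using B(2,3)[of "T0 q t"] B(3)[of q "T0 q t"] that(1) by blast
    then have "T0 q t = T0 q 0" using T0(2) that by simp
    then have "t = 0"
      using inj_onD[OF discD(3)[OF T0(1)[OF that(1)]]] that(2) discD(1)[OF T0(1)[OF that(1)]] by auto
    then show False using that by simp
  qed
  \<comment> \<open>Sample points, one on each punctured disc. They lie outside the fibre, so there
    is a linear form that is nonzero on \<open>h - P\<close> at all of them and thus does not vanish
    identically on any branch.\<close>
  define t0 where "t0 q = complex_of_real (r0 q / 2)" for q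
  have t0: "t0 q \<in> ball 0 (r0 q)" "t0 q \<noteq> 0" if "q \<in> Q" for q
    using discD(1)[OF T0(1)[OF that]] by (auto simp: t0_def)
  have v: "h (T0 q (t0 q)) - P \<noteq> 0" if "q \<in> Q" for q
    using T0_notin[OF that t0[OF that]] disc_in_points[OF T0(1) t0(1), OF that that]
    by (auto simp: Q_def)
  have "finite ((\<lambda>q. h (T0 q (t0 q)) - P) ` Q)" "0 \<notin> (\<lambda>q. h (T0 q (t0 q)) - P) ` Q"
    using finQ v by force+
  then obtain a :: "complex^'n" where a0: "\<And>v. v \<in> (\<lambda>q. h (T0 q (t0 q)) - P) ` Q \<Longrightarrow>
      (\<Sum>i\<in>UNIV. a $ i * v $ i) \<noteq> 0"
    by (rule separating_linear_form) (rule that)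
  then have a: "(\<Sum>i\<in>UNIV. a $ i * (h (T0 q (t0 q)) - P) $ i) \<noteq> 0" if "q \<in> Q" for q
    using that by blast
  define u where "u q t = (\<Sum>i\<in>UNIV. a $ i * (h (T0 q t) - P) $ i)" for q t
  define good where "good q r n g \<longleftrightarrow> 0 < r \<and> 0 < n \<and> g holomorphic_on ball 0 r \<and> inj_on g (ball 0 r) \<and>
      g ` ball 0 r \<subseteq> ball 0 (r0 q) \<and> g 0 = 0 \<and> (\<forall>t\<in>ball 0 r. u q (g t) = t ^ n)"
    for q r g and n :: nat
  have "\<exists>r n g. good q r n g" if q: "q \<in> Q" for q
  proof -
    have u: "u q holomorphic_on ball 0 (r0 q)"
      unfolding u_def using disc_holomorphic[OF S hol T0(1)[OF q]]
      by (auto intro!: holomorphic_intros)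
    have u0: "u q 0 = 0" using T0(2)[OF q] q by (simp add: u_def Q_def)
    have ut: "u q (t0 q) \<noteq> 0" unfolding u_def by (rule a[OF q])
    obtain g r n where "0 < r" "0 < n" "g holomorphic_on ball 0 r" "inj_on g (ball 0 r)"
        "g ` ball 0 r \<subseteq> ball 0 (r0 q)" "g 0 = 0" and *: "\<And>t. t \<in> ball 0 r \<Longrightarrow> u q (g t) = t ^ n"
      by (rule holomorphic_power_coordinate[OF u u0 t0(1)[OF q] ut]) (rule that)
    moreover have "\<forall>t\<in>ball 0 r. u q (g t) = t ^ n" by (intro ballI *)
    ultimately show ?thesis unfolding good_def by (intro exI conjI)
  qed
  then obtain r1 m g where good: "\<And>q. q \<in> Q \<Longrightarrow> good q (r1 q) (m q) (g q)" by metis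
  define \<rho> where "\<rho> = Min (insert 1 (r1 ` Q))"
  have \<rho>: "0 < \<rho>" "\<rho> \<le> 1" "\<And>q. q \<in> Q \<Longrightarrow> \<rho> \<le> r1 q"
    using finQ good by (auto simp: \<rho>_def good_def)
  define T where "T q t = T0 q (g q t)" for q t
  have g_ball: "g q t \<in> ball 0 (r0 q)" if "q \<in> Q" "t \<in> ball 0 \<rho>" for q t
  proof -
    have "t \<in> ball 0 (r1 q)" using that \<rho>(3) by force
    then show ?thesis using good[OF that(1)] unfolding good_def by blast
  qed
  have g_nz: "g q t \<noteq> 0" if "q \<in> Q" "t \<in> ball 0 \<rho> - {0}" for q t
  proof
    assume "g q t = 0"
    then have "g q t = g q 0" using good[OF that(1)] by (simp add: good_def)
    moreover have "t \<in> ball 0 (r1 q)" "0 \<in> ball 0 (r1 q)" using that \<rho>(1) \<rho>(3)[OF that(1)] by auto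
    moreover have "inj_on (g q) (ball 0 (r1 q))" using good[OF that(1)] by (simp add: good_def)
    ultimately have "t = 0" by (meson inj_onD)
    then show False using that by simp
  qed
  have disc: "disc S (T q) \<rho>" if "q \<in> Q" for q
  proof -
    have "disc S (T q) (r1 q)"
      unfolding T_def using good[OF that] by (intro disc_reparam[OF T0(1)[OF that]]) (auto simp: good_def)
    then show ?thesis using disc_smaller \<rho> that by blast
  qed
  show ?thesis
  proof (rule that[of \<rho> T m a])
    show "T q 0 = q" if "q \<in> Q" for q
      using good[OF that] T0(2)[OF that] by (simp add: T_def good_def)
    show "(\<Sum>i\<in>UNIV. a $ i * (h (T q t) - P) $ i) = t ^ m q" if "q \<in> Q" "t \<in> ball 0 \<rho>" for q t
    proof -
      have "t \<in> ball 0 (r1 q)" using that \<rho>(3) by force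
      then have "u q (g q t) = t ^ m q" using good[OF that(1)] by (simp add: good_def)
      then show ?thesis by (simp only: u_def T_def)
    qed
    fix q q' t t' assume q: "q \<in> Q" "q' \<in> Q" and t: "t \<in> ball 0 \<rho> - {0}" "t' \<in> ball 0 \<rho> - {0}"
      and eq: "h (T q t) = h (T q' t')"
    have "T q t \<in> points S - E" "T q' t' \<in> points S - E"
      using T0_notin[OF q(1) g_ball g_nz, OF q(1) _ q(1) t(1)]
        T0_notin[OF q(2) g_ball g_nz, OF q(2) _ q(2) t(2)] t
        disc_in_points[OF disc[OF q(1)], of t] disc_in_points[OF disc[OF q(2)], of t']
      by (auto simp: T_def)
    then have eq': "T q t = T q' t'" using inj_onD[OF E(3) eq] by blast
    have "T q t \<in> B q" "T q' t' \<in> B q'"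
      using T0(3)[OF q(1)] T0(3)[OF q(2)] g_ball[OF q(1), of t] g_ball[OF q(2), of t'] t
      by (auto simp: T_def)
    then have "q = q'" using B(3)[of q q'] q eq' by auto
    moreover have "t = t'"
      using inj_onD[OF discD(3)[OF disc[OF q(1)]], of t t'] eq' t \<open>q = q'\<close> by auto
    ultimately show "q = q' \<and> t = t'" by blast
  qed (use \<rho> disc good in \<open>auto simp: good_def\<close>)
qed

text \<open>The local ring at \<open>P\<close> contains a power of the maximal ideal of its normalisation. Interpolation
  along the projection \<open>z \<mapsto> \<Sum>i. a i * (z i - P i)\<close> exhibits the conductor.\<close>

lemma finite_jet_determines_descent:
  fixes h :: "'a \<Rightarrow> complex^'n"
  assumes S: "riemann_surface S" and h: "holomap S U h" and P: "P \<in> U"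
  obtains Q T \<rho> N where "finite (Q :: 'a set)" "\<And>q. q \<in> Q \<Longrightarrow> disc S (T q) \<rho>"
    "\<forall>f. holomorphic_on_surface S f \<longrightarrow>
      (\<forall>q\<in>Q. \<forall>i<N. (deriv ^^ i) (\<lambda>t. f (T q t)) 0 = 0) \<longrightarrow> descends_at S h f P"
proof -
  define Q where "Q = {p \<in> points S. h p = P}"
  have finQ: "finite Q" unfolding Q_def by (rule holomap_finite_fibre[OF h])
  have hol: "holomorphic_on_surface S (\<lambda>p. h p $ i)" for i
    using h unfolding holomap_def by blast
  obtain T a \<rho> and m :: "'a \<Rightarrow> nat" where \<rho>: "0 < \<rho>" "\<rho> \<le> 1"
    and disc: "\<And>q. q \<in> Q \<Longrightarrow> disc S (T q) \<rho>" and T0: "\<And>q. q \<in> Q \<Longrightarrow> T q 0 = q"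
    and m: "\<And>q. q \<in> Q \<Longrightarrow> m q > 0"
    and a: "\<And>q t. q \<in> Q \<Longrightarrow> t \<in> ball 0 \<rho> \<Longrightarrow> (\<Sum>i\<in>UNIV. a $ i * (h (T q t) - P) $ i) = t ^ m q"
    and inj: "\<And>q q' t t'. q \<in> Q \<Longrightarrow> q' \<in> Q \<Longrightarrow> t \<in> ball 0 \<rho> - {0} \<Longrightarrow> t' \<in> ball 0 \<rho> - {0} \<Longrightarrow>
       h (T q t) = h (T q' t') \<Longrightarrow> q = q' \<and> t = t'"
    by (rule discs_over_point[OF S h, of P, folded Q_def]) (rule that)
  \<comment> \<open>The sheets depend on \<open>Q\<close> and \<open>m\<close> alone. This auxiliary
    instance provides them before the separating function \<open>y\<close> is known, because
    \<open>y\<close> is chosen so as to separate their points over \<open>s0\<close>.\<close>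
  interpret b0: branched_discs Q m "\<lambda>_ t. t" \<rho>
    by unfold_locales (use finQ m \<rho> in auto)
  \<comment> \<open>Nonzero, so that no sheet over \<open>s0\<close> passes through a centre, and
    small enough for \<open>b.interpolation\<close>.\<close>
  define s0 where "s0 = complex_of_real (\<rho> ^ b0.M / 2)"
  have s0: "s0 \<noteq> 0" "s0 \<in> ball 0 (\<rho> ^ b0.M)"
    using \<rho> by (auto simp: s0_def norm_power norm_divide)
  have "\<rho> ^ b0.M \<le> \<rho>" using \<rho> b0.M_pos power_decreasing[of 1 b0.M \<rho>] by simp
  then have s0': "s0 \<in> ball 0 \<rho>" using s0 by auto
  have sheet: "b0.sheet k s0 \<in> ball 0 \<rho> - {0}" if "k \<in> b0.sheets" for k
    using b0.sheet_in_ball[OF that s0' \<rho>(2)] s0(1) b0.norm_sheet[of k s0] by auto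
  define x where "x k = h (T (fst k) (b0.sheet k s0))" for k
  have x_inj: "k = l" if kl: "k \<in> b0.sheets" "l \<in> b0.sheets" "x k = x l" for k l
  proof -
    have "fst k = fst l \<and> b0.sheet k s0 = b0.sheet l s0"
      using kl by (intro inj sheet) (auto simp: x_def b0.sheets_def)
    then have "fst k = fst l" "root_unity (m (fst k)) (snd k) = root_unity (m (fst k)) (snd l)"
      using s0(1) by (auto simp: b0.sheet_def)
    moreover have "snd k = snd l"
      using kl calculation m by (intro root_unity_inj[of "m (fst k)"]) (auto simp: b0.sheets_def)
    ultimately show ?thesis by (simp add: prod_eq_iff)
  qed
  \<comment> \<open>A linear form that is nonzero on these differences takes distinct values at the
    points \<open>x k\<close>.\<close>
  define X where "X = (\<lambda>(k, l). x k - x l) ` {(k, l) \<in> b0.sheets \<times> b0.sheets. k \<noteq> l}"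
  have "finite X" unfolding X_def
    by (intro finite_imageI finite_subset[OF _ finite_cartesian_product[OF b0.finite_sheets b0.finite_sheets]]) auto
  moreover have "0 \<notin> X" using x_inj by (auto simp: X_def)
  ultimately obtain b :: "complex^'n" where b: "\<And>v. v \<in> X \<Longrightarrow> (\<Sum>i\<in>UNIV. b $ i * v $ i) \<noteq> 0"
    by (rule separating_linear_form) (rule that)
  define \<beta> where "\<beta> z = (\<Sum>i\<in>UNIV. b $ i * z $ i)" for z
  define \<pi> where "\<pi> z = (\<Sum>i\<in>UNIV. a $ i * (z - P) $ i)" for z
  define y where "y q t = \<beta> (h (T q t))" for q t
  have y: "y q holomorphic_on ball 0 \<rho>" if "q \<in> Q" for q
    unfolding y_def \<beta>_def using disc_holomorphic[OF S hol disc[OF that]]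
    by (auto intro!: holomorphic_intros)
  interpret b: branched_discs Q m y \<rho>
    by unfold_locales (use finQ m \<rho> y in auto)
  have "inj_on (\<lambda>k. y (fst k) (b.sheet k s0)) b.sheets"
  proof (rule inj_onI, rule ccontr)
    fix k l assume kl: "k \<in> b.sheets" "l \<in> b.sheets" "y (fst k) (b.sheet k s0) = y (fst l) (b.sheet l s0)"
      and "k \<noteq> l"
    then have "x k - x l \<in> X" by (auto simp: X_def)
    from b[OF this] have "\<beta> (x k) - \<beta> (x l) \<noteq> 0"
      by (simp add: \<beta>_def right_diff_distrib sum_subtractf)
    then show False using kl by (simp add: y_def x_def)
  qed
  from b.interpolation[OF s0(2) this] obtain N where N: "\<forall>g. (\<forall>q\<in>Q. g q holomorphic_on ball 0 \<rho>) \<longrightarrow>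
    (\<exists>C r. 0 < r \<and> r \<le> \<rho> \<and> (\<forall>n. C n holomorphic_on ball 0 r) \<and>
      (\<forall>q\<in>Q. \<forall>t\<in>ball 0 r. t ^ N * g q t = (\<Sum>n\<le>card b.sheets. C n (t ^ m q) * y q t ^ n)))"
    by (rule exE)
  show ?thesis
  proof (rule that[of Q T \<rho> N], goal_cases)
    case 3
    show ?case
    proof (intro allI impI)
      fix f assume f: "holomorphic_on_surface S f"
        and "\<forall>q\<in>Q. \<forall>i<N. (deriv ^^ i) (\<lambda>t. f (T q t)) 0 = 0"
      then have vanish: "\<And>q i. q \<in> Q \<Longrightarrow> i < N \<Longrightarrow> (deriv ^^ i) (\<lambda>t. f (T q t)) 0 = 0" by blast
      have "\<exists>g. g holomorphic_on ball 0 \<rho> \<and> (\<forall>t\<in>ball 0 \<rho>. f (T q t) = t ^ N * g t)" if q: "q \<in> Q" for q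
      proof -
        obtain g where g: "g holomorphic_on ball 0 \<rho>" "\<And>t. t \<in> ball 0 \<rho> \<Longrightarrow> f (T q t) = t ^ N * g t"
          by (rule holomorphic_vanishing_order[OF disc_holomorphic[OF S f disc[OF q]] \<rho>(1) vanish[OF q]])
             (assumption, rule that)
        then show ?thesis by blast
      qed
      then obtain g where g: "\<And>q. q \<in> Q \<Longrightarrow> g q holomorphic_on ball 0 \<rho>"
          "\<And>q t. q \<in> Q \<Longrightarrow> t \<in> ball 0 \<rho> \<Longrightarrow> f (T q t) = t ^ N * g q t"
        by metis
      obtain C r where r: "0 < r" "r \<le> \<rho>" and C: "\<And>n. C n holomorphic_on ball 0 r"
        and Cg: "\<forall>q\<in>Q. \<forall>t\<in>ball 0 r. t ^ N * g q t = (\<Sum>n\<le>card b.sheets. C n (t ^ m q) * y q t ^ n)"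
        using N[rule_format, of g] g(1) by blast
      define W0 where "W0 = \<pi> -` ball 0 r"
      \<comment> \<open>The interpolation formula with \<open>t ^ m q\<close> and
        \<open>y q t\<close> replaced by the functions \<open>\<pi>\<close> and
        \<open>\<beta>\<close> of the ambient point, which makes it holomorphic on a neighbourhood
        of \<open>P\<close>.\<close>
      define F where "F z = (\<Sum>n\<le>card b.sheets. C n (\<pi> z) * \<beta> z ^ n)" for z
      have \<pi>: "holomorphic_multi \<pi> A" for A
      proof -
        have "\<pi> = (\<lambda>z. \<Sum>i\<in>UNIV. a $ i * (z $ i + - P $ i))" by (simp add: \<pi>_def fun_eq_iff)
        then show ?thesis
          by (simp only:, intro holomorphic_multi_sum holomorphic_multi_mult holomorphic_multi_const
            holomorphic_multi_add holomorphic_multi_nth)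
      qed
      have \<beta>: "holomorphic_multi \<beta> A" for A
        unfolding \<beta>_def
        by (intro holomorphic_multi_sum holomorphic_multi_mult holomorphic_multi_const holomorphic_multi_nth)
      have "open W0"
        unfolding W0_def using holomorphic_multi_continuous_on[OF \<pi>, of UNIV]
        by (intro open_vimage) auto
      moreover have "P \<in> W0" using r by (simp add: W0_def \<pi>_def)
      moreover have F: "holomorphic_multi F W0"
        unfolding F_def
        by (intro holomorphic_multi_sum holomorphic_multi_mult holomorphic_multi_power \<beta>
            holomorphic_multi_compose[OF \<pi> C open_ball]) (simp add: W0_def)
      have Ff: "f (T q t) = F (h (T q t))" if q: "q \<in> Q" and t: "t \<in> ball 0 r" for q t
      proof -
        have t\<rho>: "t \<in> ball 0 \<rho>" using t r by simp
        have "F (h (T q t)) = (\<Sum>n\<le>card b.sheets. C n (t ^ m q) * y q t ^ n)"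
          unfolding F_def \<pi>_def a[OF q t\<rho>] y_def ..
        also have "\<dots> = f (T q t)" using Cg q t g(2)[OF q t\<rho>] by simp
        finally show ?thesis by simp
      qed
      \<comment> \<open>The formula is known on the discs only; properness provides a neighbourhood
        of \<open>P\<close> whose preimage they cover.\<close>
      define B where "B = (\<Union>q\<in>Q. T q ` ball 0 r)"
      have "openin (surface_top S) B"
        unfolding B_def
      proof (rule openin_Union, clarify)
        fix q assume "q \<in> Q"
        show "openin (surface_top S) (T q ` ball 0 r)"
          by (rule discD(5)[OF disc[OF \<open>q \<in> Q\<close>] open_ball]) (use r in \<open>simp add: ball_subset_ball_iff\<close>)
      qed
      moreover have "{p \<in> points S. h p = P} \<subseteq> B"
      proof
        fix q assume "q \<in> {p \<in> points S. h p = P}"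
        then have "q \<in> Q" by (simp add: Q_def)
        then have "q = T q 0" "0 \<in> ball (0::complex) r" using T0 r by auto
        then show "q \<in> B" using \<open>q \<in> Q\<close> unfolding B_def by blast
      qed
      ultimately obtain W1 where W1: "open W1" "P \<in> W1"
          "\<And>p. p \<in> points S \<Longrightarrow> h p \<in> W1 \<Longrightarrow> p \<in> B"
        using holomap_fibre_neighbourhood[OF h P] by blast
      have "f p = F (h p)" if "p \<in> points S" "h p \<in> W0 \<inter> W1" for p
        using W1(3)[OF that(1)] that(2) Ff by (auto simp: B_def)
      then show "descends_at S h f P"
        unfolding descends_at_def using \<open>open W0\<close> \<open>P \<in> W0\<close> W1 holomorphic_multi_subset[OF F]
        by (intro exI[of _ "W0 \<inter> W1"] exI[of _ F]) auto
    qed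
  qed (use finQ disc in auto)
qed

subsection \<open>Pullbacks of holomorphic functions\<close>

lemma holomorphic_on_curve_compose_disc:
  fixes h :: "complex \<Rightarrow> complex^'n"
  assumes g: "holomorphic_on_curve V g" and h: "\<And>i. (\<lambda>t. h t $ i) holomorphic_on A"
    and A: "open A" and sub: "h ` A \<subseteq> V"
  shows "(\<lambda>t. g (h t)) holomorphic_on A"
proof -
  have "\<forall>t\<in>A. \<exists>B. open B \<and> t \<in> B \<and> B \<subseteq> A \<and> (\<lambda>t. g (h t)) holomorphic_on B"
  proof
    fix t assume t: "t \<in> A"
    then obtain W F where F: "open W" "h t \<in> W" "holomorphic_multi F W" "\<forall>z\<in>V \<inter> W. g z = F z"
      using g sub unfolding holomorphic_on_curve_def by blast
    define B where "B = A \<inter> h -` W"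
    have "continuous_on A (\<lambda>t. \<chi> i. h t $ i)"
      by (intro continuous_on_vec_lambda holomorphic_on_imp_continuous_on h)
    then have "continuous_on A h" by simp
    then have B: "open B" unfolding B_def using A F(1) by (rule continuous_open_preimage)
    have "(\<lambda>t. F (h t)) holomorphic_on B"
      by (rule holomorphic_multi_compose_disc[OF F(3) holomorphic_on_subset[OF h] B])
         (auto simp: B_def)
    then have "(\<lambda>t. g (h t)) holomorphic_on B"
      by (rule holomorphic_transform) (use F(4) sub in \<open>auto simp: B_def\<close>)
    then show "\<exists>B. open B \<and> t \<in> B \<and> B \<subseteq> A \<and> (\<lambda>t. g (h t)) holomorphic_on B"
      using B t F(2) by (intro exI[of _ B]) (auto simp: B_def)
  qed
  then obtain B where B: "\<And>t. t \<in> A \<Longrightarrow> open (B t) \<and> t \<in> B t \<and> B t \<subseteq> A \<and> (\<lambda>t. g (h t)) holomorphic_on B t"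
    by metis
  then have "(\<lambda>t. g (h t)) holomorphic_on (\<Union>t\<in>A. B t)" by (intro holomorphic_on_UN_open) auto
  moreover have "(\<Union>t\<in>A. B t) = A" using B by blast
  ultimately show ?thesis by simp
qed

text \<open>Each component of \<open>\<phi>\<close> has its own ambient extension near
  \<open>P\<close>. There are finitely many components, so the extensions have a common open domain
  and combine to an ambient map \<open>\<Phi>\<close>, to which the chain rule applies.\<close>

lemma holomorphic_on_curve_compose:
  assumes g: "holomorphic_on_curve V2 g" and \<phi>: "holomorphic_curve_map V1 V2 \<phi>"
  shows "holomorphic_on_curve V1 (\<lambda>z. g (\<phi> z))"
  unfolding holomorphic_on_curve_def
proof
  fix P assume P: "P \<in> V1"
  then have "\<phi> P \<in> V2" using \<phi> unfolding holomorphic_curve_map_def by blast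
  then obtain W F where F: "open W" "\<phi> P \<in> W" "holomorphic_multi F W" "\<forall>z\<in>V2 \<inter> W. g z = F z"
    using g unfolding holomorphic_on_curve_def by blast
  have "\<forall>i. \<exists>A G. open A \<and> P \<in> A \<and> holomorphic_multi G A \<and> (\<forall>z\<in>V1 \<inter> A. \<phi> z $ i = G z)"
    using \<phi> P unfolding holomorphic_curve_map_def holomorphic_on_curve_def by blast
  then obtain A G where G: "\<And>i. open (A i)" "\<And>i. P \<in> A i" "\<And>i. holomorphic_multi (G i) (A i)"
      "\<And>i z. z \<in> V1 \<inter> A i \<Longrightarrow> \<phi> z $ i = G i z"
    by metis
  define \<Phi> where "\<Phi> z = (\<chi> i. G i z)" for z
  define A0 where "A0 = (\<Inter>i. A i)"
  have A0: "open A0" unfolding A0_def using G(1) by (intro open_INT) auto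
  have \<Phi>_hol: "holomorphic_multi (\<lambda>z. \<Phi> z $ i) A0" for i
    using G(3)[of i] by (auto simp: \<Phi>_def A0_def intro: holomorphic_multi_subset)
  have \<Phi>: "\<phi> z = \<Phi> z" if "z \<in> V1 \<inter> A0" for z
    using G(4) that by (auto simp: \<Phi>_def A0_def vec_eq_iff)
  define B where "B = A0 \<inter> \<Phi> -` W"
  have "continuous_on A0 (\<lambda>z. \<chi> i. \<Phi> z $ i)"
    by (intro continuous_on_vec_lambda holomorphic_multi_continuous_on \<Phi>_hol)
  then have "continuous_on A0 \<Phi>" by simp
  then have B: "open B" unfolding B_def using A0 F(1) by (rule continuous_open_preimage)
  moreover have PB: "P \<in> B" using G(2) P F(2) \<Phi>[of P] by (auto simp: B_def A0_def)
  moreover have "holomorphic_multi (\<lambda>z. F (\<Phi> z)) B"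
    by (rule holomorphic_multi_compose_multi[OF F(3) holomorphic_multi_subset[OF \<Phi>_hol]])
       (auto simp: B_def)
  moreover have "\<forall>z\<in>V1 \<inter> B. g (\<phi> z) = F (\<Phi> z)"
  proof
    fix z assume z: "z \<in> V1 \<inter> B"
    then have "\<phi> z = \<Phi> z" "\<Phi> z \<in> W" by (auto simp: B_def intro: \<Phi>)
    moreover have "\<phi> z \<in> V2" using \<phi> z unfolding holomorphic_curve_map_def by blast
    ultimately show "g (\<phi> z) = F (\<Phi> z)" using F(4) by auto
  qed
  ultimately show "\<exists>W F. open W \<and> P \<in> W \<and> holomorphic_multi F W \<and> (\<forall>z\<in>V1 \<inter> W. g (\<phi> z) = F z)"
    by blast
qed

lemma holomorphic_on_surface_compose_curve:
  fixes h :: "'a \<Rightarrow> complex^'n"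
  assumes S: "riemann_surface S" and h: "\<And>i. holomorphic_on_surface S (\<lambda>p. h p $ i)"
    and im: "h ` points S \<subseteq> V" and g: "holomorphic_on_curve V g"
  shows "holomorphic_on_surface S (\<lambda>p. g (h p))"
  unfolding holomorphic_on_surface_def
proof clarify
  fix W c assume Wc: "(W, c) \<in> atlas S"
  note ch = chart_facts[OF S Wc]
  have hol: "(\<lambda>t. h (inv_into W c t) $ i) holomorphic_on c ` W" for i
    using h[of i] Wc unfolding holomorphic_on_surface_def by (auto simp: o_def)
  have "(\<lambda>t. g (h (inv_into W c t))) holomorphic_on c ` W"
  proof (rule holomorphic_on_curve_compose_disc[OF g hol ch(2)])
    show "(\<lambda>t. h (inv_into W c t)) ` c ` W \<subseteq> V"
      using ch(3,4) im by (auto simp: image_subset_iff subset_iff)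
  qed
  then show "((\<lambda>p. g (h p)) \<circ> inv_into W c) holomorphic_on c ` W" by (simp add: o_def)
qed

section \<open>Operations on holomorphic functions on a surface\<close>

lemma holomorphic_on_surface_cong:
  assumes S: "riemann_surface S" and f: "holomorphic_on_surface S f"
    and eq: "\<And>p. p \<in> points S \<Longrightarrow> g p = f p"
  shows "holomorphic_on_surface S g"
  unfolding holomorphic_on_surface_def
proof clarify
  fix W c assume Wc: "(W, c) \<in> atlas S"
  note ch = chart_facts[OF S Wc]
  have "(f \<circ> inv_into W c) holomorphic_on c ` W"
    using f Wc unfolding holomorphic_on_surface_def by blast
  then show "(g \<circ> inv_into W c) holomorphic_on c ` W"
    by (rule holomorphic_transform) (use ch(3,4) eq in auto)
qed

lemma restrict_in_O_surface:
  "riemann_surface S \<Longrightarrow> holomorphic_on_surface S f \<Longrightarrow> restrict f (points S) \<in> O_surface S"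
  unfolding O_surface_def by (auto intro: holomorphic_on_surface_cong)

lemma holomorphic_on_surface_add:
  "holomorphic_on_surface S f \<Longrightarrow> holomorphic_on_surface S g \<Longrightarrow> holomorphic_on_surface S (\<lambda>p. f p + g p)"
  unfolding holomorphic_on_surface_def by (auto simp: o_def split_beta intro!: holomorphic_on_add)

lemma holomorphic_on_surface_scale:
  "holomorphic_on_surface S f \<Longrightarrow> holomorphic_on_surface S (\<lambda>p. a * f p)"
  unfolding holomorphic_on_surface_def by (auto simp: o_def split_beta intro!: holomorphic_on_mult)

lemma holomorphic_on_surface_compose_map:
  assumes S1: "riemann_surface S1" and S2: "riemann_surface S2"
    and \<psi>: "holomorphic_surface_map S1 S2 \<psi>" and f: "holomorphic_on_surface S2 f"
  shows "holomorphic_on_surface S1 (\<lambda>p. f (\<psi> p))"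
  unfolding holomorphic_on_surface_def
proof clarify
  fix W c assume Wc: "(W, c) \<in> atlas S1"
  note ch = chart_facts[OF S1 Wc]
  have cont: "continuous_map (surface_top S1) (surface_top S2) \<psi>"
    using \<psi> unfolding holomorphic_surface_map_def by blast
  define A where "A W' = c ` (W \<inter> \<psi> -` W')" for W'
  have "(\<lambda>t. f (\<psi> (inv_into W c t))) holomorphic_on (\<Union>W'\<in>atlas S2. A (fst W'))"
  proof (rule holomorphic_on_UN_open)
    fix Wc' assume "Wc' \<in> atlas S2"
    then obtain W' c' where Wc': "Wc' = (W', c')" "(W', c') \<in> atlas S2" by (metis surj_pair)
    note ch' = chart_facts[OF S2 Wc'(2)]
    have "c ` ({p \<in> points S1. \<psi> p \<in> W'} \<inter> W) = A W'"
      using ch(4) by (auto simp: A_def)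
    then have op: "open (A W')"
      using ch(6)[OF openin_continuous_map_preimage[OF cont ch'(1)]] by simp
    then show "open (A (fst Wc'))" using Wc' by simp
    have 1: "(c' \<circ> \<psi> \<circ> inv_into W c) holomorphic_on A W'"
      using \<psi> Wc Wc'(2) unfolding holomorphic_surface_map_def A_def by blast
    have 2: "(f \<circ> inv_into W' c') holomorphic_on c' ` W'"
      using f Wc'(2) unfolding holomorphic_on_surface_def by blast
    have "((f \<circ> inv_into W' c') \<circ> (c' \<circ> \<psi> \<circ> inv_into W c)) holomorphic_on A W'"
      by (rule holomorphic_on_compose_gen[OF 1 2]) (use ch(3) in \<open>auto simp: A_def\<close>)
    then have "(\<lambda>t. f (\<psi> (inv_into W c t))) holomorphic_on A W'"
      by (rule holomorphic_transform) (use ch(3) ch'(3) in \<open>auto simp: A_def\<close>)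
    then show "(\<lambda>t. f (\<psi> (inv_into W c t))) holomorphic_on A (fst Wc')" using Wc' by simp
  qed
  moreover have "(\<Union>W'\<in>atlas S2. A (fst W')) = c ` W"
  proof (intro equalityI subsetI)
    fix t assume "t \<in> c ` W"
    then obtain p where p: "p \<in> W" "t = c p" by blast
    then have "\<psi> p \<in> points S2" using cont ch(4) unfolding continuous_map by blast
    then obtain W' c' where "(W', c') \<in> atlas S2" "\<psi> p \<in> W'"
      using S2 unfolding riemann_surface_def by auto
    then show "t \<in> (\<Union>W'\<in>atlas S2. A (fst W'))"
      using p by (intro UN_I[of "(W', c')"]) (auto simp: A_def)
  qed (auto simp: A_def)
  ultimately show "((\<lambda>p. f (\<psi> p)) \<circ> inv_into W c) holomorphic_on c ` W" by (simp add: o_def)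
qed

definition pullbacks :: "'a surface \<Rightarrow> ('a \<Rightarrow> complex^'n) \<Rightarrow> (complex^'n) set \<Rightarrow> ('a \<Rightarrow> complex) set" where
  "pullbacks S h V = {restrict (F \<circ> h) (points S) | F. F \<in> O_curve V}"

lemma pullbacks_subset:
  assumes S: "riemann_surface S" and h: "holomap S U h" and V: "h ` points S = V"
  shows "pullbacks S h V \<subseteq> O_surface S"
proof
  fix f assume "f \<in> pullbacks S h V"
  then obtain F where F: "F \<in> O_curve V" "f = restrict (\<lambda>p. F (h p)) (points S)"
    unfolding pullbacks_def by (auto simp: o_def)
  have "holomorphic_on_surface S (\<lambda>p. h p $ i)" for i
    using h unfolding holomap_def by blast
  then have "holomorphic_on_surface S (\<lambda>p. F (h p))"
    by (rule holomorphic_on_surface_compose_curve[OF S, where V = V])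
       (use F(1) V in \<open>simp_all add: O_curve_def\<close>)
  then show "f \<in> O_surface S" unfolding F(2) by (rule restrict_in_O_surface[OF S])
qed

lemma pullbacks_descend:
  assumes "f \<in> pullbacks S h V" and V: "h ` points S = V" and P: "P \<in> V"
  shows "descends_at S h f P"
proof -
  obtain F where F: "F \<in> O_curve V" "f = restrict (F \<circ> h) (points S)"
    using assms(1) unfolding pullbacks_def by blast
  then obtain W G where "open W" "P \<in> W" "holomorphic_multi G W" "\<forall>z\<in>V \<inter> W. F z = G z"
    using P unfolding O_curve_def holomorphic_on_curve_def by blast
  then show ?thesis
    unfolding descends_at_def using F(2) V by (intro exI[of _ W] exI[of _ G]) auto
qed

text \<open>Descending at \<open>h p\<close> makes \<open>f\<close> constant on the fibre through
  \<open>p\<close>, so an arbitrary choice of preimages defines the function on \<open>V\<close>.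
  Its ambient extension near \<open>P\<close> is the one provided by
  \<open>descends_at\<close>.\<close>

lemma pullbacks_if_descends:
  assumes f: "f \<in> extensional (points S)" and V: "h ` points S = V"
    and d: "\<And>P. P \<in> V \<Longrightarrow> descends_at S h f P"
  shows "f \<in> pullbacks S h V"
proof -
  define s where "s z = (SOME p. p \<in> points S \<and> h p = z)" for z
  have s: "s z \<in> points S \<and> h (s z) = z" if "z \<in> V" for z
    unfolding s_def by (rule someI_ex) (use that V in auto)
  define G where "G = restrict (\<lambda>z. f (s z)) V"
  have "holomorphic_on_curve V G"
    unfolding holomorphic_on_curve_def
  proof
    fix P assume "P \<in> V"
    then obtain W F where F: "open W" "P \<in> W" "holomorphic_multi F W"
        "\<forall>p\<in>points S. h p \<in> W \<longrightarrow> f p = F (h p)"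
      using d unfolding descends_at_def by blast
    moreover have "\<forall>z\<in>V \<inter> W. G z = F z" using F(4) s by (auto simp: G_def)
    ultimately show "\<exists>W F. open W \<and> P \<in> W \<and> holomorphic_multi F W \<and> (\<forall>z\<in>V \<inter> W. G z = F z)"
      by blast
  qed
  then have "G \<in> O_curve V" by (simp add: O_curve_def G_def)
  moreover have "f = restrict (G \<circ> h) (points S)"
  proof (rule extensionalityI[OF f])
    fix p assume p: "p \<in> points S"
    then have hp: "h p \<in> V" using V by blast
    obtain W F where F: "h p \<in> W" "\<forall>q\<in>points S. h q \<in> W \<longrightarrow> f q = F (h q)"
      using d[OF hp] unfolding descends_at_def by blast
    have "f p = F (h p)" "f (s (h p)) = F (h (s (h p)))" using F p s[OF hp] by auto
    then show "f p = restrict (G \<circ> h) (points S) p" using p hp s[OF hp] by (simp add: G_def)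
  qed auto
  ultimately show ?thesis unfolding pullbacks_def by blast
qed

subsection \<open>Functionals annihilating the pullbacks\<close>

text \<open>Separation of a vector from a subspace in finitely many coordinates, by Gaussian
  elimination on the coordinate \<open>a\<close>. The closure conditions allow \<open>X\<close> to
  be empty, and then \<open>j\<close> may be 0 on \<open>K\<close> and admit no functional; hence
  the first alternative.\<close>

lemma finite_coordinates_separate:
  fixes X :: "('k \<Rightarrow> complex) set"
  assumes "finite K"
    and "\<And>v w. v \<in> X \<Longrightarrow> w \<in> X \<Longrightarrow> (\<lambda>k. v k + w k) \<in> X" and "\<And>c v. v \<in> X \<Longrightarrow> (\<lambda>k. c * v k) \<in> X"
    and "\<And>v. v \<in> X \<Longrightarrow> \<exists>k\<in>K. v k \<noteq> j k"
  shows "X = {} \<or> (\<exists>\<mu>. (\<forall>v\<in>X. (\<Sum>k\<in>K. \<mu> k * v k) = 0) \<and> (\<Sum>k\<in>K. \<mu> k * j k) \<noteq> 0)"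
  using assms
proof (induction K arbitrary: X j)
  case empty
  then show ?case by auto
next
  case (insert a K)
  note add = insert.prems(1) and scale = insert.prems(2) and sep = insert.prems(3)
  show ?case
  proof (cases "\<forall>v\<in>X. v a = 0")
    case True
    show ?thesis
    proof (cases "j a = 0")
      case ja: False
      then show ?thesis
        using True insert.hyps
        by (intro disjI2 exI[of _ "\<lambda>k. if k = a then 1 else 0"])
           (auto simp: if_distrib[of "\<lambda>x. x * _"] cong: if_cong)
    next
      case ja: True
      have "X = {} \<or> (\<exists>\<mu>. (\<forall>v\<in>X. (\<Sum>k\<in>K. \<mu> k * v k) = 0) \<and> (\<Sum>k\<in>K. \<mu> k * j k) \<noteq> 0)"
        by (rule insert.IH) (use add scale sep ja True in force)+
      then show ?thesis
      proof (elim disjE exE)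
        fix \<mu> assume "(\<forall>v\<in>X. (\<Sum>k\<in>K. \<mu> k * v k) = 0) \<and> (\<Sum>k\<in>K. \<mu> k * j k) \<noteq> 0"
        then show ?thesis using insert.hyps ja True by (intro disjI2 exI[of _ \<mu>]) simp
      qed simp
    qed
  next
    case False
    then obtain w0 where w0: "w0 \<in> X" "w0 a \<noteq> 0" by blast
    define w where "w k = (1 / w0 a) * w0 k" for k
    have w: "w \<in> X" "w a = 1" using scale[OF w0(1), of "1 / w0 a"] w0(2) by (auto simp: w_def[abs_def])
    define X0 where "X0 = {v \<in> X. v a = 0}"
    \<comment> \<open>Subtracting a multiple of the pivot \<open>w\<close> clears the coordinate
      \<open>a\<close>. The induction hypothesis is applied to the cleared vectors \<open>X0\<close>
      and to \<open>pr j\<close>.\<close>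
    define pr where "pr v k = v k - v a * w k" for v :: "'k \<Rightarrow> complex" and k
    have comb: "(\<lambda>k. v k + c * w k) \<in> X" if "v \<in> X" for v c
      using add[OF that scale[OF w(1), of c]] .
    have pr: "pr v \<in> X0" if "v \<in> X" for v
      using comb[OF that, of "- v a"] w(2) by (simp add: X0_def pr_def[abs_def])
    have "X0 = {} \<or> (\<exists>\<mu>. (\<forall>v\<in>X0. (\<Sum>k\<in>K. \<mu> k * v k) = 0) \<and> (\<Sum>k\<in>K. \<mu> k * pr j k) \<noteq> 0)"
    proof (rule insert.IH)
      fix v assume v: "v \<in> X0"
      then have "(\<lambda>k. v k + j a * w k) \<in> X" by (auto simp: X0_def intro: comb)
      from sep[OF this] obtain k where k: "k \<in> insert a K" "v k + j a * w k \<noteq> j k" by blast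
      have "k \<noteq> a" using k(2) v w(2) by (auto simp: X0_def)
      then show "\<exists>k\<in>K. v k \<noteq> pr j k"
        using k by (intro bexI[of _ k]) (auto simp: pr_def algebra_simps)
    qed (use add scale in \<open>auto simp: X0_def\<close>)
    moreover have "X0 \<noteq> {}" using pr[OF w(1)] by auto
    ultimately obtain \<mu> where \<mu>: "\<And>v. v \<in> X0 \<Longrightarrow> (\<Sum>k\<in>K. \<mu> k * v k) = 0"
        "(\<Sum>k\<in>K. \<mu> k * pr j k) \<noteq> 0" by blast
    \<comment> \<open>The coefficient at \<open>a\<close> is chosen to make the extended functional
      equal to \<open>\<mu>\<close> applied after \<open>pr\<close>.\<close>
    define \<mu>' where "\<mu>' = \<mu>(a := - (\<Sum>k\<in>K. \<mu> k * w k))"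
    have "(\<Sum>k\<in>insert a K. \<mu>' k * v k) = (\<Sum>k\<in>K. \<mu> k * pr v k)" for v
    proof -
      have "(\<Sum>k\<in>K. \<mu>' k * v k) = (\<Sum>k\<in>K. \<mu> k * v k)"
        using insert.hyps by (intro sum.cong) (auto simp: \<mu>'_def)
      moreover have "(\<Sum>k\<in>K. \<mu> k * pr v k) = (\<Sum>k\<in>K. \<mu> k * v k) - (\<Sum>k\<in>K. \<mu> k * w k) * v a"
        by (simp add: pr_def right_diff_distrib sum_subtractf sum_distrib_left mult_ac)
      ultimately show ?thesis using insert.hyps by (simp add: \<mu>'_def)
    qed
    then show ?thesis using \<mu> pr by (intro disjI2 exI[of _ \<mu>']) auto
  qed
qed

section \<open>Jets along discs and their continuity\<close>

definition jet :: "(complex \<Rightarrow> 'a) \<Rightarrow> nat \<Rightarrow> ('a \<Rightarrow> complex) \<Rightarrow> complex" where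
  "jet T i f = (deriv ^^ i) (\<lambda>t. f (T t)) 0"

lemma jet_cong:
  assumes S: "riemann_surface S" and T: "disc S T r" and f: "holomorphic_on_surface S f"
    and eq: "\<And>p. p \<in> points S \<Longrightarrow> g p = f p"
  shows "jet T i g = jet T i f"
  unfolding jet_def
  using disc_holomorphic[OF S holomorphic_on_surface_cong[OF S f eq] T] disc_holomorphic[OF S f T]
    disc_in_points[OF T] discD(1)[OF T]
  by (intro higher_deriv_transform_within_open[of _ "ball 0 r"]) (auto simp: eq)

lemma jet_add:
  assumes S: "riemann_surface S" and T: "disc S T r"
    and f: "holomorphic_on_surface S f" and g: "holomorphic_on_surface S g"
  shows "jet T i (\<lambda>p. f p + g p) = jet T i f + jet T i g"
  unfolding jet_def using discD(1)[OF T]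
  by (intro higher_deriv_add[OF disc_holomorphic[OF S f T] disc_holomorphic[OF S g T]]) auto

lemma jet_scale:
  assumes S: "riemann_surface S" and T: "disc S T r" and f: "holomorphic_on_surface S f"
  shows "jet T i (\<lambda>p. c * f p) = c * jet T i f"
  unfolding jet_def using discD(1)[OF T]
  by (intro higher_deriv_cmult[OF disc_holomorphic[OF S f T] _ open_ball]) auto

text \<open>Cauchy's inequality on the circle of half the radius; \<open>K\<close> is the compact
  image of the closed disc bounded by this circle.\<close>

lemma jet_bound:
  assumes S: "riemann_surface S" and T: "disc S T r"
  obtains K B where "compactin (surface_top S) K" "B > 0"
    "\<And>f e. holomorphic_on_surface S f \<Longrightarrow> (\<And>p. p \<in> K \<Longrightarrow> norm (f p) \<le> e) \<Longrightarrow> norm (jet T i f) \<le> B * e"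
proof -
  define s where "s = r / 2"
  have s: "0 < s" "s < r" using discD(1)[OF T] by (auto simp: s_def)
  have sub: "cball 0 s \<subseteq> ball (0::complex) r" using s by auto
  define K where "K = T ` cball 0 s"
  have "continuous_map (top_of_set (ball 0 r)) (surface_top S) T"
    unfolding continuous_map
  proof (intro conjI allI impI)
    show "T ` topspace (top_of_set (ball 0 r)) \<subseteq> points S" using discD(2)[OF T] by simp
    fix B assume "openin (surface_top S) B"
    from discD(4)[OF T this]
    show "openin (top_of_set (ball 0 r)) {x \<in> topspace (top_of_set (ball 0 r)). T x \<in> B}"
      by (auto simp: openin_open_eq)
  qed
  moreover have "compactin (top_of_set (ball 0 r)) (cball (0::complex) s)"
    using sub by (simp add: compactin_subtopology)
  ultimately have "compactin (surface_top S) K"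
    unfolding K_def by (rule image_compactin[rotated])
  moreover have "fact i / s ^ i > (0::real)" using s by simp
  moreover have "norm (jet T i f) \<le> fact i / s ^ i * e"
    if f: "holomorphic_on_surface S f" and e: "\<And>p. p \<in> K \<Longrightarrow> norm (f p) \<le> e" for f e
  proof -
    have hol: "(\<lambda>t. f (T t)) holomorphic_on ball 0 r" by (rule disc_holomorphic[OF S f T])
    have "norm (jet T i f) \<le> fact i * e / s ^ i"
      unfolding jet_def
    proof (rule Cauchy_inequality)
      show "(\<lambda>t. f (T t)) holomorphic_on ball 0 s"
        using hol by (rule holomorphic_on_subset) (use s in auto)
      show "continuous_on (cball 0 s) (\<lambda>t. f (T t))"
        using holomorphic_on_imp_continuous_on[OF hol] sub by (rule continuous_on_subset)
      show "norm (f (T x)) \<le> e" if "norm (0 - x) = s" for x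
        using that by (intro e) (auto simp: K_def)
    qed (rule s)
    then show ?thesis by simp
  qed
  ultimately show ?thesis using that by blast
qed

text \<open>By \<open>jet_bound\<close> a finite combination of jets is bounded by a multiple of the
  supremum over one compact set, and for a linear functional this gives continuity in the topology
  of \<open>O_topology S\<close>.\<close>

lemma jet_combination_in_O_dual:
  assumes S: "riemann_surface S" and K: "finite K" and T: "\<And>k. k \<in> K \<Longrightarrow> disc S (T (fst k)) r"
  shows "restrict (\<lambda>f. \<Sum>k\<in>K. \<mu> k * jet (T (fst k)) (snd k) f) (O_surface S) \<in> O_dual S"
proof -
  define \<Lambda> where "\<Lambda> f = (\<Sum>k\<in>K. \<mu> k * jet (T (fst k)) (snd k) f)" for f
  have hol: "holomorphic_on_surface S f" if "f \<in> O_surface S" for f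
    using that by (simp add: O_surface_def)
  have jet_eq: "jet (T (fst k)) i (restrict f (points S)) = jet (T (fst k)) i f"
    if "k \<in> K" "holomorphic_on_surface S f" for k i f
    by (rule jet_cong[OF S T[OF that(1)] that(2)]) simp
  have \<Lambda>_add: "\<Lambda> (\<lambda>p\<in>points S. f p + g p) = \<Lambda> f + \<Lambda> g" if "f \<in> O_surface S" "g \<in> O_surface S" for f g
    unfolding \<Lambda>_def sum.distrib[symmetric] distrib_left[symmetric]
    using that hol by (intro sum.cong) (simp_all add: jet_eq holomorphic_on_surface_add jet_add[OF S T])
  have \<Lambda>_scale: "\<Lambda> (\<lambda>p\<in>points S. a * f p) = a * \<Lambda> f" if "f \<in> O_surface S" for a f
    unfolding \<Lambda>_def sum_distrib_left
    using that hol by (intro sum.cong) (simp_all add: jet_eq holomorphic_on_surface_scale jet_scale[OF S T])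
  have "\<exists>C B. compactin (surface_top S) C \<and> B > 0 \<and> (\<forall>f e. holomorphic_on_surface S f \<longrightarrow>
      (\<forall>p\<in>C. norm (f p) \<le> e) \<longrightarrow> norm (jet (T (fst k)) (snd k) f) \<le> B * e)" if "k \<in> K" for k
    by (rule jet_bound[OF S T[OF that], of "snd k"]) blast
  then obtain C B where C: "\<And>k. k \<in> K \<Longrightarrow> compactin (surface_top S) (C k)" "\<And>k. k \<in> K \<Longrightarrow> B k > 0"
    and bound: "\<And>k f e. k \<in> K \<Longrightarrow> holomorphic_on_surface S f \<Longrightarrow> (\<And>p. p \<in> C k \<Longrightarrow> norm (f p) \<le> e) \<Longrightarrow>
      norm (jet (T (fst k)) (snd k) f) \<le> B k * e"
    by metis
  define B0 where "B0 = (\<Sum>k\<in>K. norm (\<mu> k) * B k)"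
  have B0: "B0 \<ge> 0" unfolding B0_def using C(2) by (intro sum_nonneg mult_nonneg_nonneg) (auto simp: less_imp_le)
  define C0 where "C0 = (\<Union>k\<in>K. C k)"
  have C0: "compactin (surface_top S) C0"
    unfolding C0_def using K C(1) by (intro compactin_Union) auto
  have \<Lambda>_bound: "norm (\<Lambda> f) \<le> B0 * e"
    if "holomorphic_on_surface S f" "\<And>p. p \<in> C0 \<Longrightarrow> norm (f p) \<le> e" for f e
  proof -
    have "norm (\<Lambda> f) \<le> (\<Sum>k\<in>K. norm (\<mu> k) * (B k * e))"
      unfolding \<Lambda>_def
    proof (rule sum_norm_le)
      fix k assume k: "k \<in> K"
      have "norm (jet (T (fst k)) (snd k) f) \<le> B k * e"
        by (rule bound[OF k that(1)]) (use that(2) k in \<open>auto simp: C0_def\<close>)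
      then show "norm (\<mu> k * jet (T (fst k)) (snd k) f) \<le> norm (\<mu> k) * (B k * e)"
        by (simp add: norm_mult mult_left_mono)
    qed
    then show ?thesis by (simp add: B0_def sum_distrib_right mult.assoc)
  qed
  have "continuous_map (O_topology S) euclidean \<Lambda>"
    unfolding continuous_map
  proof (intro conjI allI impI)
    fix A :: "complex set" assume "openin euclidean A"
    then have A: "open A" by simp
    show "openin (O_topology S) {f \<in> topspace (O_topology S). \<Lambda> f \<in> A}"
      unfolding openin_O_topology ucc_open_def topspace_O_topology
    proof (intro conjI ballI)
      fix f assume f: "f \<in> {f \<in> O_surface S. \<Lambda> f \<in> A}"
      then obtain e where e: "e > 0" "ball (\<Lambda> f) e \<subseteq> A" using A by (auto simp: open_contains_ball)
      \<comment> \<open>The summand 1 keeps the denominator positive when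
        \<open>B0 = 0\<close>.\<close>
      define d where "d = e / (B0 + 1)"
      have d: "d > 0" "B0 * d < e"
        using B0 e(1) by (auto simp: d_def divide_simps algebra_simps)
      have "\<Lambda> g \<in> A" if g: "g \<in> O_surface S" "\<forall>x\<in>C0. dist (g x) (f x) < d" for g
      proof -
        \<comment> \<open>The difference of \<open>g\<close> and \<open>f\<close> is assembled from
          the two operations for which linearity of \<open>\<Lambda>\<close> has been shown, with a
          restriction to the points of \<open>S\<close> after each.\<close>
        have mf: "(\<lambda>p\<in>points S. (- 1) * f p) \<in> O_surface S"
          using f by (intro restrict_in_O_surface[OF S] holomorphic_on_surface_scale) (auto intro: hol)
        have df: "(\<lambda>p\<in>points S. g p + (\<lambda>p\<in>points S. (- 1) * f p) p) \<in> O_surface S"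
          by (intro restrict_in_O_surface[OF S] holomorphic_on_surface_add hol[OF g(1)] hol[OF mf])
        have "C0 \<subseteq> points S" using C0 by (simp add: compactin_def)
        then have "norm (\<Lambda> (\<lambda>p\<in>points S. g p + (\<lambda>p\<in>points S. (- 1) * f p) p)) \<le> B0 * d"
          using g(2) by (intro \<Lambda>_bound hol[OF df]) (auto simp: dist_norm less_imp_le subset_iff)
        moreover have "\<Lambda> (\<lambda>p\<in>points S. g p + (\<lambda>p\<in>points S. (- 1) * f p) p) = \<Lambda> g - \<Lambda> f"
          using \<Lambda>_add[OF g(1) mf] \<Lambda>_scale[of f "- 1"] f by simp
        ultimately show "\<Lambda> g \<in> A" using d(2) e(2) by (auto simp: dist_norm norm_minus_commute)
      qed
      then show "\<exists>K e. compactin (surface_top S) K \<and> e > 0 \<and>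
          {g \<in> O_surface S. \<forall>x\<in>K. dist (g x) (f x) < e} \<subseteq> {f \<in> O_surface S. \<Lambda> f \<in> A}"
        using C0 d(1) by (intro exI[of _ C0] exI[of _ d]) auto
    qed auto
  qed auto
  then have "continuous_map (O_topology S) euclidean (restrict \<Lambda> (O_surface S))"
    by (rule continuous_map_eq) simp
  then show ?thesis
    unfolding O_dual_def \<Lambda>_def[symmetric]
    using \<Lambda>_add \<Lambda>_scale hol
    by (auto simp: restrict_in_O_surface[OF S] holomorphic_on_surface_add holomorphic_on_surface_scale)
qed

lemma connection_separates:
  fixes h :: "'a \<Rightarrow> complex^'n"
  assumes S: "riemann_surface S" and h: "holomap S U h" and V: "h ` points S = V"
    and f: "f \<in> O_surface S" "f \<notin> pullbacks S h V"
  obtains \<Lambda> where "\<Lambda> \<in> connection S h V" "\<Lambda> f \<noteq> 0"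
proof -
  have hol: "holomorphic_on_surface S g" if "g \<in> O_surface S" for g
    using that by (simp add: O_surface_def)
  obtain P where P: "P \<in> V" "\<not> descends_at S h f P"
    using pullbacks_if_descends[OF _ V] f by (auto simp: O_surface_def)
  have "P \<in> U" using P(1) V h unfolding holomap_def by blast
  then obtain Q T \<rho> N where Q: "finite (Q :: 'a set)" and T: "\<And>q. q \<in> Q \<Longrightarrow> disc S (T q) \<rho>"
    and desc: "\<forall>f. holomorphic_on_surface S f \<longrightarrow>
      (\<forall>q\<in>Q. \<forall>i<N. (deriv ^^ i) (\<lambda>t. f (T q t)) 0 = 0) \<longrightarrow> descends_at S h f P"
    by (rule finite_jet_determines_descent[OF S h]) (rule that)
  define K where "K = Q \<times> {..<N}"
  have K: "finite K" using Q by (simp add: K_def)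
  have TK: "disc S (T (fst k)) \<rho>" if "k \<in> K" for k using that T by (auto simp: K_def)
  \<comment> \<open>Set to 0 outside \<open>K\<close>, so that \<open>j\<close> is additive and
    homogeneous in every coordinate.\<close>
  define j where "j g k = (if k \<in> K then jet (T (fst k)) (snd k) g else 0)" for g k
  \<comment> \<open>Descent is demanded at \<open>P\<close> alone, so \<open>D\<close> contains all
    pullbacks, and a functional that kills the jets of \<open>D\<close> kills the pullbacks.\<close>
  define D where "D = {g. holomorphic_on_surface S g \<and> descends_at S h g P}"
  have j_add: "j (\<lambda>p. g p + g' p) k = j g k + j g' k"
    if "holomorphic_on_surface S g" "holomorphic_on_surface S g'" for g g' k
    using jet_add[OF S TK that] by (simp add: j_def)
  have j_scale: "j (\<lambda>p. c * g p) k = c * j g k" if "holomorphic_on_surface S g" for g c k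
    using jet_scale[OF S TK that] by (simp add: j_def)
  have "j ` D = {} \<or> (\<exists>\<mu>. (\<forall>v\<in>j ` D. (\<Sum>k\<in>K. \<mu> k * v k) = 0) \<and> (\<Sum>k\<in>K. \<mu> k * j f k) \<noteq> 0)"
  proof (rule finite_coordinates_separate[OF K])
    fix v w assume "v \<in> j ` D" "w \<in> j ` D"
    then obtain g g' where g: "g \<in> D" "g' \<in> D" "v = j g" "w = j g'" by blast
    then have "(\<lambda>k. v k + w k) = j (\<lambda>p. g p + g' p)" "(\<lambda>p. g p + g' p) \<in> D"
      by (auto simp: D_def j_add holomorphic_on_surface_add descends_at_add)
    then show "(\<lambda>k. v k + w k) \<in> j ` D" by simp
  next
    fix c v assume "v \<in> j ` D"
    then obtain g where "g \<in> D" "v = j g" by blast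
    then have "(\<lambda>k. c * v k) = j (\<lambda>p. c * g p)" "(\<lambda>p. c * g p) \<in> D"
      by (auto simp: D_def j_scale holomorphic_on_surface_scale descends_at_scale)
    then show "(\<lambda>k. c * v k) \<in> j ` D" by simp
  next
    fix v assume "v \<in> j ` D"
    then obtain g where g: "holomorphic_on_surface S g" "descends_at S h g P" "v = j g"
      by (auto simp: D_def)
    show "\<exists>k\<in>K. v k \<noteq> j f k"
    proof (rule ccontr)
      assume "\<not> (\<exists>k\<in>K. v k \<noteq> j f k)"
      then have eq: "j g k = j f k" if "k \<in> K" for k using that g(3) by auto
      have mg: "holomorphic_on_surface S (\<lambda>p. - 1 * g p)"
        using g(1) by (rule holomorphic_on_surface_scale)
      \<comment> \<open>If \<open>f\<close> had the same jet as some \<open>g\<close> in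
        \<open>D\<close>, the difference would have zero jet and therefore descend, and
        \<open>f\<close> would descend as a sum.\<close>
      have "descends_at S h (\<lambda>p. f p + - 1 * g p) P"
      proof (rule desc[rule_format])
        show "holomorphic_on_surface S (\<lambda>p. f p + - 1 * g p)"
          by (rule holomorphic_on_surface_add[OF hol[OF f(1)] mg])
        fix q i assume "q \<in> Q" "i < N"
        then have "(q, i) \<in> K" by (simp add: K_def)
        moreover have "j (\<lambda>p. f p + - 1 * g p) (q, i) = j f (q, i) + - 1 * j g (q, i)"
          by (simp only: j_add[OF hol[OF f(1)] mg] j_scale[OF g(1)])
        ultimately have "jet (T q) i (\<lambda>p. f p + - 1 * g p) = 0"
          using eq[of "(q, i)"] by (simp add: j_def)
        then show "(deriv ^^ i) (\<lambda>t. f (T q t) + - 1 * g (T q t)) 0 = 0" by (simp add: jet_def)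
      qed
      from descends_at_add[OF this g(2)] P(2) show False by simp
    qed
  qed
  moreover have "D \<noteq> {}"
  proof -
    have "holomorphic_on_surface S (\<lambda>p. 0 * f p)"
      by (rule holomorphic_on_surface_scale[OF hol[OF f(1)]])
    moreover have "descends_at S h (\<lambda>p. 0 * f p) P"
      unfolding descends_at_def by (intro exI[of _ UNIV] exI[of _ "\<lambda>_. 0"]) (simp add: holomorphic_multi_const)
    ultimately show ?thesis by (auto simp: D_def)
  qed
  ultimately obtain \<mu> where \<mu>: "\<And>v. v \<in> j ` D \<Longrightarrow> (\<Sum>k\<in>K. \<mu> k * v k) = 0" "(\<Sum>k\<in>K. \<mu> k * j f k) \<noteq> 0"
    by auto
  define \<Lambda> where "\<Lambda> = restrict (\<lambda>f. \<Sum>k\<in>K. \<mu> k * jet (T (fst k)) (snd k) f) (O_surface S)"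
  have \<Lambda>: "\<Lambda> g = (\<Sum>k\<in>K. \<mu> k * j g k)" if "g \<in> O_surface S" for g
    using that by (simp add: \<Lambda>_def j_def)
  have "\<Lambda> \<in> connection S h V"
    unfolding connection_def
  proof (intro CollectI conjI ballI)
    show "\<Lambda> \<in> O_dual S" unfolding \<Lambda>_def using S K TK by (rule jet_combination_in_O_dual)
    fix F assume "F \<in> O_curve V"
    then have F: "restrict (F \<circ> h) (points S) \<in> pullbacks S h V" unfolding pullbacks_def by blast
    then have O: "restrict (F \<circ> h) (points S) \<in> O_surface S" using pullbacks_subset[OF S h V] by blast
    have "restrict (F \<circ> h) (points S) \<in> D"
      using hol[OF O] pullbacks_descend[OF F V P(1)] by (simp add: D_def)
    then show "\<Lambda> (restrict (F \<circ> h) (points S)) = 0" using \<mu>(1) \<Lambda>[OF O] by simp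
  qed
  moreover have "\<Lambda> f \<noteq> 0" using \<mu>(2) \<Lambda>[OF f(1)] by simp
  ultimately show ?thesis using that by blast
qed

subsection \<open>Biholomorphic maps and connections\<close>

lemma biholomorphic_surface_mapE:
  assumes "biholomorphic_surface_map S1 S2 \<psi>"
  obtains \<psi>' where "holomorphic_surface_map S1 S2 \<psi>" "holomorphic_surface_map S2 S1 \<psi>'"
    "\<And>p. p \<in> points S1 \<Longrightarrow> \<psi> p \<in> points S2" "\<And>p. p \<in> points S2 \<Longrightarrow> \<psi>' p \<in> points S1"
    "\<And>p. p \<in> points S1 \<Longrightarrow> \<psi>' (\<psi> p) = p" "\<And>p. p \<in> points S2 \<Longrightarrow> \<psi> (\<psi>' p) = p"
proof -
  obtain \<psi>' where \<psi>': "homeomorphic_maps (surface_top S1) (surface_top S2) \<psi> \<psi>'"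
      "holomorphic_surface_map S1 S2 \<psi>" "holomorphic_surface_map S2 S1 \<psi>'"
    using assms unfolding biholomorphic_surface_map_def by blast
  show ?thesis
    by (rule that[OF \<psi>'(2,3)])
       (use \<psi>'(1) in \<open>auto simp: homeomorphic_maps_def dest: continuous_map_image_subset_topspace\<close>)
qed

lemma compose_in_O_surface:
  assumes "riemann_surface S1" "riemann_surface S2" "holomorphic_surface_map S1 S2 \<psi>" "f \<in> O_surface S2"
  shows "restrict (f \<circ> \<psi>) (points S1) \<in> O_surface S1"
  using restrict_in_O_surface[OF assms(1) holomorphic_on_surface_compose_map[OF assms(1-3)], of f] assms(4)
  by (simp add: O_surface_def o_def)

text \<open>\<open>\<psi>\<close> maps compact sets to compact sets, so composition with
  \<open>\<psi>\<close> is continuous for uniform convergence on compact sets.\<close>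

lemma push_forward_in_O_dual:
  assumes S1: "riemann_surface S1" and S2: "riemann_surface S2"
    and \<psi>: "holomorphic_surface_map S1 S2 \<psi>" and \<Lambda>: "\<Lambda> \<in> O_dual S1"
  shows "push_forward S1 S2 \<psi> \<Lambda> \<in> O_dual S2"
proof -
  have cont: "continuous_map (surface_top S1) (surface_top S2) \<psi>"
    using \<psi> unfolding holomorphic_surface_map_def by blast
  have im: "\<psi> p \<in> points S2" if "p \<in> points S1" for p
    using cont that unfolding continuous_map by blast
  define c where "c f = restrict (f \<circ> \<psi>) (points S1)" for f :: "'b \<Rightarrow> complex"
  have c: "c f \<in> O_surface S1" if "f \<in> O_surface S2" for f
    unfolding c_def by (rule compose_in_O_surface[OF S1 S2 \<psi> that])
  have hol: "holomorphic_on_surface S2 f" if "f \<in> O_surface S2" for f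
    using that by (simp add: O_surface_def)
  have add: "c (\<lambda>p\<in>points S2. f p + g p) = (\<lambda>p\<in>points S1. c f p + c g p)" for f g
    by (auto simp: c_def fun_eq_iff im)
  have scale: "c (\<lambda>p\<in>points S2. a * f p) = (\<lambda>p\<in>points S1. a * c f p)" for a f
    by (auto simp: c_def fun_eq_iff im)
  have "continuous_map (O_topology S2) (O_topology S1) c"
    unfolding continuous_map
  proof (intro conjI allI impI)
    show "c ` topspace (O_topology S2) \<subseteq> topspace (O_topology S1)" using c by auto
    fix A assume "openin (O_topology S1) A"
    then have A: "ucc_open S1 A" by (simp add: openin_O_topology)
    show "openin (O_topology S2) {f \<in> topspace (O_topology S2). c f \<in> A}"
      unfolding openin_O_topology ucc_open_def topspace_O_topology
    proof (intro conjI ballI)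
      fix f assume "f \<in> {f \<in> O_surface S2. c f \<in> A}"
      then obtain K e where K: "compactin (surface_top S1) K" "e > 0"
          "{g \<in> O_surface S1. \<forall>x\<in>K. dist (g x) (c f x) < e} \<subseteq> A"
        using A unfolding ucc_open_def by blast
      have KS: "K \<subseteq> points S1" using K(1) by (simp add: compactin_def)
      have "c g \<in> A" if "g \<in> O_surface S2" "\<forall>x\<in>\<psi> ` K. dist (g x) (f x) < e" for g
      proof -
        have "\<forall>x\<in>K. dist (c g x) (c f x) < e" using that(2) KS by (auto simp: c_def subset_iff)
        then show ?thesis using K(3) c[OF that(1)] by blast
      qed
      then show "\<exists>K e. compactin (surface_top S2) K \<and> e > 0 \<and>
          {g \<in> O_surface S2. \<forall>x\<in>K. dist (g x) (f x) < e} \<subseteq> {f \<in> O_surface S2. c f \<in> A}"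
        using image_compactin[OF K(1) cont] K(2) by (intro exI[of _ "\<psi> ` K"] exI[of _ e]) auto
    qed auto
  qed
  moreover have "continuous_map (O_topology S1) euclidean \<Lambda>" using \<Lambda> by (simp add: O_dual_def)
  ultimately have "continuous_map (O_topology S2) euclidean (\<Lambda> \<circ> c)" by (rule continuous_map_compose)
  then have "continuous_map (O_topology S2) euclidean (push_forward S1 S2 \<psi> \<Lambda>)"
    by (rule continuous_map_eq) (simp add: push_forward_def c_def)
  moreover have "push_forward S1 S2 \<psi> \<Lambda> f = \<Lambda> (c f)" if "f \<in> O_surface S2" for f
    using that by (simp add: push_forward_def c_def)
  moreover have "(\<lambda>p\<in>points S2. f p + g p) \<in> O_surface S2" if "f \<in> O_surface S2" "g \<in> O_surface S2" for f g
    by (intro restrict_in_O_surface[OF S2] holomorphic_on_surface_add hol that)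
  moreover have "(\<lambda>p\<in>points S2. a * f p) \<in> O_surface S2" if "f \<in> O_surface S2" for f a
    by (intro restrict_in_O_surface[OF S2] holomorphic_on_surface_scale hol that)
  moreover have "push_forward S1 S2 \<psi> \<Lambda> \<in> extensional (O_surface S2)" by (simp add: push_forward_def)
  ultimately show ?thesis
    using \<Lambda> c unfolding O_dual_def by (simp add: add scale)
qed

lemma pull_composites:
  assumes "\<And>p. p \<in> points S1 \<Longrightarrow> \<psi> p \<in> points S2"
  shows "{restrict (G \<circ> h \<circ> \<psi>) (points S1) | G. G \<in> O_curve V} =
    (\<lambda>g. restrict (g \<circ> \<psi>) (points S1)) ` pullbacks S2 h V"
proof -
  have "restrict (G \<circ> h \<circ> \<psi>) (points S1) =
      restrict (restrict (G \<circ> h) (points S2) \<circ> \<psi>) (points S1)" for G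
    using assms by (auto simp: fun_eq_iff)
  then show ?thesis unfolding pullbacks_def by auto
qed

lemma connection_eq: "connection S h V = {\<Lambda> \<in> O_dual S. \<forall>f\<in>pullbacks S h V. \<Lambda> f = 0}"
  unfolding connection_def pullbacks_def by auto

text \<open>The double annihilator of the pullbacks adds nothing to them, so the connection
  determines the pullbacks.\<close>

lemma pullbacks_eq_annihilator:
  assumes "riemann_surface S" "holomap S U h" "h ` points S = V"
  shows "pullbacks S h V = {f \<in> O_surface S. \<forall>\<Lambda>\<in>connection S h V. \<Lambda> f = 0}"
  using pullbacks_subset[OF assms] connection_separates[OF assms]
  by (auto simp: connection_eq) blast

text \<open>Composition with \<open>\<psi>\<close> is an isomorphism \<open>c\<close> of
  \<open>O_surface S2\<close> onto \<open>O_surface S1\<close>, and push-forward is its transpose.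
  Corresponding subspaces have corresponding annihilators; the converse direction recovers the
  subspaces as double annihilators.\<close>

lemma pullbacks_iff_connections:
  fixes S1 :: "'a surface" and S2 :: "'b surface"
    and h1 :: "'a \<Rightarrow> complex^'n" and h2 :: "'b \<Rightarrow> complex^'m"
  assumes S1: "riemann_surface S1" and S2: "riemann_surface S2"
    and h1: "holomap S1 U1 h1" "h1 ` points S1 = V1" and h2: "holomap S2 U2 h2" "h2 ` points S2 = V2"
    and \<psi>: "biholomorphic_surface_map S1 S2 \<psi>"
  shows "pullbacks S1 h1 V1 = (\<lambda>g. restrict (g \<circ> \<psi>) (points S1)) ` pullbacks S2 h2 V2 \<longleftrightarrow>
    push_forward S1 S2 \<psi> ` connection S1 h1 V1 = connection S2 h2 V2"
proof -
  obtain \<psi>' where \<psi>': "holomorphic_surface_map S1 S2 \<psi>" "holomorphic_surface_map S2 S1 \<psi>'"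
    "\<And>p. p \<in> points S1 \<Longrightarrow> \<psi> p \<in> points S2" "\<And>p. p \<in> points S2 \<Longrightarrow> \<psi>' p \<in> points S1"
    "\<And>p. p \<in> points S1 \<Longrightarrow> \<psi>' (\<psi> p) = p" "\<And>p. p \<in> points S2 \<Longrightarrow> \<psi> (\<psi>' p) = p"
    by (rule biholomorphic_surface_mapE[OF \<psi>]) (rule that)
  define c where "c f = restrict (f \<circ> \<psi>) (points S1)" for f :: "'b \<Rightarrow> complex"
  define c' where "c' f = restrict (f \<circ> \<psi>') (points S2)" for f :: "'a \<Rightarrow> complex"
  have c: "c f \<in> O_surface S1" if "f \<in> O_surface S2" for f
    unfolding c_def by (rule compose_in_O_surface[OF S1 S2 \<psi>'(1) that])
  have c': "c' f \<in> O_surface S2" if "f \<in> O_surface S1" for f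
    unfolding c'_def by (rule compose_in_O_surface[OF S2 S1 \<psi>'(2) that])
  have cc': "c (c' f) = f" if "f \<in> O_surface S1" for f
    using that by (intro extensionalityI[of _ "points S1"]) (auto simp: c_def c'_def O_surface_def \<psi>')
  have c'c: "c' (c f) = f" if "f \<in> O_surface S2" for f
    using that by (intro extensionalityI[of _ "points S2"]) (auto simp: c_def c'_def O_surface_def \<psi>')
  have push: "push_forward S1 S2 \<psi> \<Lambda> f = \<Lambda> (c f)" if "f \<in> O_surface S2" for f \<Lambda>
    using that by (simp add: push_forward_def c_def)
  have push': "push_forward S2 S1 \<psi>' \<Lambda> f = \<Lambda> (c' f)" if "f \<in> O_surface S1" for f \<Lambda>
    using that by (simp add: push_forward_def c'_def)
  note sub1 = pullbacks_subset[OF S1 h1] and sub2 = pullbacks_subset[OF S2 h2]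
  show ?thesis
    unfolding c_def[symmetric]
  proof
    assume eq: "pullbacks S1 h1 V1 = c ` pullbacks S2 h2 V2"
    show "push_forward S1 S2 \<psi> ` connection S1 h1 V1 = connection S2 h2 V2"
    proof (intro equalityI subsetI)
      fix \<Lambda>2 assume "\<Lambda>2 \<in> push_forward S1 S2 \<psi> ` connection S1 h1 V1"
      then obtain \<Lambda> where "\<Lambda> \<in> connection S1 h1 V1" "\<Lambda>2 = push_forward S1 S2 \<psi> \<Lambda>" by blast
      then show "\<Lambda>2 \<in> connection S2 h2 V2"
        using push_forward_in_O_dual[OF S1 S2 \<psi>'(1)] push sub2 eq by (auto simp: connection_eq)
    next
      fix \<Lambda>2 assume \<Lambda>2: "\<Lambda>2 \<in> connection S2 h2 V2"
      \<comment> \<open>The transpose of \<open>c\<close> is inverted by the transpose of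
        \<open>c'\<close>.\<close>
      define \<Lambda> where "\<Lambda> = push_forward S2 S1 \<psi>' \<Lambda>2"
      have "\<Lambda> \<in> O_dual S1"
        unfolding \<Lambda>_def using \<Lambda>2 by (intro push_forward_in_O_dual[OF S2 S1 \<psi>'(2)]) (simp add: connection_eq)
      moreover have "\<Lambda> f = 0" if "f \<in> pullbacks S1 h1 V1" for f
      proof -
        from that have "f \<in> c ` pullbacks S2 h2 V2" by (simp only: eq)
        then obtain g where g: "g \<in> pullbacks S2 h2 V2" "f = c g" by (elim imageE)
        then have "g \<in> O_surface S2" using sub2 by blast
        then have "\<Lambda> f = \<Lambda>2 g" using g(2) by (simp add: \<Lambda>_def push' c c'c)
        then show ?thesis using \<Lambda>2 g(1) by (simp add: connection_eq)
      qed
      ultimately have "\<Lambda> \<in> connection S1 h1 V1" by (simp add: connection_eq)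
      moreover have "push_forward S1 S2 \<psi> \<Lambda> = \<Lambda>2"
      proof (rule extensionalityI[of _ "O_surface S2"])
        show "\<Lambda>2 \<in> extensional (O_surface S2)" using \<Lambda>2 by (simp add: connection_eq O_dual_def)
        show "push_forward S1 S2 \<psi> \<Lambda> f = \<Lambda>2 f" if "f \<in> O_surface S2" for f
          using that by (simp add: push \<Lambda>_def push' c c'c)
      qed (simp add: push_forward_def)
      ultimately show "\<Lambda>2 \<in> push_forward S1 S2 \<psi> ` connection S1 h1 V1" by blast
    qed
  next
    assume eq: "push_forward S1 S2 \<psi> ` connection S1 h1 V1 = connection S2 h2 V2"
    have iff: "g \<in> pullbacks S2 h2 V2 \<longleftrightarrow> c g \<in> pullbacks S1 h1 V1" if g: "g \<in> O_surface S2" for g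
      unfolding pullbacks_eq_annihilator[OF S1 h1] pullbacks_eq_annihilator[OF S2 h2] eq[symmetric]
      using g c[OF g] push[OF g] by simp
    show "pullbacks S1 h1 V1 = c ` pullbacks S2 h2 V2"
    proof (intro equalityI subsetI)
      fix f assume f: "f \<in> pullbacks S1 h1 V1"
      then have "f \<in> O_surface S1" using sub1 by blast
      then have "f = c (c' f)" "c' f \<in> pullbacks S2 h2 V2" using iff[OF c'] f cc' by auto
      then show "f \<in> c ` pullbacks S2 h2 V2" by blast
    qed (use iff sub2 in auto)
  qed
qed

subsection \<open>Maps of curves induced by maps of surfaces\<close>

lemma holomorphic_curve_map_continuous_on:
  fixes \<phi> :: "complex^'n \<Rightarrow> complex^'m"
  assumes "holomorphic_curve_map V1 V2 \<phi>" shows "continuous_on V1 \<phi>"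
proof -
  have "continuous_on V1 (\<lambda>z. \<phi> z $ i)" for i
    unfolding continuous_on_eq_continuous_within
  proof
    fix P assume P: "P \<in> V1"
    then obtain W F where F: "open W" "P \<in> W" "holomorphic_multi F W" "\<forall>z\<in>V1 \<inter> W. \<phi> z $ i = F z"
      using assms unfolding holomorphic_curve_map_def holomorphic_on_curve_def by blast
    have "continuous (at P within V1) F"
      using continuous_on_interior[OF holomorphic_multi_continuous_on[OF F(3)]] F(1,2)
      by (auto simp: interior_open intro: continuous_at_imp_continuous_within)
    then have "(F \<longlongrightarrow> \<phi> P $ i) (at P within V1)"
      using F(2,4) P by (simp add: continuous_within)
    moreover have "\<forall>\<^sub>F z in at P within V1. F z = \<phi> z $ i"
      using eventually_at_topological F(1,2,4) by (metis (mono_tags, lifting) IntI)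
    ultimately have "((\<lambda>z. \<phi> z $ i) \<longlongrightarrow> \<phi> P $ i) (at P within V1)"
      by (rule Lim_transform_eventually)
    then show "continuous (at P within V1) (\<lambda>z. \<phi> z $ i)" by (simp add: continuous_within)
  qed
  then have "continuous_on V1 (\<lambda>z. \<chi> i. \<phi> z $ i)" by (intro continuous_on_vec_lambda)
  then show ?thesis by simp
qed

text \<open>One inclusion of the pullback algebras gives a map in one direction, from
  \<open>V2\<close> to \<open>V1\<close>; its components are functions on \<open>V2\<close> that
  match the coordinates on \<open>V1\<close>. Its values lie in \<open>V1\<close> because every
  point of \<open>V2\<close> is some \<open>h2 (\<psi> p)\<close>.\<close>

lemma curve_map_of_pullbacks:
  fixes h1 :: "'a \<Rightarrow> complex^'n" and h2 :: "'b \<Rightarrow> complex^'m"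
  assumes V2: "h2 ` points S2 = V2" and V1: "h1 ` points S1 = V1"
    and \<psi>: "\<And>p. p \<in> points S1 \<Longrightarrow> \<psi> p \<in> points S2" "\<And>q. q \<in> points S2 \<Longrightarrow> \<exists>p\<in>points S1. \<psi> p = q"
    and pull: "\<And>G. G \<in> O_curve V1 \<Longrightarrow> \<exists>F\<in>O_curve V2. \<forall>p\<in>points S1. G (h1 p) = F (h2 (\<psi> p))"
  obtains \<phi> where "holomorphic_curve_map V2 V1 \<phi>" "\<And>p. p \<in> points S1 \<Longrightarrow> \<phi> (h2 (\<psi> p)) = h1 p"
proof -
  have "restrict (\<lambda>z. z $ i) V1 \<in> O_curve V1" for i
    unfolding O_curve_def holomorphic_on_curve_def
    by (auto intro!: exI[of _ UNIV] exI[of _ "\<lambda>z. z $ i"] holomorphic_multi_nth)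
  then have "\<forall>i. \<exists>F\<in>O_curve V2. \<forall>p\<in>points S1. restrict (\<lambda>z. z $ i) V1 (h1 p) = F (h2 (\<psi> p))"
    using pull by blast
  then obtain F where F: "\<And>i. F i \<in> O_curve V2"
      "\<And>i p. p \<in> points S1 \<Longrightarrow> restrict (\<lambda>z. z $ i) V1 (h1 p) = F i (h2 (\<psi> p))" by metis
  define \<phi> where "\<phi> z = (\<chi> i. F i z)" for z
  have \<phi>: "\<phi> (h2 (\<psi> p)) = h1 p" if "p \<in> points S1" for p
  proof -
    have "h1 p \<in> V1" using that V1 by blast
    then have "F i (h2 (\<psi> p)) = h1 p $ i" for i using F(2)[OF that, of i] by simp
    then show ?thesis by (simp add: \<phi>_def vec_eq_iff)
  qed
  have "\<phi> ` V2 \<subseteq> V1"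
  proof
    fix w assume "w \<in> \<phi> ` V2"
    then obtain q where "q \<in> points S2" "w = \<phi> (h2 q)" using V2 by blast
    then obtain p where "p \<in> points S1" "w = \<phi> (h2 (\<psi> p))" using \<psi>(2) by blast
    then show "w \<in> V1" using \<phi> V1 by auto
  qed
  moreover have "holomorphic_on_curve V2 (\<lambda>z. \<phi> z $ i)" for i
    using F(1)[of i] by (simp add: \<phi>_def O_curve_def)
  ultimately show ?thesis using that \<phi> unfolding holomorphic_curve_map_def by blast
qed

subsection \<open>Lifting maps of curves to the Riemann surfaces\<close>

text \<open>Near \<open>g x\<close> the function \<open>v\<close> has a holomorphic inverse, and by
  continuity \<open>g\<close> is that inverse applied to \<open>v \<circ> g\<close> near
  \<open>x\<close>.\<close>

lemma holomorphic_local_lift: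
  assumes A: "open A" and g: "continuous_on A g" and x: "x \<in> A"
    and B: "open B" "v holomorphic_on B" "g ` A \<subseteq> B" and dv: "deriv v (g x) \<noteq> 0"
    and vg: "(\<lambda>t. v (g t)) holomorphic_on A"
  shows "g field_differentiable at x"
proof -
  have gx: "g x \<in> B" using x B(3) by blast
  obtain r where r: "r > 0" "ball (g x) r \<subseteq> B" "inj_on v (ball (g x) r)"
    by (rule has_complex_derivative_locally_injective[OF B(2) gx B(1) dv]) (rule that)
  have v': "v holomorphic_on ball (g x) r" using B(2) r(2) by (rule holomorphic_on_subset)
  obtain k where k: "k holomorphic_on v ` ball (g x) r" "\<And>z. z \<in> ball (g x) r \<Longrightarrow> k (v z) = z"
    by (rule holomorphic_has_inverse[OF v' open_ball r(3)]) (rule that)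
  define A' where "A' = A \<inter> g -` ball (g x) r"
  have A': "open A'" unfolding A'_def using g A open_ball by (rule continuous_open_preimage)
  have "(\<lambda>t. v (g t)) holomorphic_on A'" using vg by (rule holomorphic_on_subset) (auto simp: A'_def)
  from holomorphic_on_compose_gen[OF this k(1)]
  have "(k \<circ> (\<lambda>t. v (g t))) holomorphic_on A'" by (auto simp: A'_def)
  then have "g holomorphic_on A'"
    by (rule holomorphic_transform) (use k(2) in \<open>auto simp: A'_def\<close>)
  then show ?thesis
    using A' x r(1) by (intro holomorphic_on_imp_differentiable_at[of g A']) (simp_all add: A'_def)
qed

lemma openin_surface_infinite:
  assumes S: "riemann_surface S" and B: "openin (surface_top S) B" "p \<in> B"
  shows "infinite B"
proof -
  have "p \<in> points S" using B openin_subset by blast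
  then obtain T r where T: "disc S T r" "T 0 = p" using disc_exists[OF S] by blast
  have "T 0 \<in> B" using T(2) B(2) by simp
  then obtain r' where r': "0 < r'" "T ` ball 0 r' \<subseteq> B" "disc S T r'"
    by (rule disc_shrink[OF T(1) B(1)]) (rule that)
  have "infinite (ball (0::complex) r')"
    using uncountable_ball[OF r'(1)] countable_finite by blast
  then have "infinite (T ` ball 0 r')" using finite_imageD[OF _ discD(3)[OF r'(3)]] by blast
  then show ?thesis using r'(2) infinite_super by blast
qed

text \<open>Where \<open>h\<close> is nonsingular at \<open>\<psi> p\<close>, one component of
  \<open>h\<close> is a local coordinate, and \<open>\<psi>\<close> is recovered from the
  corresponding component of \<open>h \<circ> \<psi>\<close>. The points of \<open>G\<close> are
  removable singularities of a continuous function.\<close>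

lemma holomorphic_surface_mapI:
  fixes h :: "'b \<Rightarrow> complex^'m"
  assumes S1: "riemann_surface S1" and S2: "riemann_surface S2"
    and cont: "continuous_map (surface_top S1) (surface_top S2) \<psi>"
    and h: "\<And>i. holomorphic_on_surface S2 (\<lambda>p. h p $ i)"
    and h\<psi>: "\<And>i. holomorphic_on_surface S1 (\<lambda>p. h (\<psi> p) $ i)"
    and G: "finite G" and ns: "\<And>p. p \<in> points S1 - G \<Longrightarrow> nonsingular_at S2 h (\<psi> p)"
  shows "holomorphic_surface_map S1 S2 \<psi>"
  unfolding holomorphic_surface_map_def
proof (intro conjI cont, clarify)
  fix W c W' c' assume Wc: "(W, c) \<in> atlas S1" and Wc': "(W', c') \<in> atlas S2"
  note ch = chart_facts[OF S1 Wc] and ch' = chart_facts[OF S2 Wc']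
  define A where "A = c ` (W \<inter> \<psi> -` W')"
  define g where "g = c' \<circ> \<psi> \<circ> inv_into W c"
  have pre: "open (c ` (W \<inter> \<psi> -` B))" if "openin (surface_top S2) B" for B
  proof -
    have "c ` ({p \<in> points S1. \<psi> p \<in> B} \<inter> W) = c ` (W \<inter> \<psi> -` B)"
      using ch(4) by auto
    then show ?thesis using ch(6)[OF openin_continuous_map_preimage[OF cont that]] by simp
  qed
  have A: "open A" unfolding A_def by (rule pre[OF ch'(1)])
  have "continuous_on A g"
    unfolding continuous_on_open_vimage[OF A]
  proof (intro allI impI)
    fix B :: "complex set" assume B: "open B"
    have "g -` B \<inter> A = c ` (W \<inter> \<psi> -` {x \<in> W'. c' x \<in> B})"
      using ch(3) by (auto simp: g_def A_def)
    then show "open (g -` B \<inter> A)" using pre[OF ch'(5)[OF B]] by simp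
  qed
  moreover have "g holomorphic_on (A - c ` (G \<inter> W))"
    unfolding holomorphic_on_def
  proof
    fix x assume "x \<in> A - c ` (G \<inter> W)"
    then obtain p where p: "p \<in> W" "\<psi> p \<in> W'" "x = c p" "p \<notin> G" and x: "x \<in> A" by (auto simp: A_def)
    have gx: "g x = c' (\<psi> p)" using p ch(3) by (simp add: g_def)
    have "p \<in> points S1 - G" using p ch(4) by blast
    from ns[OF this] obtain i where i: "deriv (\<lambda>t. h (inv_into W' c' t) $ i) (c' (\<psi> p)) \<noteq> 0"
      using Wc' p(2) unfolding nonsingular_at_def by blast
    have v: "(\<lambda>t. h (inv_into W' c' t) $ i) holomorphic_on c' ` W'"
      using h[of i] Wc' unfolding holomorphic_on_surface_def by (auto simp: o_def)
    have "(\<lambda>t. h (\<psi> (inv_into W c t)) $ i) holomorphic_on c ` W"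
      using h\<psi>[of i] Wc unfolding holomorphic_on_surface_def by (auto simp: o_def)
    then have "(\<lambda>t. h (\<psi> (inv_into W c t)) $ i) holomorphic_on A"
      by (rule holomorphic_on_subset) (auto simp: A_def)
    then have vg: "(\<lambda>t. h (inv_into W' c' (g t)) $ i) holomorphic_on A"
      by (rule holomorphic_transform) (use ch(3) ch'(3) in \<open>auto simp: A_def g_def\<close>)
    have im: "g ` A \<subseteq> c' ` W'" using ch(3) by (auto simp: A_def g_def)
    have "g field_differentiable at x"
      by (rule holomorphic_local_lift[OF A \<open>continuous_on A g\<close> x ch'(2) v im i[folded gx] vg])
    then show "g field_differentiable at x within (A - c ` (G \<inter> W))"
      by (rule field_differentiable_at_within)
  qed
  ultimately have "g holomorphic_on A"
    by (rule no_isolated_singularity) (use A G in auto)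
  then show "(c' \<circ> \<psi> \<circ> inv_into W c) holomorphic_on c ` (W \<inter> \<psi> -` W')"
    by (simp add: g_def A_def)
qed

lemma connected_finite_disjoint_cover:
  assumes A: "connected A" "x \<in> A" and Q: "finite Q" and op: "\<And>q. q \<in> Q \<Longrightarrow> open (B q)"
    and disj: "\<And>p q. p \<in> Q \<Longrightarrow> q \<in> Q \<Longrightarrow> p \<noteq> q \<Longrightarrow> B p \<inter> B q = {}" and cover: "A \<subseteq> (\<Union>q\<in>Q. B q)"
  shows "\<exists>q\<in>Q. A \<subseteq> B q"
proof -
  obtain q where q: "q \<in> Q" "x \<in> B q" using A(2) cover by blast
  have "open (\<Union>p\<in>Q - {q}. B p)" using op by (intro open_UN) auto
  moreover have "B q \<inter> (\<Union>p\<in>Q - {q}. B p) \<inter> A = {}" using disj q(1) by blast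
  moreover have "A \<subseteq> B q \<union> (\<Union>p\<in>Q - {q}. B p)" using cover by blast
  ultimately have "B q \<inter> A = {} \<or> (\<Union>p\<in>Q - {q}. B p) \<inter> A = {}"
    using connectedD[OF A(1) op[OF q(1)]] by blast
  then have "A \<subseteq> B q" using A(2) q(2) cover by blast
  then show ?thesis using q(1) by blast
qed

lemma openin_minus_finite:
  assumes "riemann_surface S" "openin (surface_top S) B" "finite F"
  shows "openin (surface_top S) (B - F)"
proof -
  have "Hausdorff_space (surface_top S)" using assms(1) unfolding riemann_surface_def by blast
  then have "closedin (surface_top S) (F \<inter> points S)"
    using assms(3) by (intro closedin_Hausdorff_finite) auto
  then have "openin (surface_top S) (B - F \<inter> points S)" using assms(2) by (intro openin_diff)
  moreover have "B - F \<inter> points S = B - F" using openin_subset[OF assms(2)] by blast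
  ultimately show ?thesis by simp
qed

text \<open>Away from finitely many points the lift is \<open>h2\<^sup>-\<^sup>1 \<circ> \<phi> \<circ> h1\<close>. At such a point \<open>p\<close> the cluster
  values lie in the finite fibre of \<open>h2\<close> over \<open>\<phi> (h1 p)\<close>, and connectedness of a punctured
  disc around \<open>p\<close> leaves only one of them.\<close>

lemma holomap_lift:
  fixes h1 :: "'a \<Rightarrow> complex^'n" and h2 :: "'b \<Rightarrow> complex^'m"
  assumes S1: "riemann_surface S1" and S2: "riemann_surface S2"
    and h1: "holomap S1 U1 h1" "h1 ` points S1 = V1" and h2: "holomap S2 U2 h2" "h2 ` points S2 = V2"
    and \<phi>: "holomorphic_curve_map V1 V2 \<phi>" "inj_on \<phi> V1"
  obtains \<psi> where "holomorphic_surface_map S1 S2 \<psi>" "\<And>p. p \<in> points S1 \<Longrightarrow> \<psi> p \<in> points S2"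
    "\<And>p. p \<in> points S1 \<Longrightarrow> h2 (\<psi> p) = \<phi> (h1 p)"
proof -
  obtain E2 where E2: "finite E2" "E2 \<subseteq> points S2" "\<And>p. p \<in> points S2 - E2 \<Longrightarrow> nonsingular_at S2 h2 p"
      "inj_on h2 (points S2 - E2)"
    by (rule holomap_exceptional[OF h2(1)]) (rule that)
  have hol1: "holomorphic_on_surface S1 (\<lambda>p. h1 p $ i)" for i
    using h1(1) unfolding holomap_def by blast
  have hol2: "holomorphic_on_surface S2 (\<lambda>p. h2 p $ i)" for i
    using h2(1) unfolding holomap_def by blast
  have Haus2: "Hausdorff_space (surface_top S2)" using S2 unfolding riemann_surface_def by blast
  define f where "f p = \<phi> (h1 p)" for p
  have fV: "f p \<in> V2" if "p \<in> points S1" for p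
    using \<phi>(1) h1(2) that unfolding holomorphic_curve_map_def f_def by blast
  have fU: "f p \<in> U2" if "p \<in> points S1" for p
    using fV[OF that] h2 unfolding holomap_def by blast
  have f_hol: "holomorphic_on_surface S1 (\<lambda>p. f p $ i)" for i
    unfolding f_def
    by (rule holomorphic_on_surface_compose_curve[OF S1 hol1, of V1 "\<lambda>z. \<phi> z $ i"])
       (use \<phi>(1) h1(2) in \<open>auto simp: holomorphic_curve_map_def\<close>)
  have f_cont: "continuous_map (surface_top S1) euclidean f"
    by (rule holomorphic_vec_continuous[OF S1 f_hol])
  \<comment> \<open>Defined by the image of \<open>E2\<close> and not by \<open>E2\<close> itself: a
    point outside \<open>E2\<close> can share its image with a point of \<open>E2\<close>. Off
    \<open>G\<close> the fibre of \<open>h2\<close> over \<open>f p\<close> is a single nonsingular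
    point.\<close>
  define G where "G = {p \<in> points S1. f p \<in> h2 ` E2}"
  have G: "finite G"
  proof -
    have "finite (\<Union>y\<in>h2 ` E2. {p \<in> points S1. f p = y})"
    proof (intro finite_UN_I)
      fix y
      show "finite {p \<in> points S1. f p = y}"
      proof (cases "\<exists>p0\<in>points S1. f p0 = y")
        case True
        then obtain p0 where p0: "p0 \<in> points S1" "f p0 = y" by blast
        have "{p \<in> points S1. f p = y} \<subseteq> {p \<in> points S1. h1 p = h1 p0}"
          using inj_onD[OF \<phi>(2)] p0 h1(2) by (auto simp: f_def)
        then show ?thesis using holomap_finite_fibre[OF h1(1)] finite_subset by blast
      next
        case False
        then have "{p \<in> points S1. f p = y} = {}" by blast
        then show ?thesis by (simp only: finite.emptyI)
      qed
    qed (use E2(1) in simp)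
    then show ?thesis by (rule rev_finite_subset) (auto simp: G_def)
  qed
  \<comment> \<open>An arbitrary choice in the fibre. Off \<open>G\<close> it is forced; at the
    points of \<open>G\<close> it is replaced by a limit.\<close>
  define \<psi>0 where "\<psi>0 p = (SOME q. q \<in> points S2 \<and> h2 q = f p)" for p
  have \<psi>0: "\<psi>0 p \<in> points S2 \<and> h2 (\<psi>0 p) = f p" if "p \<in> points S1" for p
    unfolding \<psi>0_def
  proof (rule someI_ex)
    have "f p \<in> h2 ` points S2" using fV[OF that] h2(2) by simp
    then obtain q where "f p = h2 q" "q \<in> points S2" by (rule imageE)
    then show "\<exists>q. q \<in> points S2 \<and> h2 q = f p" by (intro exI[of _ q]) simp
  qed
  have unique: "q = q'" if "p \<in> points S1 - G" "q \<in> points S2" "h2 q = f p" "q' \<in> points S2" "h2 q' = f p"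
    for p q q'
  proof -
    have "h2 q \<notin> h2 ` E2" "h2 q' \<notin> h2 ` E2" using that by (simp_all add: G_def)
    then have "q \<in> points S2 - E2" "q' \<in> points S2 - E2" using that by blast+
    then show ?thesis using inj_onD[OF E2(4), of q q'] that by simp
  qed
  \<comment> \<open>The form of continuity that survives the arbitrary choice and holds at every
    point: \<open>B\<close> has to contain the whole fibre.\<close>
  have near: "\<exists>B'. openin (surface_top S1) B' \<and> p \<in> B' \<and> \<psi>0 ` B' \<subseteq> B"
    if p: "p \<in> points S1" and B: "openin (surface_top S2) B" "{q \<in> points S2. h2 q = f p} \<subseteq> B" for p B
  proof -
    obtain W where W: "open W" "f p \<in> W" "\<And>q. q \<in> points S2 \<Longrightarrow> h2 q \<in> W \<Longrightarrow> q \<in> B"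
      by (rule holomap_fibre_neighbourhood[OF h2(1) fU[OF p] B]) (rule that)
    have "openin (surface_top S1) {p' \<in> points S1. f p' \<in> W}"
      using openin_continuous_map_preimage[OF f_cont] W(1) by simp
    moreover have "\<psi>0 ` {p' \<in> points S1. f p' \<in> W} \<subseteq> B"
      using \<psi>0 W(3) by auto
    ultimately show ?thesis using p W(2) by blast
  qed
  have limit: "\<exists>q. q \<in> points S2 \<and> h2 q = f p \<and> (\<forall>B. openin (surface_top S2) B \<longrightarrow> q \<in> B \<longrightarrow>
      (\<exists>B'. openin (surface_top S1) B' \<and> p \<in> B' \<and> \<psi>0 ` (B' - {p}) \<subseteq> B))" if p: "p \<in> points S1" for p
  proof -
    define Q where "Q = {q \<in> points S2. h2 q = f p}"
    have Q: "finite Q" "Q \<subseteq> points S2"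
      unfolding Q_def using holomap_finite_fibre[OF h2(1)] by auto
    obtain N where N: "\<And>q. q \<in> Q \<Longrightarrow> openin (surface_top S2) (N q)" "\<And>q. q \<in> Q \<Longrightarrow> q \<in> N q"
        "\<And>q q'. q \<in> Q \<Longrightarrow> q' \<in> Q \<Longrightarrow> q \<noteq> q' \<Longrightarrow> N q \<inter> N q' = {}"
      by (rule Hausdorff_space_separate_finite[OF Haus2 Q]) (rule that)
    have "openin (surface_top S2) (\<Union>q\<in>Q. N q)" using N(1) by auto
    moreover have "{q \<in> points S2. h2 q = f p} \<subseteq> (\<Union>q\<in>Q. N q)" using N(2) by (auto simp: Q_def)
    ultimately obtain B0 where B0: "openin (surface_top S1) B0" "p \<in> B0" "\<psi>0 ` B0 \<subseteq> (\<Union>q\<in>Q. N q)"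
      using near[OF p] by blast
    obtain T r0 where T0: "disc S1 T r0" "T 0 = p" using disc_exists[OF S1 p] by blast
    \<comment> \<open>Removing the other points of \<open>G\<close> leaves a punctured disc over
      which the fibres of \<open>h2\<close> are single points. There \<open>near\<close> becomes
      genuine continuity of \<open>\<psi>0\<close>, which makes the sets \<open>A q\<close>
      open.\<close>
    have "openin (surface_top S1) (B0 - (G - {p}))" "T 0 \<in> B0 - (G - {p})"
      using openin_minus_finite[OF S1 B0(1)] G B0(2) T0(2) by auto
    then obtain r where r: "0 < r" "T ` ball 0 r \<subseteq> B0 - (G - {p})" and T: "disc S1 T r"
      by (rule disc_shrink[OF T0(1)]) (rule that)
    have Tp: "T t \<noteq> p" if "t \<in> ball 0 r - {0}" for t
      using inj_onD[OF discD(3)[OF T], of t 0] that T0(2) r(1) by auto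
    define A where "A q = {t \<in> ball 0 r - {0}. \<psi>0 (T t) \<in> N q}" for q
    have conn: "connected (ball (0::complex) r - {0})"
      by (rule connected_punctured_ball) simp
    have x0: "complex_of_real (r / 2) \<in> ball 0 r - {0}" using r(1) by simp
    have op: "open (A q)" if q: "q \<in> Q" for q
    proof (subst open_subopen, intro ballI)
      fix t assume t: "t \<in> A q"
      then have t': "t \<in> ball 0 r" "t \<noteq> 0" "\<psi>0 (T t) \<in> N q" by (auto simp: A_def)
      have "T t \<in> B0 - (G - {p})" using r(2) t'(1) by blast
      then have Tt: "T t \<in> points S1 - G"
        using Tp[of t] t'(1,2) disc_in_points[OF T t'(1)] by simp
      have "{q' \<in> points S2. h2 q' = f (T t)} \<subseteq> N q"
        using unique[OF Tt] \<psi>0[of "T t"] t'(3) Tt by auto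
      then obtain B' where B': "openin (surface_top S1) B'" "T t \<in> B'" "\<psi>0 ` B' \<subseteq> N q"
        using near[of "T t" "N q"] N(1)[OF q] Tt by blast
      have "open ({s \<in> ball 0 r. T s \<in> B'} - {0})" using discD(4)[OF T B'(1)] by (intro open_Diff) auto
      then show "\<exists>D. open D \<and> t \<in> D \<and> D \<subseteq> A q"
        using B' t' by (intro exI[of _ "{s \<in> ball 0 r. T s \<in> B'} - {0}"]) (auto simp: A_def)
    qed
    have disj: "A q \<inter> A q' = {}" if "q \<in> Q" "q' \<in> Q" "q \<noteq> q'" for q q'
      using N(3)[OF that] by (auto simp: A_def)
    have cover: "ball 0 r - {0} \<subseteq> (\<Union>q\<in>Q. A q)"
    proof
      fix t :: complex assume t: "t \<in> ball 0 r - {0}"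
      then have "T t \<in> B0" using r(2) by blast
      then obtain q where "q \<in> Q" "\<psi>0 (T t) \<in> N q" using B0(3) by blast
      then show "t \<in> (\<Union>q\<in>Q. A q)" using t unfolding A_def by blast
    qed
    have "\<exists>q\<in>Q. ball 0 r - {0} \<subseteq> A q"
      using conn x0 Q(1) op disj cover by (rule connected_finite_disjoint_cover)
    then obtain q where q: "q \<in> Q" "ball 0 r - {0} \<subseteq> A q" by blast
    have "\<exists>B'. openin (surface_top S1) B' \<and> p \<in> B' \<and> \<psi>0 ` (B' - {p}) \<subseteq> B"
      if B: "openin (surface_top S2) B" "q \<in> B" for B
    proof -
      \<comment> \<open>Only the neighbourhood of \<open>q\<close> is cut down to \<open>B\<close>.
        Keeping those of the other points lets \<open>near\<close> apply to the whole fibre;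
        disjointness from \<open>N q\<close> discards them afterwards.\<close>
      define B1 where "B1 = (B \<inter> N q) \<union> (\<Union>q'\<in>Q - {q}. N q')"
      have "openin (surface_top S2) B1"
        unfolding B1_def using B(1) N(1) q(1) by (intro openin_Un openin_Int openin_Union) auto
      moreover have "{q' \<in> points S2. h2 q' = f p} \<subseteq> B1"
        using N(2) q(1) B(2) by (auto simp: B1_def Q_def)
      ultimately obtain B' where B': "openin (surface_top S1) B'" "p \<in> B'" "\<psi>0 ` B' \<subseteq> B1"
        using near[OF p] by blast
      have "\<psi>0 p' \<in> B" if p': "p' \<in> B' \<inter> T ` ball 0 r - {p}" for p'
      proof -
        obtain t where t: "t \<in> ball 0 r" "p' = T t" using p' by blast
        then have "t \<noteq> 0" using p' T0(2) by auto
        then have "\<psi>0 p' \<in> N q" using q(2) t by (auto simp: A_def)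
        moreover have "\<psi>0 p' \<in> B1" using B'(3) p' by blast
        ultimately show ?thesis using N(3)[OF q(1)] by (auto simp: B1_def)
      qed
      moreover have "openin (surface_top S1) (B' \<inter> T ` ball 0 r)"
        using B'(1) discD(5)[OF T open_ball] by (intro openin_Int) auto
      moreover have "p \<in> B' \<inter> T ` ball 0 r" using B'(2) T0(2) r(1) by force
      ultimately show ?thesis by (intro exI[of _ "B' \<inter> T ` ball 0 r"]) auto
    qed
    then show ?thesis using q(1) by (auto simp: Q_def)
  qed
  then obtain \<psi> where \<psi>: "\<And>p. p \<in> points S1 \<Longrightarrow> \<psi> p \<in> points S2" "\<And>p. p \<in> points S1 \<Longrightarrow> h2 (\<psi> p) = f p"
    and lim: "\<And>p B. p \<in> points S1 \<Longrightarrow> openin (surface_top S2) B \<Longrightarrow> \<psi> p \<in> B \<Longrightarrow>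
      \<exists>B'. openin (surface_top S1) B' \<and> p \<in> B' \<and> \<psi>0 ` (B' - {p}) \<subseteq> B"
    by metis
  have \<psi>_eq: "\<psi> p = \<psi>0 p" if "p \<in> points S1 - G" for p
    using unique[OF that] \<psi> \<psi>0 that by blast
  have cont: "continuous_map (surface_top S1) (surface_top S2) \<psi>"
    unfolding continuous_map
  proof (intro conjI allI impI)
    show "\<psi> ` points S1 \<subseteq> points S2" using \<psi>(1) by blast
    fix B assume B: "openin (surface_top S2) B"
    show "openin (surface_top S1) {p \<in> points S1. \<psi> p \<in> B}"
    proof (subst openin_subopen, intro ballI)
      fix p assume "p \<in> {p \<in> points S1. \<psi> p \<in> B}"
      then have p: "p \<in> points S1" "\<psi> p \<in> B" by auto
      then obtain B' where B': "openin (surface_top S1) B'" "p \<in> B'" "\<psi>0 ` (B' - {p}) \<subseteq> B"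
        using lim[OF p(1) B] by blast
      \<comment> \<open>\<open>lim\<close> controls \<open>\<psi>0\<close> and not
        \<open>\<psi>\<close>. Outside \<open>G\<close> the two agree, and at \<open>p\<close> the
        value of \<open>\<psi>\<close> lies in \<open>B\<close> by assumption.\<close>
      have "openin (surface_top S1) (B' - (G - {p}))"
        using openin_minus_finite[OF S1 B'(1)] G by simp
      moreover have "B' - (G - {p}) \<subseteq> {p \<in> points S1. \<psi> p \<in> B}"
      proof
        fix p' assume p': "p' \<in> B' - (G - {p})"
        then have "p' \<in> points S1" using openin_subset[OF B'(1)] by blast
        then show "p' \<in> {p \<in> points S1. \<psi> p \<in> B}"
          using p' p(2) B'(3) \<psi>_eq[of p'] by (cases "p' = p") auto
      qed
      ultimately show "\<exists>T. openin (surface_top S1) T \<and> p \<in> T \<and> T \<subseteq> {p \<in> points S1. \<psi> p \<in> B}"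
        using B'(2) by (intro exI[of _ "B' - (G - {p})"]) auto
    qed
  qed
  have "holomorphic_on_surface S1 (\<lambda>p. h2 (\<psi> p) $ i)" for i
    by (rule holomorphic_on_surface_cong[OF S1 f_hol[of i]]) (simp add: \<psi>(2))
  moreover have "nonsingular_at S2 h2 (\<psi> p)" if "p \<in> points S1 - G" for p
  proof -
    have "h2 (\<psi> p) \<notin> h2 ` E2" using that \<psi>(2)[of p] by (simp add: G_def)
    then have "\<psi> p \<notin> E2" by blast
    then show ?thesis using E2(3) \<psi>(1) that by blast
  qed
  ultimately have "holomorphic_surface_map S1 S2 \<psi>"
    using G by (intro holomorphic_surface_mapI[OF S1 S2 cont hol2])
  then show ?thesis using that \<psi> by (simp add: f_def)
qed

text \<open>A continuous \<open>g\<close> that moves \<open>p\<close> moves every point of a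
  neighbourhood. A moved point and its image have the same value under \<open>h\<close>, so one of
  them lies in \<open>E\<close>. Hence all these points lie in finitely many finite fibres, whereas
  nonempty open sets are infinite.\<close>

lemma holomap_lift_inverse:
  assumes S: "riemann_surface S" and h: "holomap S U h"
    and g: "continuous_map (surface_top S) (surface_top S) g"
    and hg: "\<And>p. p \<in> points S \<Longrightarrow> h (g p) = h p" and p: "p \<in> points S"
  shows "g p = p"
proof (rule ccontr)
  assume neq: "g p \<noteq> p"
  have g_im: "g q \<in> points S" if "q \<in> points S" for q
    using g that unfolding continuous_map by blast
  have "Hausdorff_space (surface_top S)" using S unfolding riemann_surface_def by blast
  then obtain A B where AB: "openin (surface_top S) A" "openin (surface_top S) B" "g p \<in> A" "p \<in> B" "disjnt A B"
    using p g_im[OF p] neq unfolding Hausdorff_space_def by blast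
  define C where "C = {q \<in> points S. g q \<in> A} \<inter> B"
  have "openin (surface_top S) C"
    unfolding C_def using openin_continuous_map_preimage[OF g AB(1)] AB(2) by (rule openin_Int)
  moreover have "p \<in> C" using p AB by (simp add: C_def)
  ultimately have "infinite C" by (rule openin_surface_infinite[OF S])
  obtain E where E: "finite E" "inj_on h (points S - E)"
    using holomap_exceptional[OF h] by metis
  have "C \<subseteq> (\<Union>e\<in>E. {q \<in> points S. h q = h e})"
  proof
    fix q assume "q \<in> C"
    then have q: "q \<in> points S" "g q \<noteq> q" using AB(5) by (auto simp: C_def disjnt_iff)
    then have "q \<in> E \<or> g q \<in> E" using inj_onD[OF E(2) hg[OF q(1)]] g_im[OF q(1)] by blast
    then show "q \<in> (\<Union>e\<in>E. {q \<in> points S. h q = h e})"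
      using UN_I[of q E q "\<lambda>e. {q \<in> points S. h q = h e}"]
        UN_I[of "g q" E q "\<lambda>e. {q \<in> points S. h q = h e}"] q(1) hg[OF q(1)] by auto
  qed
  moreover have "finite (\<Union>e\<in>E. {q \<in> points S. h q = h e})"
    using E(1) holomap_finite_fibre[OF h] by blast
  ultimately show False using \<open>infinite C\<close> finite_subset by blast
qed

lemma O_curve_compose:
  assumes "holomorphic_curve_map V1 V2 \<phi>" and "G \<in> O_curve V2"
  shows "restrict (\<lambda>z. G (\<phi> z)) V1 \<in> O_curve V1"
  using holomorphic_on_curve_compose[of V2 G V1 \<phi>] assms
  by (auto simp: O_curve_def holomorphic_on_curve_def)

text \<open>Lift \<open>\<phi>\<close> and its inverse separately. Both composites of the lifts lie
  over the identity of a curve, so they are identities by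
  \<open>holomap_lift_inverse\<close>.\<close>

lemma curve_isomorphism_lifts:
  fixes h1 :: "'a \<Rightarrow> complex^'n" and h2 :: "'b \<Rightarrow> complex^'m"
  assumes S1: "riemann_surface S1" and S2: "riemann_surface S2"
    and h1: "holomap S1 U1 h1" "h1 ` points S1 = V1" and h2: "holomap S2 U2 h2" "h2 ` points S2 = V2"
    and \<phi>: "biholomorphic_curve_map V1 V2 \<phi>"
  shows "\<exists>\<psi>. biholomorphic_surface_map S1 S2 \<psi> \<and> (\<forall>p\<in>points S1. h2 (\<psi> p) = \<phi> (h1 p))"
proof -
  obtain \<phi>' where hom: "homeomorphism V1 V2 \<phi> \<phi>'"
    and \<phi>': "holomorphic_curve_map V1 V2 \<phi>" "holomorphic_curve_map V2 V1 \<phi>'"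
    using \<phi> unfolding biholomorphic_curve_map_def by blast
  have inv: "\<And>z. z \<in> V1 \<Longrightarrow> \<phi>' (\<phi> z) = z" "\<And>z. z \<in> V2 \<Longrightarrow> \<phi> (\<phi>' z) = z"
    using hom by (auto simp: homeomorphism_def)
  have inj: "inj_on \<phi> V1" "inj_on \<phi>' V2"
    by (rule inj_on_inverseI, rule inv(1), assumption) (rule inj_on_inverseI, rule inv(2), assumption)
  obtain \<psi> where \<psi>: "holomorphic_surface_map S1 S2 \<psi>" "\<And>p. p \<in> points S1 \<Longrightarrow> \<psi> p \<in> points S2"
    "\<And>p. p \<in> points S1 \<Longrightarrow> h2 (\<psi> p) = \<phi> (h1 p)"
    by (rule holomap_lift[OF S1 S2 h1 h2 \<phi>'(1) inj(1)]) (rule that)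
  obtain \<psi>' where \<psi>': "holomorphic_surface_map S2 S1 \<psi>'" "\<And>p. p \<in> points S2 \<Longrightarrow> \<psi>' p \<in> points S1"
    "\<And>p. p \<in> points S2 \<Longrightarrow> h1 (\<psi>' p) = \<phi>' (h2 p)"
    by (rule holomap_lift[OF S2 S1 h2 h1 \<phi>'(2) inj(2)]) (rule that)
  have cont: "continuous_map (surface_top S1) (surface_top S2) \<psi>"
      "continuous_map (surface_top S2) (surface_top S1) \<psi>'"
    using \<psi>(1) \<psi>'(1) unfolding holomorphic_surface_map_def by blast+
  have "\<psi>' (\<psi> p) = p" if "p \<in> points S1" for p
  proof (rule holomap_lift_inverse[OF S1 h1(1) _ _ that])
    show "continuous_map (surface_top S1) (surface_top S1) (\<lambda>p. \<psi>' (\<psi> p))"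
      using continuous_map_compose[OF cont] by (simp add: o_def)
    show "h1 (\<psi>' (\<psi> q)) = h1 q" if "q \<in> points S1" for q
      using that \<psi> \<psi>' inv(1)[of "h1 q"] h1(2) by auto
  qed
  moreover have "\<psi> (\<psi>' p) = p" if "p \<in> points S2" for p
  proof (rule holomap_lift_inverse[OF S2 h2(1) _ _ that])
    show "continuous_map (surface_top S2) (surface_top S2) (\<lambda>p. \<psi> (\<psi>' p))"
      using continuous_map_compose[OF cont(2,1)] by (simp add: o_def)
    show "h2 (\<psi> (\<psi>' q)) = h2 q" if "q \<in> points S2" for q
      using that \<psi> \<psi>' inv(2)[of "h2 q"] h2(2) by auto
  qed
  ultimately have "biholomorphic_surface_map S1 S2 \<psi>"
    unfolding biholomorphic_surface_map_def homeomorphic_maps_def using cont \<psi>(1) \<psi>'(1) by blast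
  then show ?thesis using \<psi>(3) by blast
qed

lemma intertwined_imp_pullbacks_eq:
  fixes h1 :: "'a \<Rightarrow> complex^'n" and h2 :: "'b \<Rightarrow> complex^'m"
  assumes h1: "h1 ` points S1 = V1" and h2: "h2 ` points S2 = V2"
    and \<psi>: "biholomorphic_surface_map S1 S2 \<psi>" and \<phi>: "biholomorphic_curve_map V1 V2 \<phi>"
    and comm: "\<And>p. p \<in> points S1 \<Longrightarrow> h2 (\<psi> p) = \<phi> (h1 p)"
  shows "{restrict (F \<circ> h1) (points S1) | F. F \<in> O_curve V1} =
    {restrict (G \<circ> h2 \<circ> \<psi>) (points S1) | G. G \<in> O_curve V2}"
proof -
  obtain \<phi>' where hom: "homeomorphism V1 V2 \<phi> \<phi>'"
    and \<phi>': "holomorphic_curve_map V1 V2 \<phi>" "holomorphic_curve_map V2 V1 \<phi>'"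
    using \<phi> unfolding biholomorphic_curve_map_def by blast
  have inv: "\<And>z. z \<in> V1 \<Longrightarrow> \<phi>' (\<phi> z) = z" using hom by (auto simp: homeomorphism_def)
  have h1V: "h1 p \<in> V1" "\<phi> (h1 p) \<in> V2" if "p \<in> points S1" for p
    using that h1 \<phi>'(1) unfolding holomorphic_curve_map_def by blast+
  show ?thesis
  proof (intro equalityI subsetI)
    fix f assume "f \<in> {restrict (F \<circ> h1) (points S1) | F. F \<in> O_curve V1}"
    then obtain F where F: "F \<in> O_curve V1" "f = restrict (F \<circ> h1) (points S1)" by blast
    have "f = restrict (restrict (\<lambda>z. F (\<phi>' z)) V2 \<circ> h2 \<circ> \<psi>) (points S1)"
      unfolding F(2) by (rule restrict_ext) (simp add: comm h1V inv)
    then show "f \<in> {restrict (G \<circ> h2 \<circ> \<psi>) (points S1) | G. G \<in> O_curve V2}"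
      using O_curve_compose[OF \<phi>'(2) F(1)] by blast
  next
    fix f assume "f \<in> {restrict (G \<circ> h2 \<circ> \<psi>) (points S1) | G. G \<in> O_curve V2}"
    then obtain G where G: "G \<in> O_curve V2" "f = restrict (G \<circ> h2 \<circ> \<psi>) (points S1)" by blast
    have "f = restrict (restrict (\<lambda>z. G (\<phi> z)) V1 \<circ> h1) (points S1)"
      unfolding G(2) by (rule restrict_ext) (simp add: comm h1V)
    then show "f \<in> {restrict (F \<circ> h1) (points S1) | F. F \<in> O_curve V1}"
      using O_curve_compose[OF \<phi>'(1) G(1)] by blast
  qed
qed

text \<open>The two inclusions contained in \<open>eq\<close> give \<open>\<phi>'\<close> and
  \<open>\<phi>\<close>. They are inverse to each other because each is determined by its values at
  images of surface points.\<close>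

lemma pullbacks_eq_imp_intertwined:
  fixes h1 :: "'a \<Rightarrow> complex^'n" and h2 :: "'b \<Rightarrow> complex^'m"
  assumes h1: "h1 ` points S1 = V1" and h2: "h2 ` points S2 = V2"
    and \<psi>: "biholomorphic_surface_map S1 S2 \<psi>"
    and eq: "{restrict (F \<circ> h1) (points S1) | F. F \<in> O_curve V1} =
      {restrict (G \<circ> h2 \<circ> \<psi>) (points S1) | G. G \<in> O_curve V2}"
  shows "\<exists>\<phi>. biholomorphic_curve_map V1 V2 \<phi> \<and> (\<forall>p\<in>points S1. h2 (\<psi> p) = \<phi> (h1 p))"
proof -
  obtain \<psi>' where \<psi>'_holo: "holomorphic_surface_map S1 S2 \<psi>" "holomorphic_surface_map S2 S1 \<psi>'"
    and \<psi>': "\<And>p. p \<in> points S1 \<Longrightarrow> \<psi> p \<in> points S2" "\<And>p. p \<in> points S2 \<Longrightarrow> \<psi>' p \<in> points S1"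
    "\<And>p. p \<in> points S1 \<Longrightarrow> \<psi>' (\<psi> p) = p" "\<And>p. p \<in> points S2 \<Longrightarrow> \<psi> (\<psi>' p) = p"
    by (rule biholomorphic_surface_mapE[OF \<psi>]) (rule that)
  have pull12: "\<exists>F\<in>O_curve V2. \<forall>p\<in>points S1. G (h1 p) = F (h2 (\<psi> p))" if G: "G \<in> O_curve V1" for G
  proof -
    have "restrict (G \<circ> h1) (points S1) \<in> {restrict (G \<circ> h2 \<circ> \<psi>) (points S1) | G. G \<in> O_curve V2}"
      unfolding eq[symmetric] using G by blast
    then obtain F where F: "F \<in> O_curve V2"
        "restrict (G \<circ> h1) (points S1) = restrict (F \<circ> h2 \<circ> \<psi>) (points S1)" by blast
    have "G (h1 p) = F (h2 (\<psi> p))" if "p \<in> points S1" for p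
      using fun_cong[OF F(2), of p] that by simp
    then show ?thesis using F(1) by blast
  qed
  have pull21: "\<exists>F\<in>O_curve V1. \<forall>q\<in>points S2. G (h2 q) = F (h1 (\<psi>' q))" if G: "G \<in> O_curve V2" for G
  proof -
    have "restrict (G \<circ> h2 \<circ> \<psi>) (points S1) \<in> {restrict (F \<circ> h1) (points S1) | F. F \<in> O_curve V1}"
      unfolding eq using G by blast
    then obtain F where F: "F \<in> O_curve V1"
        "restrict (G \<circ> h2 \<circ> \<psi>) (points S1) = restrict (F \<circ> h1) (points S1)" by blast
    have "G (h2 q) = F (h1 (\<psi>' q))" if "q \<in> points S2" for q
      using fun_cong[OF F(2), of "\<psi>' q"] that \<psi>' by simp
    then show ?thesis using F(1) by blast
  qed
  obtain \<phi>' where \<phi>': "holomorphic_curve_map V2 V1 \<phi>'" "\<And>p. p \<in> points S1 \<Longrightarrow> \<phi>' (h2 (\<psi> p)) = h1 p"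
  proof (rule curve_map_of_pullbacks[OF h2 h1 \<psi>'(1) _ pull12])
    show "\<exists>p\<in>points S1. \<psi> p = q" if "q \<in> points S2" for q using \<psi>' that by blast
  qed (assumption | rule that)+
  obtain \<phi> where \<phi>: "holomorphic_curve_map V1 V2 \<phi>" "\<And>q. q \<in> points S2 \<Longrightarrow> \<phi> (h1 (\<psi>' q)) = h2 q"
  proof (rule curve_map_of_pullbacks[OF h1 h2 \<psi>'(2) _ pull21])
    show "\<exists>q\<in>points S2. \<psi>' q = p" if "p \<in> points S1" for p using \<psi>' that by blast
  qed (assumption | rule that)+
  have comm: "\<phi> (h1 p) = h2 (\<psi> p)" if "p \<in> points S1" for p
    using \<phi>(2)[of "\<psi> p"] \<psi>' that by simp
  have inv1: "\<phi>' (\<phi> z) = z" if z: "z \<in> V1" for z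
  proof -
    obtain p where "p \<in> points S1" "z = h1 p" using z h1 by blast
    then show ?thesis by (simp add: comm \<phi>'(2))
  qed
  have inv2: "\<phi> (\<phi>' z) = z" if z: "z \<in> V2" for z
  proof -
    obtain q where q: "q \<in> points S2" "z = h2 q" using z h2 by blast
    then have "\<phi>' z = h1 (\<psi>' q)" using \<phi>'(2)[of "\<psi>' q"] \<psi>' by simp
    then show ?thesis using \<phi>(2) q by simp
  qed
  have im: "\<phi> ` V1 \<subseteq> V2" "\<phi>' ` V2 \<subseteq> V1"
    using \<phi>(1) \<phi>'(1) unfolding holomorphic_curve_map_def by blast+
  have "homeomorphism V1 V2 \<phi> \<phi>'"
    by (rule homeomorphismI)
       (use im inv1 inv2 holomorphic_curve_map_continuous_on[OF \<phi>(1)]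
          holomorphic_curve_map_continuous_on[OF \<phi>'(1)] in auto)
  then have "biholomorphic_curve_map V1 V2 \<phi>"
    unfolding biholomorphic_curve_map_def using \<phi>(1) \<phi>'(1) by blast
  then show ?thesis using comm by auto
qed

theorem theorem3p1:
  fixes S1 :: "'a surface" and S2 :: "'b surface"
    and U1 V1 :: "(complex^'n) set" and U2 V2 :: "(complex^'m) set"
    and h1 :: "'a \<Rightarrow> complex^'n" and h2 :: "'b \<Rightarrow> complex^'m"
  assumes "riemann_surface S1" and "riemann_surface S2"
    and "hyperbolic_analytic_curve V1" and "hyperbolic_analytic_curve V2"
    and "holomap S1 U1 h1" and "h1 ` points S1 = V1"
    and "holomap S2 U2 h2" and "h2 ` points S2 = V2"
  shows "let
      i = (\<exists>\<phi>. biholomorphic_curve_map V1 V2 \<phi>);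
      ii = (\<exists>\<psi> \<phi>. biholomorphic_surface_map S1 S2 \<psi> \<and> biholomorphic_curve_map V1 V2 \<phi> \<and>
              (\<forall>p\<in>points S1. h2 (\<psi> p) = \<phi> (h1 p)));
      iii = (\<exists>\<psi>. biholomorphic_surface_map S1 S2 \<psi> \<and>
              {restrict (F \<circ> h1) (points S1) | F. F \<in> O_curve V1} =
              {restrict (G \<circ> h2 \<circ> \<psi>) (points S1) | G. G \<in> O_curve V2});
      iv = (\<exists>\<psi>. biholomorphic_surface_map S1 S2 \<psi> \<and>
              push_forward S1 S2 \<psi> ` connection S1 h1 V1 = connection S2 h2 V2)
    in (i \<longleftrightarrow> ii) \<and> (ii \<longleftrightarrow> iii) \<and> (iii \<longleftrightarrow> iv)"
proof -
  note S = assms(1,2) and h1 = assms(5,6) and h2 = assms(7,8)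
  \<comment> \<open>For a fixed \<open>\<psi>\<close> the conditions of (iii) and (iv) are
    equivalent, so the same map serves both.\<close>
  have iii_iv: "{restrict (F \<circ> h1) (points S1) | F. F \<in> O_curve V1} =
        {restrict (G \<circ> h2 \<circ> \<psi>) (points S1) | G. G \<in> O_curve V2} \<longleftrightarrow>
      push_forward S1 S2 \<psi> ` connection S1 h1 V1 = connection S2 h2 V2"
    if \<psi>: "biholomorphic_surface_map S1 S2 \<psi>" for \<psi>
  proof -
    have "\<psi> p \<in> points S2" if "p \<in> points S1" for p
      by (rule biholomorphic_surface_mapE[OF \<psi>]) (use that in blast)
    from pull_composites[where \<psi> = \<psi> and h = h2 and V = V2, OF this] show ?thesis
      using pullbacks_iff_connections[OF S h1 h2 \<psi>] by (simp only: pullbacks_def)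
  qed
  show ?thesis
    unfolding Let_def
  proof (intro conjI iffI; elim exE conjE)
    \<comment> \<open>The one implication in which a map of surfaces has to be constructed.\<close>
    fix \<phi> assume \<phi>: "biholomorphic_curve_map V1 V2 \<phi>"
    show "\<exists>\<psi> \<phi>. biholomorphic_surface_map S1 S2 \<psi> \<and> biholomorphic_curve_map V1 V2 \<phi> \<and>
        (\<forall>p\<in>points S1. h2 (\<psi> p) = \<phi> (h1 p))"
      using curve_isomorphism_lifts[OF S h1 h2 \<phi>] \<phi> by blast
  next
    fix \<psi> \<phi> assume \<psi>: "biholomorphic_surface_map S1 S2 \<psi>" and \<phi>: "biholomorphic_curve_map V1 V2 \<phi>"
      and "\<forall>p\<in>points S1. h2 (\<psi> p) = \<phi> (h1 p)"
    then have comm: "\<And>p. p \<in> points S1 \<Longrightarrow> h2 (\<psi> p) = \<phi> (h1 p)" by blast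
    show "\<exists>\<phi>. biholomorphic_curve_map V1 V2 \<phi>" using \<phi> by blast
    show "\<exists>\<psi>. biholomorphic_surface_map S1 S2 \<psi> \<and>
        {restrict (F \<circ> h1) (points S1) | F. F \<in> O_curve V1} =
        {restrict (G \<circ> h2 \<circ> \<psi>) (points S1) | G. G \<in> O_curve V2}"
      by (rule exI, rule conjI, rule \<psi>, rule intertwined_imp_pullbacks_eq[OF h1(2) h2(2) \<psi> \<phi> comm])
  next
    fix \<psi> assume \<psi>: "biholomorphic_surface_map S1 S2 \<psi>"
      and eq: "{restrict (F \<circ> h1) (points S1) | F. F \<in> O_curve V1} =
        {restrict (G \<circ> h2 \<circ> \<psi>) (points S1) | G. G \<in> O_curve V2}"
    show "\<exists>\<psi> \<phi>. biholomorphic_surface_map S1 S2 \<psi> \<and> biholomorphic_curve_map V1 V2 \<phi> \<and>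
        (\<forall>p\<in>points S1. h2 (\<psi> p) = \<phi> (h1 p))"
      using pullbacks_eq_imp_intertwined[OF h1(2) h2(2) \<psi> eq] \<psi> by (elim exE, intro exI conjI) auto
    show "\<exists>\<psi>. biholomorphic_surface_map S1 S2 \<psi> \<and>
        push_forward S1 S2 \<psi> ` connection S1 h1 V1 = connection S2 h2 V2"
      using \<psi> iii_iv[OF \<psi>, THEN iffD1, OF eq] by (intro exI conjI)
  next
    fix \<psi> assume \<psi>: "biholomorphic_surface_map S1 S2 \<psi>"
      and eq: "push_forward S1 S2 \<psi> ` connection S1 h1 V1 = connection S2 h2 V2"
    show "\<exists>\<psi>. biholomorphic_surface_map S1 S2 \<psi> \<and>
        {restrict (F \<circ> h1) (points S1) | F. F \<in> O_curve V1} =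
        {restrict (G \<circ> h2 \<circ> \<psi>) (points S1) | G. G \<in> O_curve V2}"
      using \<psi> iii_iv[OF \<psi>, THEN iffD2, OF eq] by (intro exI conjI)
  qed
qed

end
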